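(* Let $d\ge 2$ and let $n_0\in L^{\infty}_{4d+12}(\mathbb{R}^d)$ with $n_0\ge 0$. Then there exists $T=T\left(\|n_0\|_{\infty,4d+12}\right)>0$ such that the capillary wave kinetic equation $$\frac{\partial n_k}{\partial t}=S(n_k),\qquad n_k(0)=n_0(k),$$ has a (non-negative) strong solution $$n_k=n(t,k)\in C\left([0,T];L^{\infty}_{2(d+1)}(\mathbb{R}^d)\right)\subseteq C\left([0,T];L^1(\mathbb{R}^d)\right).$$ Moreover, $$\sup_{t\in[0,T]}\|n(t,\cdot)\|_{\infty,4d+12}\le 2\|n_0\|_{\infty,4d+12}.$$
   Context: Weighted spaces: $\langle k\rangle=(1+|k|^2)^{1/2}$; for $1\le p\le\infty$, $s\ge 0$, $L^p_s(\mathbb{R}^d)$ is the space of measurable $f:\mathbb{R}^d\to\mathbb{R}$ with $\|f\|_{p,s}:=\|\langle k\rangle^s f\|_{L^p(\mathbb{R}^d)}<\infty$. Collision operator: $\omega_k=|k|^{3/2}$, $n_k=n(k)$, and $$S(n_k)=\iint_{\mathbb{R}^{2d}}\left(R_{kk_1k_2}-R_{k_1kk_2}-R_{k_2kk_1}\right)dk_1\,dk_2,$$ where, for $x,y,z\in\mathbb{R}^d$, $$R_{xyz}=4\pi|V_{xyz}|^2\,\delta(x-y-z)\,\delta(\omega_x-\omega_y-\omega_z)\left(n_yn_z-n_xn_y-n_xn_z\right),$$ $$V_{xyz}=\frac{1}{8\pi\sqrt2}(\omega_x\omega_y\omega_z)^{1/2}\left[\frac{L_{y,z}}{|y|^{1/2}|z|^{1/2}|x|}-\frac{L_{x,-y}}{|x|^{1/2}|y|^{1/2}|z|}-\frac{L_{x,-z}}{|x|^{1/2}|z|^{1/2}|y|}\right],\qquad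 L_{y,z}=y\cdot z+|y||z|.$$ Delta functions: for fixed $k\neq0$, the vector delta function is used to eliminate one variable (e.g. $k_1=k-k_2$ for $\delta(k-k_1-k_2)$, $k_1=k+k_2$ for $\delta(k_1-k-k_2)$, $k_2=k+k_1$ for $\delta(k_2-k-k_1)$), and the remaining scalar delta is interpreted by $\int_{\mathbb{R}^d}\delta(\phi(y))f(y)\,dy=\int_{\{\phi=0\}}f\,|\nabla\phi|^{-1}\,d\mathcal{H}^{d-1}$. Strong solution: $n\ge0$, $n(0,\cdot)=n_0$, and the equation holds in the sense $n(t)=n_0+\int_0^tS(n(s))\,ds$ for all $t\in[0,T]$ (equality for almost every $k$), where $S(n(s))$ is the function of $k$ given by the integral $\iint_{\mathbb{R}^{2d}}\left(R_{kk_1k_2}-R_{k_1kk_2}-R_{k_2kk_1}\right)dk_1\,dk_2$ with $n=n(s,\cdot)$, in which each vector delta function eliminates one variable and each remaining scalar delta is interpreted by the surface-measure formula $\int_{\mathbb{R}^d}\delta(\phi(y))f(y)\,dy=\int_{\{\phi=0\}}f\,|\nabla\phi|^{-1}\,d\mathcal{H}^{d-1}$. $C([0,T];B)$ denotes continuous maps from $[0,T]$ into the Banach space $B$. *)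

theory Defs
  imports "HOL-Analysis.Analysis" "HOL-Probability.Essential_Supremum"
begin

section \<open>Weighted Lebesgue spaces\<close>

definition jap :: "'a::euclidean_space \<Rightarrow> real" where
  "jap k = sqrt (1 + (norm k)\<^sup>2)"

text \<open>The norm takes the value \<open>\<infinity>\<close> outside the space. Functions are not quotiented
  by almost-everywhere equality, so statements about them are made almost everywhere.\<close>

definition wnorm :: "ennreal \<Rightarrow> real \<Rightarrow> ('a::euclidean_space \<Rightarrow> real) \<Rightarrow> ennreal" where
  "wnorm p s f =
     (if p = \<infinity> then esssup lebesgue (\<lambda>k. ennreal \<bar>jap k powr s * f k\<bar>)
      else let I = (\<integral>\<^sup>+k. ennreal (\<bar>jap k powr s * f k\<bar> powr enn2real p) \<partial>lebesgue)
           in if I = \<infinity> then \<infinity> else ennreal (enn2real I powr (1 / enn2real p)))"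

definition wLp :: "ennreal \<Rightarrow> real \<Rightarrow> ('a::euclidean_space \<Rightarrow> real) set" where
  "wLp p s = {f. f \<in> borel_measurable lebesgue \<and> wnorm p s f < \<infinity>}"

definition C_wLp :: "real \<Rightarrow> ennreal \<Rightarrow> real \<Rightarrow> (real \<Rightarrow> 'a::euclidean_space \<Rightarrow> real) set" where
  "C_wLp T p s =
     {n. (\<forall>t\<in>{0..T}. n t \<in> wLp p s) \<and>
         (\<forall>t\<in>{0..T}. ((\<lambda>\<tau>. wnorm p s (\<lambda>k. n \<tau> k - n t k)) \<longlongrightarrow> 0) (at t within {0..T}))}"

section \<open>Hausdorff measure\<close>

text \<open>The normalising constant is the one for which the m-dimensional Hausdorff measure of
  m-dimensional Euclidean space is Lebesgue measure. Boundedness is required explicitly because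
  the library assigns diameter 0 to unbounded sets.\<close>

definition hausdorff_gauge :: "nat \<Rightarrow> 'a::euclidean_space set \<Rightarrow> ennreal" where
  "hausdorff_gauge m U =
     (if U = {} then 0 else ennreal (unit_ball_vol (real m) * (diameter U / 2) ^ m))"

definition hausdorff_pre :: "nat \<Rightarrow> real \<Rightarrow> 'a::euclidean_space set \<Rightarrow> ennreal" where
  "hausdorff_pre m \<delta> A =
     (INF U\<in>{U :: nat \<Rightarrow> 'a set. A \<subseteq> (\<Union>i. U i) \<and> (\<forall>i. bounded (U i) \<and> diameter (U i) \<le> \<delta>)}.
        \<Sum>i. hausdorff_gauge m (U i))"

definition hausdorff_outer :: "nat \<Rightarrow> 'a::euclidean_space set \<Rightarrow> ennreal" where
  "hausdorff_outer m A = (SUP \<delta>\<in>{0<..}. hausdorff_pre m \<delta> A)"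

definition hausdorff :: "nat \<Rightarrow> 'a::euclidean_space measure" where
  "hausdorff m = measure_of UNIV (lambda_system UNIV UNIV (hausdorff_outer m)) (hausdorff_outer m)"

lemma hausdorff_pre_mono: "A \<subseteq> B \<Longrightarrow> hausdorff_pre m \<delta> A \<le> hausdorff_pre m \<delta> B"
  unfolding hausdorff_pre_def by (rule INF_superset_mono) auto

lemma hausdorff_pre_empty: "0 < \<delta> \<Longrightarrow> hausdorff_pre m \<delta> {} = 0"
  unfolding hausdorff_pre_def
  by (rule antisym, rule INF_lower2[of "\<lambda>_. {}"]) (auto simp: hausdorff_gauge_def)

lemma hausdorff_pre_UN:
  fixes A :: "nat \<Rightarrow> 'a::euclidean_space set"
  shows "hausdorff_pre m \<delta> (\<Union>i. A i) \<le> (\<Sum>i. hausdorff_pre m \<delta> (A i))"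
proof (rule ennreal_le_epsilon)
  fix e :: real assume fin: "(\<Sum>i. hausdorff_pre m \<delta> (A i)) < top" and e: "0 < e"
  have "\<exists>U :: nat \<Rightarrow> 'a set. A i \<subseteq> (\<Union>j. U j) \<and> (\<forall>j. bounded (U j) \<and> diameter (U j) \<le> \<delta>) \<and>
      (\<Sum>j. hausdorff_gauge m (U j)) \<le> hausdorff_pre m \<delta> (A i) + ennreal (e * (1/2) ^ Suc i)" for i
  proof -
    have "hausdorff_pre m \<delta> (A i) < top"
      using fin by (metis ennreal_suminf_lessD)
    then have "hausdorff_pre m \<delta> (A i) < hausdorff_pre m \<delta> (A i) + ennreal (e * (1/2) ^ Suc i)"
      using e ennreal_add_left_cancel_less[of "hausdorff_pre m \<delta> (A i)" 0 "ennreal (e * (1/2) ^ Suc i)"]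
      by (simp add: less_top[symmetric])
    then show ?thesis
      unfolding hausdorff_pre_def[of m \<delta> "A i"] INF_less_iff by (auto intro: less_imp_le)
  qed
  then obtain U :: "nat \<Rightarrow> nat \<Rightarrow> 'a set" where
    U: "\<And>i. A i \<subseteq> (\<Union>j. U i j)" "\<And>i j. bounded (U i j)" "\<And>i j. diameter (U i j) \<le> \<delta>"
       "\<And>i. (\<Sum>j. hausdorff_gauge m (U i j)) \<le> hausdorff_pre m \<delta> (A i) + ennreal (e * (1/2) ^ Suc i)"
    by metis
  let ?f = "\<lambda>(i, j). U i j"
  have "hausdorff_pre m \<delta> (\<Union>i. A i) \<le> (\<Sum>l. hausdorff_gauge m (?f (prod_decode l)))"
    unfolding hausdorff_pre_def
  proof (rule INF_lower, intro CollectI conjI allI subsetI, elim UN_E)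
    fix x i assume "x \<in> A i"
    then obtain j where "x \<in> U i j" using U(1) by blast
    then have "x \<in> ?f (prod_decode (prod_encode (i, j)))" by simp
    then show "x \<in> (\<Union>l. ?f (prod_decode l))" by (rule UN_I[OF UNIV_I])
  qed (simp_all add: U(2,3) split: prod.split)
  also have "\<dots> = (\<Sum>i. \<Sum>j. hausdorff_gauge m (U i j))"
    using suminf_ennreal_2dimen[of "\<lambda>i. \<Sum>j. hausdorff_gauge m (U i j)" "\<lambda>p. hausdorff_gauge m (?f p)"]
    by simp
  also have "\<dots> \<le> (\<Sum>i. hausdorff_pre m \<delta> (A i) + ennreal (e * (1/2) ^ Suc i))"
    by (intro suminf_le U summableI)
  also have "\<dots> = (\<Sum>i. hausdorff_pre m \<delta> (A i)) + (\<Sum>i. ennreal (e * (1/2) ^ Suc i))"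
    by (rule suminf_add[symmetric]) auto
  also have "(\<Sum>i. ennreal (e * (1/2) ^ Suc i)) = ennreal e"
  proof -
    have "(\<lambda>i. e * (1/2) ^ Suc i) sums (e * 1)"
      by (intro sums_mult power_half_series)
    then show ?thesis
      using e by (intro suminf_ennreal_eq) auto
  qed
  finally show "hausdorff_pre m \<delta> (\<Union>i. A i) \<le> (\<Sum>i. hausdorff_pre m \<delta> (A i)) + ennreal e" .
qed

lemma outer_measure_space_hausdorff: "outer_measure_space UNIV (hausdorff_outer m)"
  unfolding outer_measure_space_def positive_def increasing_def countably_subadditive_def
proof (intro conjI allI impI ballI)
  show "hausdorff_outer m {} = 0"
    by (simp add: hausdorff_outer_def hausdorff_pre_empty)
next
  fix A B :: "'a set" assume "A \<subseteq> B"
  then show "hausdorff_outer m A \<le> hausdorff_outer m B"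
    unfolding hausdorff_outer_def by (intro SUP_mono' hausdorff_pre_mono)
next
  fix A :: "nat \<Rightarrow> 'a set"
  show "hausdorff_outer m (\<Union>i. A i) \<le> (\<Sum>i. hausdorff_outer m (A i))"
    unfolding hausdorff_outer_def[of m "\<Union>i. A i"]
  proof (rule SUP_least)
    fix \<delta> :: real assume "\<delta> \<in> {0<..}"
    then have "(\<Sum>i. hausdorff_pre m \<delta> (A i)) \<le> (\<Sum>i. hausdorff_outer m (A i))"
      unfolding hausdorff_outer_def by (intro suminf_le summableI SUP_upper)
    then show "hausdorff_pre m \<delta> (\<Union>i. A i) \<le> (\<Sum>i. hausdorff_outer m (A i))"
      using hausdorff_pre_UN order_trans by blast
  qed
qed

lemma measure_space_hausdorff:
  "measure_space UNIV (lambda_system UNIV UNIV (hausdorff_outer m)) (hausdorff_outer m)"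
proof -
  interpret sigma_algebra UNIV "UNIV :: 'a set set"
    using sigma_algebra_Pow[of "UNIV :: 'a set"] by simp
  show "measure_space UNIV (lambda_system UNIV UNIV (hausdorff_outer m))
          (hausdorff_outer m :: 'a set \<Rightarrow> _)"
    by (rule caratheodory_lemma[OF outer_measure_space_hausdorff])
qed

lemma space_hausdorff [simp]: "space (hausdorff m) = UNIV"
  by (simp add: hausdorff_def space_measure_of)

lemma sets_hausdorff: "sets (hausdorff m) = lambda_system UNIV UNIV (hausdorff_outer m)"
  unfolding hausdorff_def
  by (rule sigma_algebra.sets_measure_of_eq) (use measure_space_hausdorff in \<open>auto simp: measure_space_def\<close>)

lemma emeasure_hausdorff:
  "A \<in> sets (hausdorff m) \<Longrightarrow> emeasure (hausdorff m) A = hausdorff_outer m A"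
  unfolding sets_hausdorff unfolding hausdorff_def
  by (rule emeasure_measure_of_sigma) (use measure_space_hausdorff in \<open>auto simp: measure_space_def\<close>)

section \<open>Scalar delta functions\<close>

definition grad :: "('a::euclidean_space \<Rightarrow> real) \<Rightarrow> 'a \<Rightarrow> 'a" where
  "grad \<phi> y = (THE D. GDERIV \<phi> y :> D)"

definition delta_integrable :: "('a::euclidean_space \<Rightarrow> real) \<Rightarrow> ('a \<Rightarrow> real) \<Rightarrow> bool" where
  "delta_integrable \<phi> f \<longleftrightarrow>
     set_integrable (hausdorff (DIM('a) - 1)) {y. \<phi> y = 0} (\<lambda>y. f y / norm (grad \<phi> y))"

definition delta_integral :: "('a::euclidean_space \<Rightarrow> real) \<Rightarrow> ('a \<Rightarrow> real) \<Rightarrow> real" where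
  "delta_integral \<phi> f =
     (LINT y:{y. \<phi> y = 0}|hausdorff (DIM('a) - 1). f y / norm (grad \<phi> y))"

section \<open>Collision operator\<close>

definition omega :: "'a::euclidean_space \<Rightarrow> real" where
  "omega k = norm k powr (3/2)"

definition Lc :: "'a::euclidean_space \<Rightarrow> 'a \<Rightarrow> real" where
  "Lc y z = y \<bullet> z + norm y * norm z"

definition V :: "'a::euclidean_space \<Rightarrow> 'a \<Rightarrow> 'a \<Rightarrow> real" where
  "V x y z = 1 / (8 * pi * sqrt 2) * sqrt (omega x * omega y * omega z) *
     (Lc y z / (sqrt (norm y) * sqrt (norm z) * norm x)
      - Lc x (- y) / (sqrt (norm x) * sqrt (norm y) * norm z)
      - Lc x (- z) / (sqrt (norm x) * sqrt (norm z) * norm y))"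

text \<open>The kernel \<open>R\<close> stripped of its two delta functions.\<close>

definition R0 :: "('a::euclidean_space \<Rightarrow> real) \<Rightarrow> 'a \<Rightarrow> 'a \<Rightarrow> 'a \<Rightarrow> real" where
  "R0 n x y z = 4 * pi * \<bar>V x y z\<bar>\<^sup>2 * (n y * n z - n x * n y - n x * n z)"

text \<open>In the three terms the vector delta eliminates \<open>k\<^sub>1 = k - k\<^sub>2\<close>, \<open>k\<^sub>1 = k + k\<^sub>2\<close> and
  \<open>k\<^sub>2 = k + k\<^sub>1\<close>; the bound variable \<open>q\<close> is the one that remains.\<close>

definition S :: "('a::euclidean_space \<Rightarrow> real) \<Rightarrow> 'a \<Rightarrow> real" where
  "S n k =
     delta_integral (\<lambda>q. omega k - omega (k - q) - omega q) (\<lambda>q. R0 n k (k - q) q)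
     - delta_integral (\<lambda>q. omega (k + q) - omega k - omega q) (\<lambda>q. R0 n (k + q) k q)
     - delta_integral (\<lambda>q. omega (k + q) - omega k - omega q) (\<lambda>q. R0 n (k + q) k q)"

text \<open>Needed because the Bochner integral of a non-integrable function is 0 by convention.\<close>

definition S_converges :: "('a::euclidean_space \<Rightarrow> real) \<Rightarrow> 'a \<Rightarrow> bool" where
  "S_converges n k \<longleftrightarrow>
     delta_integrable (\<lambda>q. omega k - omega (k - q) - omega q) (\<lambda>q. R0 n k (k - q) q) \<and>
     delta_integrable (\<lambda>q. omega (k + q) - omega k - omega q) (\<lambda>q. R0 n (k + q) k q)"

definition strong_solution ::
    "real \<Rightarrow> ('a::euclidean_space \<Rightarrow> real) \<Rightarrow> (real \<Rightarrow> 'a \<Rightarrow> real) \<Rightarrow> bool" where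
  "strong_solution T n0 n \<longleftrightarrow>
     (\<forall>t\<in>{0..T}. AE k in lebesgue. 0 \<le> n t k) \<and>
     (AE k in lebesgue. n 0 k = n0 k) \<and>
     (\<forall>t\<in>{0..T}. AE k in lebesgue. S_converges (n t) k) \<and>
     (\<forall>t\<in>{0..T}. AE k in lebesgue.
        set_integrable lebesgue {0..t} (\<lambda>s. S (n s) k) \<and>
        n t k = n0 k + (LINT s:{0..t}|lebesgue. S (n s) k))"

end

theory Submission
  imports Defs
begin

text \<open>Write \<open>S n = influx n - damping n * n\<close>, where \<open>influx\<close> and \<open>damping\<close> are integrals of
  nonnegative functions over the resonance surfaces. The damping grows like a power of \<open>k\<close>, and the
  influx loses as much; but in a decay \<open>k = b + h\<close> the resonance condition makes the weights at \<open>b\<close> and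
  \<open>k\<close> agree up to a factor \<open>1 + O(omega h / omega k)\<close>, so against a power weight the influx exceeds the
  damping only by a bounded amount. Hence the Duhamel map of the linear equation
  \<open>y' = influx n - damping n * y\<close> preserves \<open>0 \<le> n \<le> M exp (\<kappa> t) jap k powr -(4d+12)\<close>.
  In the weaker norm with exponent \<open>2(d+1)\<close> the same cancellation makes it a strict contraction on
  bounded sets of \<open>k\<close>, while for large \<open>k\<close> the heavier weight makes differences small, and this
  suffices for the iterates to converge. The surfaces have (d-1)-dimensional mass at most \<open>C r^(d-1)\<close> in every
  ball of radius \<open>r\<close>, one being the boundary of a convex body and the other a Lipschitz graph. All functions
  are everywhere-defined Borel functions, so that restrictions to the surfaces make sense; integrals over the
  surfaces depend measurably on \<open>k\<close> because similarities carry each of them to a fixed surface.\<close>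

section \<open>Hausdorff measure\<close>

text \<open>The obstacle is that the bound on \<open>damping\<close> grows like
  \<open>omega k\<close>: estimating the two halves of \<open>S\<close> separately loses 3/2 powers
  of \<open>k\<close> in every iteration. The damping therefore stays in the exponential of the
  Duhamel formula, and only the excess of influx over damping is estimated. That excess is uniform
  in \<open>k\<close> because both kernels, integrated against a decaying weight over the surface of
  \<open>k\<close>, give at most a constant times \<open>omega k\<close>, which cancels the
  denominator of the relative error \<open>omega h / omega k\<close>. In the comparison of two
  solutions, the difference may also fall on the short wave vector or on the damping coefficient. No
  resonance gain is available there; instead a factor with the heavy weight at \<open>k\<close> is
  left over, and the gap between the exponents 4d+12 and 2d+2 absorbs \<open>omega k\<close>. This
  is why two weights are used: the heavy one is propagated, the light one measures distances. Any
  bound on the damping is local in \<open>k\<close>, so the contraction factor tends to 1 as larger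
  \<open>k\<close> are included. Hence the contraction is only asserted down to a positive floor,
  which is arbitrary.\<close>

lemma hausdorff_pre_antimono:
  "\<delta> \<le> \<delta>' \<Longrightarrow> hausdorff_pre m \<delta>' A \<le> hausdorff_pre m \<delta> A"
  unfolding hausdorff_pre_def by (rule INF_superset_mono) (auto intro: order_trans)

text \<open>No set of diameter at most \<delta> meets both A and B, so a cover of the union splits
  into a cover of A and one of B that share no nonempty member.\<close>

lemma hausdorff_pre_Un_separated:
  fixes A B :: "'a::euclidean_space set"
  assumes sep: "\<And>a b. a \<in> A \<Longrightarrow> b \<in> B \<Longrightarrow> \<delta> < dist a b"
  shows "hausdorff_pre m \<delta> A + hausdorff_pre m \<delta> B \<le> hausdorff_pre m \<delta> (A \<union> B)"
  unfolding hausdorff_pre_def[of m \<delta> "A \<union> B"]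
proof (rule INF_greatest)
  fix U :: "nat \<Rightarrow> 'a set"
  assume "U \<in> {U. A \<union> B \<subseteq> (\<Union>i. U i) \<and> (\<forall>i. bounded (U i) \<and> diameter (U i) \<le> \<delta>)}"
  then have U: "A \<union> B \<subseteq> (\<Union>i. U i)" "\<And>i. bounded (U i)" "\<And>i. diameter (U i) \<le> \<delta>" by auto
  have d0: "0 \<le> \<delta>" using U(3)[of 0] diameter_ge_0[OF U(2)[of 0]] by linarith
  \<comment> \<open>Members that miss C are replaced by the empty set. It has gauge 0, and its
    diameter 0 is admissible by \<open>d0\<close>.\<close>
  define P where "P C i = (if U i \<inter> C = {} then {} else U i)" for C i
  have P: "hausdorff_pre m \<delta> C \<le> (\<Sum>i. hausdorff_gauge m (P C i))" if "C \<subseteq> A \<union> B" for C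
    unfolding hausdorff_pre_def
    by (rule INF_lower) (use that U d0 in \<open>fastforce simp: P_def\<close>)
  have "hausdorff_gauge m (P A i) + hausdorff_gauge m (P B i) \<le> hausdorff_gauge m (U i)" for i
  proof (cases "U i \<inter> A = {} \<or> U i \<inter> B = {}")
    case True
    then show ?thesis by (auto simp: P_def hausdorff_gauge_def)
  next
    case False
    then obtain a b where "a \<in> U i" "a \<in> A" "b \<in> U i" "b \<in> B" by auto
    with sep[of a b] diameter_bounded_bound[OF U(2)[of i], of a b] U(3)[of i] show ?thesis by auto
  qed
  then have "(\<Sum>i. hausdorff_gauge m (P A i) + hausdorff_gauge m (P B i)) \<le> (\<Sum>i. hausdorff_gauge m (U i))"
    by (intro suminf_le summableI)
  moreover have "(\<Sum>i. hausdorff_gauge m (P A i) + hausdorff_gauge m (P B i))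
      = (\<Sum>i. hausdorff_gauge m (P A i)) + (\<Sum>i. hausdorff_gauge m (P B i))"
    by (rule suminf_add[symmetric]) auto
  ultimately show "hausdorff_pre m \<delta> A + hausdorff_pre m \<delta> B \<le> (\<Sum>i. hausdorff_gauge m (U i))"
    using add_mono[OF P[of A] P[of B]] by (auto intro: order_trans)
qed

text \<open>The suprema on the left run over independent scales d1 and d2. A common scale below both
  and below e suffices, since the premeasures increase as the scale shrinks.\<close>

lemma hausdorff_outer_Un_separated:
  fixes A B :: "'a::euclidean_space set"
  assumes e: "0 < e" and sep: "\<And>a b. a \<in> A \<Longrightarrow> b \<in> B \<Longrightarrow> e \<le> dist a b"
  shows "hausdorff_outer m A + hausdorff_outer m B \<le> hausdorff_outer m (A \<union> B)"
proof -
  have "hausdorff_pre m d1 A + hausdorff_pre m d2 B \<le> hausdorff_outer m (A \<union> B)" if "0 < d1" "0 < d2" for d1 d2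
  proof -
    define d where "d = min (min d1 d2) (e/2)"
    have d: "0 < d" "d \<le> d1" "d \<le> d2" "d < e" using that e by (auto simp: d_def)
    have "hausdorff_pre m d1 A + hausdorff_pre m d2 B \<le> hausdorff_pre m d A + hausdorff_pre m d B"
      by (intro add_mono hausdorff_pre_antimono d)
    also have "\<dots> \<le> hausdorff_pre m d (A \<union> B)"
      using sep d by (intro hausdorff_pre_Un_separated) (meson less_le_trans)
    also have "\<dots> \<le> hausdorff_outer m (A \<union> B)"
      unfolding hausdorff_outer_def using d by (intro SUP_upper) auto
    finally show ?thesis .
  qed
  then have "(SUP d2\<in>{0<..}. hausdorff_pre m d1 A + hausdorff_pre m d2 B) \<le> hausdorff_outer m (A \<union> B)" if "0 < d1" for d1
    using that by (intro SUP_least) auto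
  then have "hausdorff_pre m d1 A + hausdorff_outer m B \<le> hausdorff_outer m (A \<union> B)" if "0 < d1" for d1
    using that ennreal_SUP_add_right[of "{0<..}::real set" "hausdorff_pre m d1 A" "\<lambda>d. hausdorff_pre m d B"]
    by (simp add: hausdorff_outer_def)
  then have "(SUP d1\<in>{0<..}. hausdorff_pre m d1 A + hausdorff_outer m B) \<le> hausdorff_outer m (A \<union> B)"
    by (intro SUP_least) auto
  then show ?thesis
    using ennreal_SUP_add_left[of "{0<..}::real set" "\<lambda>d. hausdorff_pre m d A" "hausdorff_outer m B"]
    by (simp add: hausdorff_outer_def)
qed

lemma hausdorff_outer_mono: "A \<subseteq> B \<Longrightarrow> hausdorff_outer m A \<le> hausdorff_outer m B"
  using outer_measure_space_hausdorff[of m] unfolding outer_measure_space_def increasing_def by auto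

lemma hausdorff_outer_empty [simp]: "hausdorff_outer m {} = 0"
  using outer_measure_space_hausdorff[of m] unfolding outer_measure_space_def positive_def by auto

lemma hausdorff_outer_UN:
  fixes A :: "nat \<Rightarrow> 'a::euclidean_space set"
  shows "hausdorff_outer m (\<Union>i. A i) \<le> (\<Sum>i. hausdorff_outer m (A i))"
  unfolding hausdorff_outer_def[of m "\<Union>i. A i"]
proof (rule SUP_least)
  fix \<delta> :: real assume "\<delta> \<in> {0<..}"
  then have "(\<Sum>i. hausdorff_pre m \<delta> (A i)) \<le> (\<Sum>i. hausdorff_outer m (A i))"
    unfolding hausdorff_outer_def by (intro suminf_le summableI SUP_upper)
  then show "hausdorff_pre m \<delta> (\<Union>i. A i) \<le> (\<Sum>i. hausdorff_outer m (A i))"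
    using hausdorff_pre_UN order_trans by blast
qed

lemma hausdorff_outer_Un: "hausdorff_outer m (A \<union> B) \<le> hausdorff_outer m A + hausdorff_outer m B"
proof -
  have "hausdorff_outer m (\<Union>i. (if i = 0 then A else if i = Suc 0 then B else {}))
     \<le> (\<Sum>i. hausdorff_outer m (if i = 0 then A else if i = Suc 0 then B else {}))"
    by (rule hausdorff_outer_UN)
  also have "\<dots> = (\<Sum>i\<in>{0, Suc 0}. hausdorff_outer m (if i = 0 then A else if i = Suc 0 then B else {}))"
    by (rule suminf_finite) auto
  also have "\<dots> = hausdorff_outer m A + hausdorff_outer m B" by simp
  also have "(\<Union>i. (if i = 0 then A else if i = Suc 0 then B else {})) = A \<union> B"
    by (auto split: if_splits)
  finally show ?thesis .
qed

text \<open>Caratheodory's criterion: the shells \<open>R j\<close> of the complement of a closed set are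
  separated as soon as their indices differ by two, so their masses are summable.\<close>

lemma closed_in_sets_hausdorff:
  fixes F :: "'a::euclidean_space set"
  assumes F: "closed F"
  shows "F \<in> sets (hausdorff m)"
proof (cases "F = {}")
  case True then show ?thesis by simp
next
  case ne: False
  let ?o = "hausdorff_outer m :: 'a set \<Rightarrow> ennreal"
  have le: "?o (F \<inter> X) + ?o (X - F) \<le> ?o X" for X
  proof (cases "?o X = \<infinity>")
    case True then show ?thesis by simp
  next
    case fin: False
    define B where "B n = {x \<in> X. 1 / (real n + 1) \<le> infdist x F}" for n :: nat
    define R where "R n = B (Suc n) - B n" for n
    have Bmono: "B i \<subseteq> B j" if "i \<le> j" for i j
    proof -
      have "1 / (real j + 1) \<le> 1 / (real i + 1)" using that by (intro divide_left_mono) auto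
      then show ?thesis by (auto simp: B_def)
    qed
    have BX: "B n \<subseteq> X - F" for n
    proof
      fix x assume x: "x \<in> B n"
      then have "1 / (real n + 1) \<le> infdist x F" by (simp add: B_def)
      moreover have "0 < 1 / (real n + 1)" by simp
      ultimately have "infdist x F > 0" by linarith
      then show "x \<in> X - F" using x by (auto simp: B_def)
    qed
    have dFB: "1 / (real n + 1) \<le> dist a b" if "a \<in> F" "b \<in> B n" for a b n
      using that infdist_le[of a F b] by (auto simp: B_def dist_commute)
    have cover: "X - F = B n \<union> (\<Union>j. R (n + j))" for n
    proof (intro equalityI subsetI)
      fix x assume x: "x \<in> X - F"
      then have "infdist x F > 0" using F ne infdist_pos_not_in_closed[of F x] by auto
      then obtain N :: nat where N: "1 / (real N + 1) < infdist x F"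
        by (metis add.commute nat_approx_posE of_nat_Suc)
      then have xN: "x \<in> B N" using x by (auto simp: B_def)
      define j where "j = (LEAST j. x \<in> B j)"
      have j: "x \<in> B j" unfolding j_def using xN by (rule LeastI)
      show "x \<in> B n \<union> (\<Union>j. R (n + j))"
      proof (cases "j \<le> n")
        case True then show ?thesis using j Bmono by auto
      next
        case False
        then obtain i where i: "j = Suc (n + i)" by (metis add_Suc_right less_imp_Suc_add not_le)
        then have "x \<notin> B (n + i)" unfolding j_def by (metis lessI not_less_Least)
        then have "x \<in> R (n + i)" using j i by (auto simp: R_def)
        then show ?thesis by auto
      qed
    next
      fix x assume "x \<in> B n \<union> (\<Union>j. R (n + j))"
      then show "x \<in> X - F" using BX unfolding R_def by blast
    qed
    have sepR: "1 / (real i + 2) - 1 / (real i + 3) \<le> dist a b"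
      if a: "a \<in> B (Suc i)" and b: "b \<in> R j" and ij: "i + 2 \<le> j" for a b i j
    proof -
      have "b \<notin> B j" "b \<in> X" using b by (auto simp: R_def B_def)
      then have "infdist b F < 1 / (real j + 1)" by (auto simp: B_def)
      also have "\<dots> \<le> 1 / (real i + 3)" using ij by (intro divide_left_mono) auto
      finally have "infdist b F < 1 / (real i + 3)" .
      moreover have "1 / (real i + 2) \<le> infdist a F" using a by (auto simp: B_def algebra_simps)
      moreover have "infdist a F \<le> infdist b F + dist a b" using infdist_triangle by blast
      ultimately show ?thesis by linarith
    qed
    \<comment> \<open>The parameter c selects the parity. Shells of the same parity are at positive
      distance, whereas consecutive ones may touch.\<close>
    have fin_sum: "(\<Sum>j<N. ?o (R (2 * j + c))) \<le> ?o (\<Union>j<N. R (2 * j + c))" for N c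
    proof (induction N)
      case (Suc N)
      have "?o (\<Union>j<N. R (2 * j + c)) + ?o (R (2 * N + c)) \<le> ?o ((\<Union>j<N. R (2 * j + c)) \<union> R (2 * N + c))"
      proof (cases "N = 0")
        case False
        define i where "i = 2 * (N - 1) + c"
        show ?thesis
        proof (rule hausdorff_outer_Un_separated[where e = "1 / (real i + 2) - 1 / (real i + 3)"])
          have "1 / (real i + 3) < 1 / (real i + 2)" by (intro divide_strict_left_mono) auto
          then show "0 < 1 / (real i + 2) - 1 / (real i + 3)" by simp
          fix a b assume a: "a \<in> (\<Union>j<N. R (2 * j + c))" and b: "b \<in> R (2 * N + c)"
          obtain j where j: "j < N" "a \<in> B (Suc (2 * j + c))" using a by (auto simp: R_def)
          have "Suc (2 * j + c) \<le> Suc i" using j(1) by (simp add: i_def)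
          then have "a \<in> B (Suc i)" using Bmono j(2) by blast
          then show "1 / (real i + 2) - 1 / (real i + 3) \<le> dist a b"
            using b False by (intro sepR) (auto simp: i_def)
        qed
      qed simp
      then have "(\<Sum>j<N. ?o (R (2 * j + c))) + ?o (R (2 * N + c)) \<le> ?o ((\<Union>j<N. R (2 * j + c)) \<union> R (2 * N + c))"
        using Suc.IH by (meson add_right_mono order_trans)
      then show ?case by (simp add: lessThan_Suc Un_commute add.commute)
    qed simp
    have half: "(\<Sum>j. ?o (R (2 * j + c))) \<le> ?o X" for c
    proof (rule suminf_le_const)
      fix N
      have "(\<Union>j<N. R (2 * j + c)) \<subseteq> X" by (auto simp: R_def B_def)
      then show "(\<Sum>j<N. ?o (R (2 * j + c))) \<le> ?o X"
        using fin_sum[of c N] hausdorff_outer_mono order_trans by blast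
    qed auto
    have "(\<Sum>j. ?o (R j)) \<le> ?o X + ?o X"
    proof (rule suminf_le_const)
      fix N
      have "(\<Sum>j<N. ?o (R j)) \<le> (\<Sum>j<2*N. ?o (R j))" by (intro sum_mono2) auto
      also have "\<dots> = (\<Sum>j<N. ?o (R (2 * j))) + (\<Sum>j<N. ?o (R (2 * j + 1)))"
        by (induction N) (auto simp: algebra_simps)
      also have "\<dots> \<le> (\<Sum>j. ?o (R (2 * j + 0))) + (\<Sum>j. ?o (R (2 * j + 1)))"
        using sum_le_suminf[of "\<lambda>j. ?o (R (2 * j + 0))" "{..<N}"] sum_le_suminf[of "\<lambda>j. ?o (R (2 * j + 1))" "{..<N}"]
        by (intro add_mono) auto
      also have "\<dots> \<le> ?o X + ?o X" by (intro add_mono half)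
      finally show "(\<Sum>j<N. ?o (R j)) \<le> ?o X + ?o X" .
    qed auto
    then have sfin: "(\<Sum>j. ?o (R j)) \<noteq> \<infinity>" using fin by (auto simp: top_unique)
    have tail: "(\<lambda>n. \<Sum>j. ?o (R (n + j))) \<longlonglongrightarrow> 0"
    proof -
      have sR: "summable (\<lambda>j. enn2real (?o (R j)))" and eR: "\<And>j. ?o (R j) = ennreal (enn2real (?o (R j)))"
      proof -
        have 1: "?o (R j) < top" for j using sfin by (metis ennreal_suminf_lessD infinity_ennreal_def less_top)
        show eR: "\<And>j. ?o (R j) = ennreal (enn2real (?o (R j)))" using 1 by (simp add: less_top)
        show "summable (\<lambda>j. enn2real (?o (R j)))"
          by (rule summable_suminf_not_top) (use sfin eR in auto)
      qed
      have "(\<Sum>j. ?o (R (n + j))) = ennreal (\<Sum>j. enn2real (?o (R (j + n))))" for n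
        by (subst eR, subst add.commute, intro suminf_ennreal2) (use summable_ignore_initial_segment[OF sR] in auto)
      moreover have "(\<lambda>n. \<Sum>j. enn2real (?o (R (j + n)))) \<longlonglongrightarrow> 0"
        using suminf_exist_split2[OF sR] .
      ultimately show ?thesis
        using tendsto_ennrealI[of "\<lambda>n. \<Sum>j. enn2real (?o (R (j + n)))" 0 sequentially] by simp
    qed
    \<comment> \<open>F is at positive distance from \<open>B n\<close>, so additivity holds for
      these two; what is missing from X - F is covered by a tail of the convergent shell
      series.\<close>
    have "?o (F \<inter> X) + ?o (X - F) \<le> ?o X + (\<Sum>j. ?o (R (n + j)))" for n
    proof -
      have "?o (X - F) \<le> ?o (B n) + ?o (\<Union>j. R (n + j))"
        unfolding cover[of n] by (rule hausdorff_outer_Un)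
      also have "\<dots> \<le> ?o (B n) + (\<Sum>j. ?o (R (n + j)))"
        by (intro add_mono hausdorff_outer_UN order_refl)
      finally have "?o (F \<inter> X) + ?o (X - F) \<le> (?o (F \<inter> X) + ?o (B n)) + (\<Sum>j. ?o (R (n + j)))"
        by (simp add: add.assoc add_left_mono)
      also have "?o (F \<inter> X) + ?o (B n) \<le> ?o ((F \<inter> X) \<union> B n)"
        by (rule hausdorff_outer_Un_separated[where e = "1 / (real n + 1)"]) (use dFB in auto)
      also have "\<dots> \<le> ?o X" using BX by (intro hausdorff_outer_mono) auto
      finally show ?thesis by (simp add: add_right_mono)
    qed
    moreover have "(\<lambda>n. ?o X + (\<Sum>j. ?o (R (n + j)))) \<longlonglongrightarrow> ?o X + 0"
      by (intro tendsto_add tendsto_const tail)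
    ultimately show ?thesis
      by (intro Lim_bounded2[where f = "\<lambda>n. ?o X + (\<Sum>j. ?o (R (n + j)))" and N = 0]) auto
  qed
  have "?o (F \<inter> X) + ?o ((UNIV - F) \<inter> X) = ?o X" for X
  proof (rule antisym)
    show "?o (F \<inter> X) + ?o ((UNIV - F) \<inter> X) \<le> ?o X" using le[of X] by (simp add: Diff_eq Int_commute)
    have "X = F \<inter> X \<union> (UNIV - F) \<inter> X" by auto
    then show "?o X \<le> ?o (F \<inter> X) + ?o ((UNIV - F) \<inter> X)" using hausdorff_outer_Un by metis
  qed
  then show ?thesis by (simp add: sets_hausdorff lambda_system_def)
qed

lemma borel_subset_sets_hausdorff: "sets borel \<subseteq> sets (hausdorff m)"
proof -
  have "sigma_sets UNIV (Collect closed) \<subseteq> sets (hausdorff m)"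
    by (rule sets.sigma_sets_subset[of _ "hausdorff m", simplified]) (auto intro: closed_in_sets_hausdorff)
  then show ?thesis by (simp add: borel_eq_closed sets_measure_of_conv)
qed

lemma borel_measurable_hausdorff: "f \<in> borel_measurable borel \<Longrightarrow> f \<in> borel_measurable (hausdorff m)"
  using borel_subset_sets_hausdorff[of m] by (auto simp: measurable_def)

section \<open>Finite covers, Lipschitz images and similarities\<close>

lemma hausdorff_pre_le_gauge:
  assumes "bounded U" "diameter U \<le> \<delta>" "0 < \<delta>"
  shows "hausdorff_pre m \<delta> U \<le> hausdorff_gauge m U"
proof -
  have "hausdorff_pre m \<delta> U \<le> (\<Sum>i. hausdorff_gauge m (if i = (0::nat) then U else {}))"
    unfolding hausdorff_pre_def by (rule INF_lower) (use assms in \<open>auto split: if_splits\<close>)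
  also have "\<dots> = (\<Sum>i\<in>{0::nat}. hausdorff_gauge m (if i = (0::nat) then U else {}))"
    by (rule suminf_finite) (auto simp: hausdorff_gauge_def)
  finally show ?thesis by simp
qed

lemma hausdorff_pre_Un:
  assumes "0 < \<delta>"
  shows "hausdorff_pre m \<delta> (A \<union> B) \<le> hausdorff_pre m \<delta> A + hausdorff_pre m \<delta> B"
proof -
  have "hausdorff_pre m \<delta> (\<Union>i. (if i = 0 then A else if i = Suc 0 then B else {}))
     \<le> (\<Sum>i. hausdorff_pre m \<delta> (if i = 0 then A else if i = Suc 0 then B else {}))"
    by (rule hausdorff_pre_UN)
  also have "\<dots> = (\<Sum>i\<in>{0, Suc 0}. hausdorff_pre m \<delta> (if i = 0 then A else if i = Suc 0 then B else {}))"
    by (rule suminf_finite) (auto simp: hausdorff_pre_empty assms)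
  also have "\<dots> = hausdorff_pre m \<delta> A + hausdorff_pre m \<delta> B" by simp
  also have "(\<Union>i. (if i = 0 then A else if i = Suc 0 then B else {})) = A \<union> B"
    by (auto split: if_splits)
  finally show ?thesis .
qed

lemma hausdorff_pre_finite_UN:
  assumes "0 < \<delta>" "finite I"
  shows "hausdorff_pre m \<delta> (\<Union>i\<in>I. A i) \<le> (\<Sum>i\<in>I. hausdorff_pre m \<delta> (A i))"
  using assms(2)
proof induction
  case (insert i I)
  have "hausdorff_pre m \<delta> (\<Union>i\<in>insert i I. A i) \<le> hausdorff_pre m \<delta> (A i) + hausdorff_pre m \<delta> (\<Union>i\<in>I. A i)"
    using hausdorff_pre_Un[OF assms(1)] by simp
  also have "\<dots> \<le> hausdorff_pre m \<delta> (A i) + (\<Sum>i\<in>I. hausdorff_pre m \<delta> (A i))"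
    using insert.IH by (rule add_left_mono)
  finally show ?case using insert by simp
qed (simp add: hausdorff_pre_empty assms)

lemma hausdorff_outer_lipschitz:
  fixes T :: "'a::euclidean_space \<Rightarrow> 'b::euclidean_space"
  assumes L: "0 < L" and lip: "\<And>x y. x \<in> A \<Longrightarrow> y \<in> A \<Longrightarrow> dist (T x) (T y) \<le> L * dist x y"
  shows "hausdorff_outer m (T ` A) \<le> ennreal (L ^ m) * hausdorff_outer m A"
  unfolding hausdorff_outer_def[of m "T ` A"]
proof (rule SUP_least)
  fix \<delta> :: real assume "\<delta> \<in> {0<..}"
  then have d: "0 < \<delta>" by simp
  have inv: "ennreal (L ^ m) * (ennreal (1 / L ^ m) * x) = x" for x
    using L by (simp add: mult.assoc[symmetric] ennreal_mult[symmetric])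
  have inv': "ennreal (1 / L ^ m) * (ennreal (L ^ m) * x) = x" for x
    using L by (simp add: mult.assoc[symmetric] ennreal_mult[symmetric])
  \<comment> \<open>With the reciprocal factor on the left, the estimate can be checked cover by
    cover before the infimum over covers of A is taken.\<close>
  have "ennreal (1 / L ^ m) * hausdorff_pre m \<delta> (T ` A) \<le> hausdorff_pre m (\<delta> / L) A"
    unfolding hausdorff_pre_def[of m "\<delta> / L" A]
  proof (rule INF_greatest)
    fix U :: "nat \<Rightarrow> 'a set"
    assume "U \<in> {U. A \<subseteq> (\<Union>i. U i) \<and> (\<forall>i. bounded (U i) \<and> diameter (U i) \<le> \<delta> / L)}"
    then have U: "A \<subseteq> (\<Union>i. U i)" "\<And>i. bounded (U i)" "\<And>i. diameter (U i) \<le> \<delta> / L" by auto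
    define W where "W i = T ` (A \<inter> U i)" for i
    have dW: "dist x y \<le> L * diameter (U i)" if "x \<in> W i" "y \<in> W i" for x y i
    proof -
      from that obtain a b where ab: "a \<in> A" "a \<in> U i" "b \<in> A" "b \<in> U i" "x = T a" "y = T b" by (auto simp: W_def)
      have "dist a b \<le> diameter (U i)" using diameter_bounded_bound[OF U(2)] ab by auto
      then show ?thesis using lip[of a b] ab L by (meson mult_le_cancel_left_pos order_trans)
    qed
    have diam: "diameter (W i) \<le> L * diameter (U i)" for i
      using dW L diameter_ge_0[OF U(2)] by (intro diameter_le) (auto simp: dist_norm)
    have bW: "bounded (W i)" for i
      unfolding bounded_two_points using dW by blast
    have Ld: "L * diameter (U i) \<le> \<delta>" for i using U(3)[of i] L by (simp add: field_simps)
    have g: "hausdorff_gauge m (W i) \<le> ennreal (L ^ m) * hausdorff_gauge m (U i)" for i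
    proof (cases "W i = {}")
      case False
      then have "U i \<noteq> {}" by (auto simp: W_def)
      have "(diameter (W i) / 2) ^ m \<le> (L * diameter (U i) / 2) ^ m"
        using diam[of i] diameter_ge_0[OF bW] by (intro power_mono) auto
      then have "unit_ball_vol (real m) * (diameter (W i) / 2) ^ m \<le> unit_ball_vol (real m) * (L * diameter (U i) / 2) ^ m"
        by (intro mult_left_mono) auto
      also have "\<dots> = L ^ m * (unit_ball_vol (real m) * (diameter (U i) / 2) ^ m)"
        by (simp add: power_mult_distrib power_divide)
      finally show ?thesis using False \<open>U i \<noteq> {}\<close> L diameter_ge_0[OF U(2)]
        by (simp add: hausdorff_gauge_def ennreal_mult[symmetric] ennreal_leI)
    qed (simp add: hausdorff_gauge_def)
    have "hausdorff_pre m \<delta> (T ` A) \<le> (\<Sum>i. hausdorff_gauge m (W i))"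
      unfolding hausdorff_pre_def
    proof (rule INF_lower, intro CollectI conjI allI)
      show "T ` A \<subseteq> (\<Union>i. W i)" using U(1) unfolding W_def by blast
      show "diameter (W i) \<le> \<delta>" for i using diam Ld order_trans by blast
    qed (rule bW)
    also have "\<dots> \<le> (\<Sum>i. ennreal (L ^ m) * hausdorff_gauge m (U i))"
      by (intro suminf_le g summableI)
    finally have "hausdorff_pre m \<delta> (T ` A) \<le> ennreal (L ^ m) * (\<Sum>i. hausdorff_gauge m (U i))" by simp
    then show "ennreal (1 / L ^ m) * hausdorff_pre m \<delta> (T ` A) \<le> (\<Sum>i. hausdorff_gauge m (U i))"
      using mult_left_mono[of "hausdorff_pre m \<delta> (T ` A)" "ennreal (L ^ m) * (\<Sum>i. hausdorff_gauge m (U i))" "ennreal (1 / L ^ m)"]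
      by (simp only: inv' zero_le)
  qed
  then have "hausdorff_pre m \<delta> (T ` A) \<le> ennreal (L ^ m) * hausdorff_pre m (\<delta> / L) A"
    using mult_left_mono[of "ennreal (1 / L ^ m) * hausdorff_pre m \<delta> (T ` A)" "hausdorff_pre m (\<delta> / L) A" "ennreal (L ^ m)"]
    by (simp only: inv zero_le)
  also have "\<dots> \<le> ennreal (L ^ m) * hausdorff_outer m A"
    unfolding hausdorff_outer_def using d L by (intro mult_left_mono SUP_upper) auto
  finally show "hausdorff_pre m \<delta> (T ` A) \<le> ennreal (L ^ m) * hausdorff_outer m A" .
qed

text \<open>Equality comes from the Lipschitz bound used twice, for T and for its inverse with
  constant 1/L.\<close>

lemma hausdorff_outer_similarity:
  fixes T :: "'a::euclidean_space \<Rightarrow> 'a"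
  assumes L: "0 < L" and sim: "\<And>x y. dist (T x) (T y) = L * dist x y"
  shows "hausdorff_outer m (T ` A) = ennreal (L ^ m) * hausdorff_outer m A"
proof (rule antisym)
  show "hausdorff_outer m (T ` A) \<le> ennreal (L ^ m) * hausdorff_outer m A"
    by (rule hausdorff_outer_lipschitz[OF L]) (simp add: sim)
  have inj: "inj T" by (rule injI) (use sim L in \<open>metis dist_eq_0_iff mult_eq_0_iff less_irrefl\<close>)
  have "hausdorff_outer m (inv T ` T ` A) \<le> ennreal ((1 / L) ^ m) * hausdorff_outer m (T ` A)"
  proof (rule hausdorff_outer_lipschitz)
    fix x y assume "x \<in> T ` A" "y \<in> T ` A"
    then show "dist (inv T x) (inv T y) \<le> 1 / L * dist x y"
      using L by (auto simp: inv_f_f[OF inj] sim)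
  qed (use L in simp)
  then have "ennreal (L ^ m) * hausdorff_outer m A \<le> ennreal (L ^ m) * (ennreal ((1 / L) ^ m) * hausdorff_outer m (T ` A))"
    by (simp add: image_inv_f_f[OF inj] mult_left_mono)
  also have "\<dots> = hausdorff_outer m (T ` A)"
    using L by (simp add: mult.assoc[symmetric] ennreal_mult[symmetric] power_mult_distrib[symmetric])
  finally show "ennreal (L ^ m) * hausdorff_outer m A \<le> hausdorff_outer m (T ` A)" .
qed

text \<open>The Hausdorff measure of codimension one, pushed forward along the identity to the Borel
  sets. Densities and product measurability then refer to \<open>borel\<close> instead of the
  Caratheodory sigma-algebra.\<close>

definition hmeas :: "'a::euclidean_space measure" where
  "hmeas = distr (hausdorff (DIM('a) - 1)) borel (\<lambda>x. x)"

lemma sets_hmeas [simp, measurable_cong]: "sets hmeas = sets borel"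
  and space_hmeas [simp]: "space hmeas = UNIV"
  by (auto simp: hmeas_def)

lemma id_measurable_hausdorff: "(\<lambda>x. x) \<in> hausdorff m \<rightarrow>\<^sub>M borel"
  by (rule borel_measurable_hausdorff) simp

lemma emeasure_hmeas:
  fixes A :: "'a::euclidean_space set"
  assumes "A \<in> sets borel"
  shows "emeasure hmeas A = hausdorff_outer (DIM('a) - 1) A"
  using assms borel_subset_sets_hausdorff
  by (auto simp: hmeas_def emeasure_distr id_measurable_hausdorff intro!: emeasure_hausdorff)

lemma hmeas_similarity:
  fixes T :: "'a::euclidean_space \<Rightarrow> 'a"
  assumes L: "0 < L" and sim: "\<And>x y. dist (T x) (T y) = L * dist x y" and surj: "surj T"
  shows "hmeas = density (distr hmeas borel T) (\<lambda>_. ennreal (L ^ (DIM('a) - 1)))"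
proof (rule measure_eqI)
  have T: "T \<in> borel_measurable borel"
  proof (rule borel_measurable_continuous_onI)
    have "L-lipschitz_on UNIV T" using L sim by (intro lipschitz_onI) auto
    then show "continuous_on UNIV T" by (rule lipschitz_on_continuous_on)
  qed
  fix A :: "'a set" assume "A \<in> sets hmeas"
  then have A: "A \<in> sets borel" by simp
  then have TA: "T -` A \<in> sets borel" using measurable_sets[OF T A] by simp
  have "emeasure hmeas A = hausdorff_outer (DIM('a) - 1) (T ` (T -` A))"
    unfolding surj_image_vimage_eq[OF surj] by (rule emeasure_hmeas[OF A])
  also have "\<dots> = ennreal (L ^ (DIM('a) - 1)) * emeasure hmeas (T -` A)"
    unfolding emeasure_hmeas[OF TA] by (rule hausdorff_outer_similarity[OF L sim])
  also have "\<dots> = emeasure (density (distr hmeas borel T) (\<lambda>_. ennreal (L ^ (DIM('a) - 1)))) A"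
    using A T by (simp add: emeasure_density emeasure_distr nn_integral_cmult)
  finally show "emeasure hmeas A = \<dots>" .
qed simp

text \<open>The change of variables by which the surfaces of different \<open>k\<close> are later
  compared.\<close>

lemma integral_hmeas_similarity:
  fixes T :: "'a::euclidean_space \<Rightarrow> 'a" and f :: "'a \<Rightarrow> real"
  assumes L: "0 < L" and sim: "\<And>x y. dist (T x) (T y) = L * dist x y" and surj: "surj T"
    and f [measurable]: "f \<in> borel_measurable borel"
  shows "integral\<^sup>L hmeas f = L ^ (DIM('a) - 1) * (\<integral>x. f (T x) \<partial>hmeas)"
proof -
  have T [measurable]: "T \<in> borel_measurable borel"
  proof (rule borel_measurable_continuous_onI)
    have "L-lipschitz_on UNIV T" using L sim by (intro lipschitz_onI) auto
    then show "continuous_on UNIV T" by (rule lipschitz_on_continuous_on)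
  qed
  have "integral\<^sup>L hmeas f = integral\<^sup>L (density (distr hmeas borel T) (\<lambda>_. ennreal (L ^ (DIM('a) - 1)))) f"
    using hmeas_similarity[OF L sim surj] by simp
  also have "\<dots> = (\<integral>x. L ^ (DIM('a) - 1) *\<^sub>R f x \<partial>distr hmeas borel T)"
    using L by (intro integral_density) auto
  also have "\<dots> = (\<integral>x. L ^ (DIM('a) - 1) *\<^sub>R f (T x) \<partial>hmeas)"
    by (intro integral_distr) auto
  finally show ?thesis by simp
qed

section \<open>Area bounds by projection to the boundary of a cube\<close>

lemma grid_cell:
  fixes u r :: real and N :: nat
  assumes "\<bar>u\<bar> \<le> r" "0 < r" "0 < N"
  shows "\<exists>j<N. - r + 2 * r * real j / real N \<le> u \<and> u \<le> - r + 2 * r * (real j + 1) / real N"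
proof -
  define z where "z = (u + r) * real N / (2 * r)"
  have "0 \<le> u + r" "u + r \<le> 2 * r" using assms(1) by linarith+
  then have "0 \<le> (u + r) * real N" "(u + r) * real N \<le> real N * (2 * r)"
    using mult_right_mono[of "u + r" "2 * r" "real N"] by (auto simp: mult.commute)
  then have z: "0 \<le> z" "z \<le> real N" using assms(2) by (auto simp: z_def pos_divide_le_eq)
  have u: "u = - r + 2 * r * z / real N" using assms by (simp add: z_def field_simps)
  obtain j where j: "j < N" "real j \<le> z" "z \<le> real j + 1"
  proof (cases "z < real N")
    case True
    have "real (nat \<lfloor>z\<rfloor>) \<le> z" "z \<le> real (nat \<lfloor>z\<rfloor>) + 1" using z by linarith+
    moreover have "nat \<lfloor>z\<rfloor> < N" using True z by linarith
    ultimately show thesis using that by blast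
  next
    \<comment> \<open>Here z = N; the right end of the interval belongs to the last cell.\<close>
    case False
    then show thesis using that[of "N - 1"] z assms by (auto simp: of_nat_diff)
  qed
  have "2 * r * real j / real N \<le> 2 * r * z / real N" "2 * r * z / real N \<le> 2 * r * (real j + 1) / real N"
    using j assms by (intro divide_right_mono mult_left_mono; simp)+
  then show ?thesis using u j(1) by (intro exI[of _ j]) auto
qed

lemma infnorm_attained:
  fixes x :: "'a::euclidean_space"
  obtains b where "b \<in> Basis" "\<bar>x \<bullet> b\<bar> = infnorm x"
proof -
  have "Max ((\<lambda>i. \<bar>x \<bullet> i\<bar>) ` Basis) \<in> (\<lambda>i. \<bar>x \<bullet> i\<bar>) ` Basis" by (rule Max_in) auto
  then show thesis using that unfolding infnorm_Max by (metis (no_types, lifting) imageE)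
qed

text \<open>A cube has 2d faces, each cut into N^(d-1) cells of side 2r/N. The diameter of a cell is
  bounded by its l1 diameter d * 2r/N; half of this to the power d-1 yields the factor
  d^(d-1).\<close>

definition cube_const :: "'a::euclidean_space itself \<Rightarrow> real" where
  "cube_const _ = 2 * real DIM('a) * unit_ball_vol (real (DIM('a) - 1)) * real DIM('a) ^ (DIM('a) - 1)"

lemma cube_const_nonneg: "0 \<le> cube_const TYPE('a::euclidean_space)"
  by (simp add: cube_const_def)

text \<open>A grid on the boundary of the cube is pulled back along p, which shrinks distances at
  most by the factor L. The number of cells times the gauge of a pulled-back cell does not depend on
  N, so the bound persists as the scale goes to 0.\<close>

lemma hausdorff_outer_cube_face:
  fixes M :: "'a::euclidean_space set" and p :: "'a \<Rightarrow> 'a"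
  assumes r: "0 < r" and L: "0 < L"
    and face: "\<And>x. x \<in> M \<Longrightarrow> infnorm (p x - c) = r"
    and lip: "\<And>x y. x \<in> M \<Longrightarrow> y \<in> M \<Longrightarrow> dist x y \<le> L * dist (p x) (p y)"
  shows "hausdorff_outer (DIM('a) - 1) M \<le> ennreal (cube_const TYPE('a) * (L * r) ^ (DIM('a) - 1))"
  unfolding hausdorff_outer_def
proof (rule SUP_least)
  fix \<delta> :: real assume "\<delta> \<in> {0<..}"
  then have d: "0 < \<delta>" by simp
  define D where "D = DIM('a)"
  have D: "0 < D" by (simp add: D_def)
  obtain N :: nat where N: "2 * L * r * real D / \<delta> < real N" using reals_Archimedean2 by blast
  have N0: "0 < N" 
  proof (rule ccontr)
    assume "\<not> 0 < N"
    then show False using N d L r by (auto simp: divide_less_0_iff mult_less_0_iff)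
  qed
  \<comment> \<open>The pair of b and the sign names one of the 2d faces, j a grid cell on that
    face.\<close>
  define I where "I = (SIGMA b:(Basis::'a set). {r, -r} \<times> ((Basis - {b}) \<rightarrow>\<^sub>E {..<N}))"
  define U where "U = (\<lambda>(b, e, j). {x \<in> M. (p x - c) \<bullet> b = e \<and> (\<forall>b'\<in>Basis - {b::'a}.
     - r + 2 * r * real (j b') / real N \<le> (p x - c) \<bullet> b' \<and> (p x - c) \<bullet> b' \<le> - r + 2 * r * (real (j b') + 1) / real N)})"
  have finI: "finite I" unfolding I_def by (intro finite_SigmaI finite_cartesian_product finite_PiE) auto
  have cover: "M \<subseteq> (\<Union>i\<in>I. U i)"
  proof
    fix x assume x: "x \<in> M"
    obtain b where b: "b \<in> Basis" "\<bar>(p x - c) \<bullet> b\<bar> = r" using infnorm_attained face[OF x] by metis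
    have "\<forall>b'. \<exists>j. b' \<in> Basis \<longrightarrow> j < N \<and> - r + 2 * r * real j / real N \<le> (p x - c) \<bullet> b' \<and> (p x - c) \<bullet> b' \<le> - r + 2 * r * (real j + 1) / real N"
      using grid_cell[OF _ r N0] Basis_le_infnorm face[OF x] by metis
    then obtain j where j: "\<And>b'. b' \<in> Basis \<Longrightarrow> j b' < N \<and> - r + 2 * r * real (j b') / real N \<le> (p x - c) \<bullet> b' \<and> (p x - c) \<bullet> b' \<le> - r + 2 * r * (real (j b') + 1) / real N"
      by metis
    have "(b, (p x - c) \<bullet> b, restrict j (Basis - {b})) \<in> I"
      using b j by (auto simp: I_def)
    moreover have "x \<in> U (b, (p x - c) \<bullet> b, restrict j (Basis - {b}))"
      using x j by (auto simp: U_def)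
    ultimately show "x \<in> (\<Union>i\<in>I. U i)" by blast
  qed
  define w where "w = 2 * L * r * real D / real N"
  have w0: "0 \<le> w" using L r by (simp add: w_def)
  have wd: "w \<le> \<delta>" using N N0 d by (simp add: w_def field_simps)
  have dU: "dist x y \<le> w" if i: "i \<in> I" and xy: "x \<in> U i" "y \<in> U i" for i x y
  proof -
    obtain b e j where ib: "i = (b, e, j)" "b \<in> Basis" using i by (auto simp: I_def)
    have c: "\<bar>(p x - p y) \<bullet> b'\<bar> \<le> 2 * r / real N" if b': "b' \<in> Basis" for b'
    proof (cases "b' = b")
      case True
      then have "(p x - p y) \<bullet> b' = 0" using xy by (auto simp: U_def ib inner_diff_left)
      then show ?thesis using r by simp
    next
      case False
      have 1: "- r + 2 * r * real (j b') / real N \<le> (p z - c) \<bullet> b' \<and> (p z - c) \<bullet> b' \<le> - r + 2 * r * real (j b') / real N + 2 * r / real N" if "z \<in> U i" for z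
        using that False b' by (auto simp: U_def ib add_divide_distrib algebra_simps)
      show ?thesis using 1[OF xy(1)] 1[OF xy(2)] unfolding inner_diff_left by linarith
    qed
    have "dist (p x) (p y) \<le> (\<Sum>b'\<in>Basis. \<bar>(p x - p y) \<bullet> b'\<bar>)"
      unfolding dist_norm by (rule norm_le_l1)
    also have "\<dots> \<le> (\<Sum>b'\<in>(Basis::'a set). 2 * r / real N)" by (intro sum_mono c)
    also have "\<dots> = real D * (2 * r / real N)" by (simp add: D_def)
    finally have "L * dist (p x) (p y) \<le> w"
      using mult_left_mono[of "dist (p x) (p y)" "real D * (2 * r / real N)" L] L by (simp add: w_def mult_ac)
    moreover have "dist x y \<le> L * dist (p x) (p y)" using xy by (intro lip) (auto simp: U_def ib)
    ultimately show ?thesis by simp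
  qed
  have bU: "bounded (U i)" if "i \<in> I" for i
    unfolding bounded_two_points using dU[OF that] by blast
  have diam: "diameter (U i) \<le> w" if "i \<in> I" for i
    using dU[OF that] w0 by (intro diameter_le) (auto simp: dist_norm)
  define \<gamma> where "\<gamma> = unit_ball_vol (real (D - 1)) * (w / 2) ^ (D - 1)"
  have g0: "0 \<le> \<gamma>" using w0 by (simp add: \<gamma>_def)
  have "hausdorff_pre (D - 1) \<delta> M \<le> hausdorff_pre (D - 1) \<delta> (\<Union>i\<in>I. U i)"
    by (rule hausdorff_pre_mono[OF cover])
  also have "\<dots> \<le> (\<Sum>i\<in>I. hausdorff_pre (D - 1) \<delta> (U i))" by (rule hausdorff_pre_finite_UN[OF d finI])
  also have "\<dots> \<le> (\<Sum>i\<in>I. ennreal \<gamma>)"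
  proof (rule sum_mono)
    fix i assume i: "i \<in> I"
    have "hausdorff_pre (D - 1) \<delta> (U i) \<le> hausdorff_gauge (D - 1) (U i)"
      using bU[OF i] diam[OF i] wd d by (intro hausdorff_pre_le_gauge) auto
    also have "\<dots> \<le> ennreal \<gamma>"
    proof (cases "U i = {}")
      case False
      have "unit_ball_vol (real (D - 1)) * (diameter (U i) / 2) ^ (D - 1) \<le> \<gamma>"
        unfolding \<gamma>_def using diam[OF i] diameter_ge_0[OF bU[OF i]]
        by (intro mult_left_mono power_mono) auto
      then show ?thesis using False by (simp add: hausdorff_gauge_def ennreal_leI)
    qed (simp add: hausdorff_gauge_def)
    finally show "hausdorff_pre (D - 1) \<delta> (U i) \<le> ennreal \<gamma>" .
  qed
  also have "\<dots> = ennreal (real (card I) * \<gamma>)"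
    using g0 by (simp add: ennreal_mult ennreal_of_nat_eq_real_of_nat)
  also have "card I = D * (2 * N ^ (D - 1))"
  proof -
    have "card I = (\<Sum>b\<in>(Basis::'a set). card ({r, -r} \<times> ((Basis - {b}) \<rightarrow>\<^sub>E {..<N})))"
      unfolding I_def by (rule card_SigmaI) (auto intro!: finite_cartesian_product finite_PiE)
    also have "\<dots> = (\<Sum>b\<in>(Basis::'a set). 2 * N ^ (D - 1))"
      using r by (intro sum.cong) (auto simp: card_cartesian_product card_PiE card_Diff_singleton D_def)
    finally show ?thesis by (simp add: D_def)
  qed
  also have "real (D * (2 * N ^ (D - 1))) * \<gamma> = 2 * real D * unit_ball_vol (real (D - 1)) * (real N * (w / 2)) ^ (D - 1)"
    by (simp add: \<gamma>_def power_mult_distrib power_divide)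
  also have "real N * (w / 2) = real D * (L * r)" using N0 by (simp add: w_def)
  finally show "hausdorff_pre (DIM('a) - 1) \<delta> M \<le> ennreal (cube_const TYPE('a) * (L * r) ^ (DIM('a) - 1))"
    by (simp add: cube_const_def D_def power_mult_distrib mult_ac)
qed

text \<open>Each point of \<open>M\<close> is pushed along its transversal direction \<open>a x\<close> to the boundary of a cube.\<close>

lemma hausdorff_outer_transversal:
  fixes M :: "'a::euclidean_space set" and a :: "'a \<Rightarrow> 'a"
  assumes r: "0 < r" and L: "0 < L" and M: "M \<subseteq> cball c r"
    and a: "\<And>x. x \<in> M \<Longrightarrow> a x \<noteq> 0"
    and lip: "\<And>x y s t. x \<in> M \<Longrightarrow> y \<in> M \<Longrightarrow> 0 \<le> s \<Longrightarrow> 0 \<le> t \<Longrightarrow>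
       dist x y \<le> L * dist (x + s *\<^sub>R a x) (y + t *\<^sub>R a y)"
  shows "hausdorff_outer (DIM('a) - 1) M \<le> ennreal (cube_const TYPE('a) * (L * r) ^ (DIM('a) - 1))"
proof -
  have "\<exists>t\<ge>0. infnorm (x + t *\<^sub>R a x - c) = r" if x: "x \<in> M" for x
  proof -
    \<comment> \<open>By time T the point has moved by 2r in the sup norm, so it has reached or
      passed the boundary of the cube, and the intermediate value theorem finds a crossing.\<close>
    define T where "T = 2 * r / infnorm (a x)"
    have ia: "0 < infnorm (a x)" using a[OF x] by (simp add: infnorm_pos_lt)
    have T: "0 \<le> T" using r ia by (simp add: T_def)
    have ix: "infnorm (x - c) \<le> r"
      using M x infnorm_le_norm[of "x - c"] by (auto simp: dist_norm norm_minus_commute)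
    have "infnorm (T *\<^sub>R a x) \<le> infnorm (x + T *\<^sub>R a x - c) + infnorm (x - c)"
      using infnorm_triangle[of "x + T *\<^sub>R a x - c" "c - x"] infnorm_sub[of x c] by (simp add: algebra_simps)
    moreover have "infnorm (T *\<^sub>R a x) = 2 * r" using T ia r by (simp add: infnorm_mul T_def)
    ultimately have "r \<le> infnorm (x + T *\<^sub>R a x - c)" using ix by simp
    moreover have "continuous_on {0..T} (\<lambda>t. infnorm (x + t *\<^sub>R a x - c))"
      by (intro continuous_on_infnorm continuous_intros)
    ultimately show ?thesis
      using IVT'[of "\<lambda>t. infnorm (x + t *\<^sub>R a x - c)" 0 r T] ix T by auto
  qed
  then obtain t where t: "\<And>x. x \<in> M \<Longrightarrow> 0 \<le> t x \<and> infnorm (x + t x *\<^sub>R a x - c) = r" by metis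
  show ?thesis
    by (rule hausdorff_outer_cube_face[OF r L, where p = "\<lambda>x. x + t x *\<^sub>R a x" and c = c]) (use t lip in auto)
qed

section \<open>Resonance surfaces\<close>

text \<open>Two thirds of the gradient of \<open>omega\<close>. Division by zero gives the value 0
  at the origin, which is correct there.\<close>

definition omega_dir :: "'a::euclidean_space \<Rightarrow> 'a" where
  "omega_dir x = (1 / sqrt (norm x)) *\<^sub>R x"

lemma omega_eq: "omega k = sqrt (norm k) ^ 3"
proof (cases "k = 0")
  case False
  then have "omega k = (norm k powr (1/2)) powr 3" by (simp add: omega_def powr_powr)
  also have "\<dots> = sqrt (norm k) ^ 3"
    using False powr_realpow[of "sqrt (norm k)" 3] by (simp add: powr_half_sqrt)
  finally show ?thesis .
qed (simp add: omega_def)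

lemma omega_nonneg [simp]: "0 \<le> omega k"
  by (simp add: omega_eq)

lemma omega_le_iff: "omega x \<le> omega y \<longleftrightarrow> norm x \<le> norm y"
  by (simp add: omega_eq power_mono_iff)

lemma omega_eq_0_iff [simp]: "omega x = 0 \<longleftrightarrow> x = 0"
  by (simp add: omega_eq)

text \<open>The origin needs a separate argument: there the quotient of \<open>omega h\<close> by
  |h| is |h|^(1/2). Since the origin is included, the phases are differentiable everywhere.\<close>

lemma GDERIV_omega: "GDERIV omega x :> (3/2) *\<^sub>R omega_dir x"
proof (cases "x = 0")
  case True
  have "((\<lambda>h::'a. sqrt (norm h)) \<longlongrightarrow> sqrt (norm (0::'a))) (at 0)"
    by (intro tendsto_intros)
  then have "((\<lambda>h::'a. sqrt (norm h)) \<longlongrightarrow> 0) (at 0)" by simp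
  moreover have "\<forall>\<^sub>F h in at (0::'a). sqrt (norm h) = norm (omega h) / norm h"
    unfolding eventually_at_filter
  proof (rule always_eventually, intro allI impI)
    fix h :: 'a assume "h \<noteq> 0"
    then have "sqrt (norm h) * norm h = sqrt (norm h) ^ 3"
      by (simp add: power3_eq_cube)
    then show "sqrt (norm h) = norm (omega h) / norm h"
      using \<open>h \<noteq> 0\<close> by (simp add: omega_eq field_simps)
  qed
  ultimately have "((\<lambda>h::'a. norm (omega h) / norm h) \<longlongrightarrow> 0) (at 0)"
    by (rule Lim_transform_eventually)
  then show ?thesis
    using True by (simp add: gderiv_def has_derivative_at omega_dir_def omega_def)
next
  case False
  have "DERIV (\<lambda>t. t powr (3/2)) (norm x) :> (3/2) * norm x powr (3/2 - 1)"
    using False by (intro has_real_derivative_powr) auto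
  then have "GDERIV (\<lambda>x. norm x powr (3/2)) x :> ((3/2) * norm x powr (3/2 - 1)) *\<^sub>R sgn x"
    by (rule GDERIV_DERIV_compose[OF GDERIV_norm[OF False]])
  moreover have "((3/2) * norm x powr (3/2 - 1)) *\<^sub>R sgn x = (3/2) *\<^sub>R omega_dir x"
  proof -
    have "norm x powr (1/2) = sqrt (norm x)" by (simp add: powr_half_sqrt)
    moreover have "sqrt (norm x) * inverse (norm x) = 1 / sqrt (norm x)"
    proof -
      obtain s where s: "s = sqrt (norm x)" by simp
      have "s \<noteq> 0" "norm x = s * s" using False by (simp_all add: s)
      then have "s * inverse (norm x) = 1 / s" by (simp add: field_simps)
      then show ?thesis by (simp only: s)
    qed
    ultimately have "((3/2) * norm x powr (3/2 - 1)) * inverse (norm x) = (3/2) * (1 / sqrt (norm x))"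
      by simp
    then show ?thesis by (simp only: omega_dir_def sgn_div_norm scaleR_scaleR)
  qed
  moreover have "omega = (\<lambda>x::'a. norm x powr (3/2))" by (auto simp: omega_def)
  ultimately show ?thesis by simp
qed

lemma grad_eq:
  assumes "GDERIV \<phi> y :> D"
  shows "grad \<phi> y = D"
  unfolding grad_def
proof (rule the_equality)
  show "GDERIV \<phi> y :> D" by (rule assms)
next
  fix D' assume "GDERIV \<phi> y :> D'"
  then have "(\<lambda>h. inner h D') = (\<lambda>h. inner h D)"
    using assms unfolding gderiv_def by (rule has_derivative_unique)
  then have "inner (D' - D) (D' - D) = 0"
    by (metis inner_diff_right right_minus_eq)
  then show "D' = D" by simp
qed

lemma GDERIV_omega_diff: "GDERIV (\<lambda>q. omega (k - q)) q :> - ((3/2) *\<^sub>R omega_dir (k - q))"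
proof -
  have "((\<lambda>q. omega (k - q)) has_derivative (\<lambda>h. inner (0 - h) ((3/2) *\<^sub>R omega_dir (k - q)))) (at q)"
    by (rule has_derivative_compose[of "\<lambda>q. k - q" "\<lambda>h. 0 - h" q UNIV omega,
        OF _ GDERIV_omega[unfolded gderiv_def]])
      (intro has_derivative_diff has_derivative_const has_derivative_ident)
  then show ?thesis by (simp add: gderiv_def)
qed

lemma GDERIV_omega_add: "GDERIV (\<lambda>q. omega (k + q)) q :> (3/2) *\<^sub>R omega_dir (k + q)"
proof -
  have "((\<lambda>q. omega (k + q)) has_derivative (\<lambda>h. inner (0 + h) ((3/2) *\<^sub>R omega_dir (k + q)))) (at q)"
    by (rule has_derivative_compose[of "\<lambda>q. k + q" "\<lambda>h. 0 + h" q UNIV omega,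
        OF _ GDERIV_omega[unfolded gderiv_def]])
      (intro has_derivative_add has_derivative_const has_derivative_ident)
  then show ?thesis by (simp add: gderiv_def)
qed

lemma GDERIV_phase1:
  "GDERIV (\<lambda>q. omega k - omega (k - q) - omega q) q :> (3/2) *\<^sub>R (omega_dir (k - q) - omega_dir q)"
  using GDERIV_diff[OF GDERIV_diff[OF GDERIV_const[of "omega k" q] GDERIV_omega_diff[of k q]] GDERIV_omega[of q]]
  by (simp add: scaleR_diff_right)

lemma GDERIV_phase2:
  "GDERIV (\<lambda>q. omega (k + q) - omega k - omega q) q :> (3/2) *\<^sub>R (omega_dir (k + q) - omega_dir q)"
  using GDERIV_diff[OF GDERIV_diff[OF GDERIV_omega_add[of k q] GDERIV_const[of "omega k" q]] GDERIV_omega[of q]]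
  by (simp add: scaleR_diff_right)

section \<open>Convexity of \<open>omega\<close> and monotonicity of its gradient\<close>

lemma inner_omega_dir_self:
  "inner (omega_dir x) x = sqrt (norm x) ^ 3" "inner (omega_dir x) (omega_dir x) = norm x"
proof -
  have "sqrt (norm x) * sqrt (norm x) = norm x" by simp
  then show "inner (omega_dir x) x = sqrt (norm x) ^ 3" "inner (omega_dir x) (omega_dir x) = norm x"
    by (cases "x = 0"; simp add: omega_dir_def dot_square_norm power2_eq_square power3_eq_cube field_simps)+
qed

text \<open>Convexity of \<open>omega\<close>. Cauchy-Schwarz reduces it to the roots a, b of the
  two lengths, where the gap between the two sides is (b - a)^2 (b + a/2).\<close>

lemma omega_tangent: "omega x + (3/2) * inner (omega_dir x) (y - x) \<le> omega y"
proof -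
  define a b where "a = sqrt (norm x)" and "b = sqrt (norm y)"
  have a: "0 \<le> a" "0 \<le> b" "norm x = a\<^sup>2" "norm y = b\<^sup>2" by (simp_all add: a_def b_def)
  have 1: "inner (omega_dir x) y \<le> a * b\<^sup>2"
  proof (cases "x = 0")
    case False
    then have "0 < a" by (simp add: a_def)
    have "inner (omega_dir x) y = inner x y / a" by (simp add: omega_dir_def a_def)
    also have "\<dots> \<le> a\<^sup>2 * b\<^sup>2 / a" using norm_cauchy_schwarz[of x y] a \<open>0 < a\<close> by (intro divide_right_mono) auto
    finally show ?thesis using \<open>0 < a\<close> by (simp add: power2_eq_square)
  qed (use a in \<open>simp add: omega_dir_def\<close>)
  have 2: "inner (omega_dir x) x = a ^ 3" by (simp add: inner_omega_dir_self a_def)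
  have "0 \<le> (b - a)\<^sup>2 * (b + a / 2)" using a by simp
  also have "\<dots> = b ^ 3 - (3/2) * (a * b\<^sup>2) + a ^ 3 / 2"
    by (simp add: power2_eq_square power3_eq_cube algebra_simps)
  finally have 3: "0 \<le> b ^ 3 - (3/2) * (a * b\<^sup>2) + a ^ 3 / 2" .
  have key: "p \<le> q \<Longrightarrow> 0 \<le> B - (3/2) * q + A / 2 \<Longrightarrow> A + (3/2) * (p - A) \<le> B" for p q A B :: real
    by (simp add: field_simps)
  show ?thesis
    unfolding omega_eq a_def[symmetric] b_def[symmetric] inner_diff_right 2 by (rule key[OF 1 3])
qed

text \<open>E is \<alpha>\<beta>(1 - cos) of the angle between a and b: it carries the angular part
  of the difference, and \<alpha> - \<beta> the radial part. In these variables the inequalities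
  below become polynomial.\<close>

lemma omega_dir_diff_algebra:
  fixes a b :: "'a::euclidean_space"
  defines "\<alpha> \<equiv> sqrt (norm a)" and "\<beta> \<equiv> sqrt (norm b)"
  obtains E where "0 \<le> E"
    "inner (omega_dir a - omega_dir b) (a - b) = (\<alpha> + \<beta>) * ((\<alpha> - \<beta>)\<^sup>2 + E)"
    "(norm (omega_dir a - omega_dir b))\<^sup>2 = (\<alpha> - \<beta>)\<^sup>2 + 2 * E"
    "(norm (a - b))\<^sup>2 = (\<alpha> + \<beta>)\<^sup>2 * (\<alpha> - \<beta>)\<^sup>2 + 2 * \<alpha> * \<beta> * E"
proof -
  define c where "c = inner a b"
  define E where "E = \<alpha> * \<beta> - c / (\<alpha> * \<beta>)"
  have n: "0 \<le> \<alpha>" "0 \<le> \<beta>" "norm a = \<alpha>\<^sup>2" "norm b = \<beta>\<^sup>2" by (simp_all add: \<alpha>_def \<beta>_def)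
  have z: "\<alpha> = 0 \<longleftrightarrow> a = 0" "\<beta> = 0 \<longleftrightarrow> b = 0" by (simp_all add: \<alpha>_def \<beta>_def)
  have c_le: "c \<le> \<alpha>\<^sup>2 * \<beta>\<^sup>2" unfolding c_def using norm_cauchy_schwarz[of a b] n by simp
  have E0: "0 \<le> E"
  proof (cases "\<alpha> = 0 \<or> \<beta> = 0")
    case True then show ?thesis by (auto simp: E_def)
  next
    case False
    then have "0 < \<alpha> * \<beta>" using n by (simp add: less_le)
    then show ?thesis using c_le by (simp add: E_def pos_divide_le_eq power2_eq_square mult_ac)
  qed
  have c0: "c = 0" if "\<alpha> = 0 \<or> \<beta> = 0" using that z by (auto simp: c_def)
  have cc: "c = \<alpha> * \<beta> * (\<alpha> * \<beta> - E)"
    using c0 by (cases "\<alpha> * \<beta> = 0") (auto simp: E_def)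
  have ca: "c / \<alpha> = \<beta> * (\<alpha> * \<beta> - E)"
    using cc c0 by (cases "\<alpha> = 0") (auto simp: E_def)
  have cb: "c / \<beta> = \<alpha> * (\<alpha> * \<beta> - E)"
    using cc c0 by (cases "\<beta> = 0") (auto simp: E_def)
  have aa: "inner (omega_dir a) a = \<alpha> ^ 3" "inner (omega_dir b) b = \<beta> ^ 3"
    "inner (omega_dir a) (omega_dir a) = \<alpha>\<^sup>2" "inner (omega_dir b) (omega_dir b) = \<beta>\<^sup>2"
    unfolding \<alpha>_def \<beta>_def by (simp_all add: inner_omega_dir_self)
  have ab: "inner (omega_dir a) b = c / \<alpha>" "inner (omega_dir b) a = c / \<beta>"
    "inner (omega_dir a) (omega_dir b) = c / (\<alpha> * \<beta>)"
    unfolding omega_dir_def \<alpha>_def[symmetric] \<beta>_def[symmetric] c_def by (simp_all add: inner_commute[of b a])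
  have ab3: "inner (omega_dir a) (omega_dir b) = \<alpha> * \<beta> - E"
    unfolding ab by (simp add: E_def)
  show thesis
  proof (rule that[OF E0])
    show "inner (omega_dir a - omega_dir b) (a - b) = (\<alpha> + \<beta>) * ((\<alpha> - \<beta>)\<^sup>2 + E)"
      unfolding inner_diff_left inner_diff_right aa ab(1,2) ca cb
      by (simp add: power2_eq_square power3_eq_cube algebra_simps)
    show "(norm (omega_dir a - omega_dir b))\<^sup>2 = (\<alpha> - \<beta>)\<^sup>2 + 2 * E"
      unfolding power2_norm_eq_inner inner_diff_left inner_diff_right aa inner_commute[of "omega_dir b" "omega_dir a"] ab3
      by (simp add: power2_eq_square algebra_simps)
    have "(norm (a - b))\<^sup>2 = (norm a)\<^sup>2 + (norm b)\<^sup>2 - 2 * c"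
      unfolding power2_norm_eq_inner c_def by (simp add: inner_diff_left inner_diff_right inner_commute)
    then show "(norm (a - b))\<^sup>2 = (\<alpha> + \<beta>)\<^sup>2 * (\<alpha> - \<beta>)\<^sup>2 + 2 * \<alpha> * \<beta> * E"
      unfolding n cc by (simp add: power2_eq_square algebra_simps)
  qed
qed

text \<open>In the variables of \<open>omega_dir_diff_algebra\<close> the gap is (\<alpha>^2 +
  \<beta>^2) E.\<close>

lemma omega_dir_strong_mono:
  "(norm (a - b))\<^sup>2 \<le> inner (omega_dir a - omega_dir b) (a - b) * (sqrt (norm a) + sqrt (norm b))"
proof -
  define \<alpha> \<beta> where "\<alpha> = sqrt (norm a)" and "\<beta> = sqrt (norm b)"
  have n: "0 \<le> \<alpha>" "0 \<le> \<beta>" by (simp_all add: \<alpha>_def \<beta>_def)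
  obtain E where E: "0 \<le> E"
    "inner (omega_dir a - omega_dir b) (a - b) = (\<alpha> + \<beta>) * ((\<alpha> - \<beta>)\<^sup>2 + E)"
    "(norm (a - b))\<^sup>2 = (\<alpha> + \<beta>)\<^sup>2 * (\<alpha> - \<beta>)\<^sup>2 + 2 * \<alpha> * \<beta> * E"
    using omega_dir_diff_algebra[of a b] unfolding \<alpha>_def \<beta>_def by metis
  have "0 \<le> (\<alpha>\<^sup>2 + \<beta>\<^sup>2) * E" using E by simp
  then have "(norm (a - b))\<^sup>2 \<le> (\<alpha> + \<beta>) * ((\<alpha> - \<beta>)\<^sup>2 + E) * (\<alpha> + \<beta>)"
    unfolding E by (simp add: power2_eq_square algebra_simps)
  then show ?thesis using E by (simp add: \<alpha>_def \<beta>_def)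
qed

text \<open>The squared cosine of the angle between the gradient difference and a - b is at least
  8/9. This is the value that nearby points already give, as the Hessian of \<open>omega\<close> has
  eigenvalue ratio 2 and 4 * 2 / (1 + 2)^2 = 8/9.\<close>

lemma omega_dir_angle:
  "8 * ((norm (omega_dir a - omega_dir b))\<^sup>2 * (norm (a - b))\<^sup>2) \<le> 9 * (inner (omega_dir a - omega_dir b) (a - b))\<^sup>2"
proof -
  define \<alpha> \<beta> where "\<alpha> = sqrt (norm a)" and "\<beta> = sqrt (norm b)"
  have n: "0 \<le> \<alpha>" "0 \<le> \<beta>" by (simp_all add: \<alpha>_def \<beta>_def)
  obtain E where E: "0 \<le> E"
    "inner (omega_dir a - omega_dir b) (a - b) = (\<alpha> + \<beta>) * ((\<alpha> - \<beta>)\<^sup>2 + E)"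
    "(norm (omega_dir a - omega_dir b))\<^sup>2 = (\<alpha> - \<beta>)\<^sup>2 + 2 * E"
    "(norm (a - b))\<^sup>2 = (\<alpha> + \<beta>)\<^sup>2 * (\<alpha> - \<beta>)\<^sup>2 + 2 * \<alpha> * \<beta> * E"
    using omega_dir_diff_algebra[of a b] unfolding \<alpha>_def \<beta>_def by metis
  define D where "D = (\<alpha> - \<beta>)\<^sup>2"
  have D: "0 \<le> D" by (simp add: D_def)
  have "0 \<le> (\<alpha> - \<beta>)\<^sup>2 * E / 2" using E by simp
  then have "2 * \<alpha> * \<beta> * E \<le> (\<alpha> + \<beta>)\<^sup>2 * E / 2"
    by (simp add: power2_eq_square algebra_simps)
  then have "(norm (a - b))\<^sup>2 \<le> (\<alpha> + \<beta>)\<^sup>2 * (D + E / 2)"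
    unfolding E D_def by (simp add: algebra_simps)
  then have "8 * ((norm (omega_dir a - omega_dir b))\<^sup>2 * (norm (a - b))\<^sup>2) \<le> 8 * ((D + 2 * E) * ((\<alpha> + \<beta>)\<^sup>2 * (D + E / 2)))"
    unfolding E(3) D_def[symmetric] using D E(1) by (intro mult_left_mono) auto
  also have "\<dots> = (\<alpha> + \<beta>)\<^sup>2 * (9 * (D + E)\<^sup>2 - (D - E)\<^sup>2)"
    by (simp add: power2_eq_square field_simps)
  also have "\<dots> \<le> (\<alpha> + \<beta>)\<^sup>2 * (9 * (D + E)\<^sup>2)" by (intro mult_left_mono) auto
  also have "\<dots> = 9 * (inner (omega_dir a - omega_dir b) (a - b))\<^sup>2"
    unfolding E(2) D_def by (simp add: power_mult_distrib)
  finally show ?thesis .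
qed

text \<open>The gradient difference deviates from its projection \<mu>k onto k by at most half the
  length of that projection, so every direction within sixty degrees of k still sees it as
  positive.\<close>

lemma omega_dir_cone:
  assumes k: "k = a - b" and v: "norm k * norm v / 2 < inner k v"
  shows "0 < inner (omega_dir a - omega_dir b) v"
proof -
  define g where "g = omega_dir a - omega_dir b"
  have k0: "k \<noteq> 0" "v \<noteq> 0" using v by auto
  define \<mu> where "\<mu> = inner g k / (norm k)\<^sup>2"
  have ab: "0 < sqrt (norm a) + sqrt (norm b)"
    using k0 k by (cases "a = 0") (auto intro: add_pos_nonneg)
  have "0 < (norm k)\<^sup>2" using k0 by simp
  also have "\<dots> \<le> inner g k * (sqrt (norm a) + sqrt (norm b))"
    using omega_dir_strong_mono[of a b] by (simp add: g_def k)
  finally have gk: "0 < inner g k" using ab by (simp add: zero_less_mult_iff)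
  then have mu: "0 < \<mu>" using k0 by (simp add: \<mu>_def)
  have gmu: "inner g k = \<mu> * (norm k)\<^sup>2" using k0 by (simp add: \<mu>_def)
  have "(norm (g - \<mu> *\<^sub>R k))\<^sup>2 = (norm g)\<^sup>2 - 2 * \<mu> * inner g k + \<mu>\<^sup>2 * (norm k)\<^sup>2"
    unfolding power2_norm_eq_inner by (simp add: inner_diff_left inner_diff_right inner_commute power2_eq_square)
  also have "\<dots> = (norm g)\<^sup>2 - \<mu>\<^sup>2 * (norm k)\<^sup>2" unfolding gmu by (simp add: power2_eq_square)
  finally have 1: "(norm (g - \<mu> *\<^sub>R k))\<^sup>2 = (norm g)\<^sup>2 - \<mu>\<^sup>2 * (norm k)\<^sup>2" .
  have "8 * ((norm g)\<^sup>2 * (norm k)\<^sup>2) \<le> 9 * (\<mu> * (norm k)\<^sup>2)\<^sup>2"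
    using omega_dir_angle[of a b] gmu by (simp add: g_def[symmetric] k[symmetric])
  then have "(8 * (norm g)\<^sup>2) * (norm k)\<^sup>2 \<le> (9 * \<mu>\<^sup>2 * (norm k)\<^sup>2) * (norm k)\<^sup>2"
    by (simp add: power2_eq_square mult_ac)
  then have "8 * (norm g)\<^sup>2 \<le> 9 * \<mu>\<^sup>2 * (norm k)\<^sup>2"
    using k0 by simp
  moreover have "0 \<le> \<mu>\<^sup>2 * (norm k)\<^sup>2" by simp
  ultimately have "(norm g)\<^sup>2 - \<mu>\<^sup>2 * (norm k)\<^sup>2 \<le> (\<mu>\<^sup>2 * (norm k)\<^sup>2) / 4" by linarith
  moreover have "(\<mu> * norm k / 2)\<^sup>2 = (\<mu>\<^sup>2 * (norm k)\<^sup>2) / 4"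
    by (simp only: power_mult_distrib power_divide) simp
  ultimately have "(norm (g - \<mu> *\<^sub>R k))\<^sup>2 \<le> (\<mu> * norm k / 2)\<^sup>2"
    by (simp only: 1)
  then have 2: "norm (g - \<mu> *\<^sub>R k) \<le> \<mu> * norm k / 2"
    by (rule power2_le_imp_le) (use mu in simp)
  have "- inner (g - \<mu> *\<^sub>R k) v \<le> norm (g - \<mu> *\<^sub>R k) * norm v"
    using Cauchy_Schwarz_ineq2[of "g - \<mu> *\<^sub>R k" v] by linarith
  also have "\<dots> \<le> \<mu> * norm k / 2 * norm v" using 2 by (intro mult_right_mono) auto
  also have "\<dots> = \<mu> * (norm k * norm v / 2)" by simp
  also have "\<dots> < \<mu> * inner k v" by (rule mult_strict_left_mono[OF v mu])
  finally have "0 < inner (g - \<mu> *\<^sub>R k) v + \<mu> * inner k v" by linarith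
  also have "\<dots> = inner g v" unfolding inner_diff_left inner_scaleR_left by simp
  finally show ?thesis unfolding g_def .
qed

section \<open>Geometry of the two resonance surfaces\<close>

definition decay_set :: "'a::euclidean_space \<Rightarrow> 'a set" where
  "decay_set k = {q. omega k - omega (k - q) - omega q = 0}"

definition fusion_set :: "'a::euclidean_space \<Rightarrow> 'a set" where
  "fusion_set k = {q. omega (k + q) - omega k - omega q = 0}"

lemma decay_set_le:
  assumes "q \<in> decay_set k"
  shows "norm q \<le> norm k" "norm (k - q) \<le> norm k"
  using assms omega_nonneg[of q] omega_nonneg[of "k - q"]
  by (auto simp: decay_set_def omega_le_iff[symmetric] simp del: omega_nonneg)

lemma fusion_set_le:
  assumes "q \<in> fusion_set k"
  shows "norm q \<le> norm (k + q)" "norm k \<le> norm (k + q)"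
  using assms omega_nonneg[of q] omega_nonneg[of k]
  by (auto simp: fusion_set_def omega_le_iff[symmetric] simp del: omega_nonneg)

text \<open>The surface \<open>decay_set k\<close> bounds the convex body
  \<open>omega (k - q) + omega q \<le> omega k\<close>, and \<open>omega_dir q - omega_dir (k - q)\<close> is its outer normal.\<close>

lemma decay_set_normal:
  assumes "x \<in> decay_set k"
  shows "(3/2) * inner (omega_dir x - omega_dir (k - x)) (y - x) \<le> omega (k - y) + omega y - omega k"
proof -
  have "omega x + (3/2) * inner (omega_dir x) (y - x) \<le> omega y" by (rule omega_tangent)
  moreover have "omega (k - x) + (3/2) * inner (omega_dir (k - x)) ((k - y) - (k - x)) \<le> omega (k - y)"
    by (rule omega_tangent)
  moreover have "inner (omega_dir (k - x)) ((k - y) - (k - x)) = - inner (omega_dir (k - x)) (y - x)"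
    by (simp add: inner_diff_right)
  moreover have "omega k = omega (k - x) + omega x" using assms by (simp add: decay_set_def)
  ultimately show ?thesis unfolding inner_diff_left by argo
qed

text \<open>The midpoint k/2 lies deep inside the convex body: since 2^(-3/2) is at most 3/8, the
  phase defect there is at least a quarter of \<open>omega k\<close>. It is within |k| of every
  surface point, so convexity forces a slope; the 6 is 4 * 3/2.\<close>

lemma decay_set_gradient:
  assumes q: "q \<in> decay_set k" and k: "k \<noteq> 0"
  shows "sqrt (norm k) / 6 \<le> norm (omega_dir (k - q) - omega_dir q)"
proof -
  define g where "g = omega_dir q - omega_dir (k - q)"
  define s where "s = sqrt (norm k)"
  have s: "0 < s" "norm k = s\<^sup>2" using k by (simp_all add: s_def)
  have half: "omega ((1/2) *\<^sub>R k) = s ^ 3 * (sqrt (1/2)) ^ 3"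
    by (simp add: omega_eq s_def real_sqrt_mult[symmetric] power_mult_distrib[symmetric])
  have sq: "(sqrt (1/2)) ^ 3 \<le> (3/8::real)"
  proof -
    have "sqrt (1/2) \<le> 3/4" by (rule real_le_lsqrt) (auto simp: power2_eq_square)
    moreover have "(sqrt (1/2)) ^ 3 = sqrt (1/2) / (2::real)" by (simp add: power3_eq_cube)
    ultimately show ?thesis by simp
  qed
  have "omega (k - (1/2) *\<^sub>R k) = omega ((1/2) *\<^sub>R k)"
    using scaleR_half_double[of k] by (simp add: algebra_simps) (metis add_diff_cancel_right' scaleR_half_double)
  moreover have "s ^ 3 * (sqrt (1/2)) ^ 3 \<le> s ^ 3 * (3/8)" using sq s by (intro mult_left_mono) auto
  moreover have "omega k = s ^ 3" by (simp add: omega_eq s_def)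
  ultimately have "omega (k - (1/2) *\<^sub>R k) + omega ((1/2) *\<^sub>R k) - omega k \<le> 2 * (s ^ 3 * (3/8)) - s ^ 3"
    unfolding half by linarith
  then have "(3/2) * inner g ((1/2) *\<^sub>R k - q) \<le> - (s ^ 3) / 4"
    using decay_set_normal[OF q, of "(1/2) *\<^sub>R k"] by (simp add: g_def)
  then have "s ^ 3 / 6 \<le> - inner g ((1/2) *\<^sub>R k - q)" by simp
  also have "\<dots> \<le> norm g * norm ((1/2) *\<^sub>R k - q)"
    using Cauchy_Schwarz_ineq2[of g "(1/2) *\<^sub>R k - q"] by linarith
  also have "norm ((1/2) *\<^sub>R k - q) \<le> norm k"
  proof -
    have "(1/2) *\<^sub>R k - q = (1/2) *\<^sub>R ((k - q) - q)"
      by (simp add: algebra_simps) (simp flip: scaleR_add_left)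
    then have "norm ((1/2) *\<^sub>R k - q) \<le> (norm (k - q) + norm q) / 2"
      using norm_triangle_ineq4[of "k - q" q] by simp
    then show ?thesis using decay_set_le[OF q] by simp
  qed
  finally have "s ^ 3 / 6 \<le> norm g * norm k" by (simp add: mult_left_mono)
  then have "(s / 6) * s\<^sup>2 \<le> norm g * s\<^sup>2" using s by (simp add: power2_eq_square power3_eq_cube)
  then have "s / 6 \<le> norm g" using s(1) by simp
  then show ?thesis by (simp add: g_def s_def norm_minus_commute)
qed

text \<open>Points pushed along outer normals of a convex body never come closer, as the
  nearest-point projection is nonexpansive. Hence the transversal argument applies with L =
  1.\<close>

lemma decay_set_mass:
  fixes k c :: "'a::euclidean_space"
  assumes k: "k \<noteq> 0" and r: "0 < r"
  shows "hausdorff_outer (DIM('a) - 1) (decay_set k \<inter> cball c r)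
     \<le> ennreal (cube_const TYPE('a) * r ^ (DIM('a) - 1))"
proof -
  define a where "a x = omega_dir x - omega_dir (k - x)" for x :: 'a
  have "hausdorff_outer (DIM('a) - 1) (decay_set k \<inter> cball c r)
     \<le> ennreal (cube_const TYPE('a) * (1 * r) ^ (DIM('a) - 1))"
  proof (rule hausdorff_outer_transversal[OF r, where a = a and c = c])
    fix x assume "x \<in> decay_set k \<inter> cball c r"
    then have "sqrt (norm k) / 6 \<le> norm (a x)"
      using decay_set_gradient[of x k] k by (simp add: a_def norm_minus_commute)
    moreover have "0 < sqrt (norm k) / 6" using k by simp
    ultimately have "0 < norm (a x)" by linarith
    then show "a x \<noteq> 0" by simp
  next
    fix x y and s t :: real
    assume x: "x \<in> decay_set k \<inter> cball c r" and y: "y \<in> decay_set k \<inter> cball c r" and st: "0 \<le> s" "0 \<le> t"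
    have ax: "inner (a x) (x - y) \<ge> 0"
      using decay_set_normal[of x k y] x y by (simp add: a_def decay_set_def inner_diff_right)
    have ay: "inner (a y) (x - y) \<le> 0"
      using decay_set_normal[of y k x] x y by (simp add: a_def decay_set_def inner_diff_right)
    have "(norm (x - y))\<^sup>2 \<le> (norm (x - y))\<^sup>2 + s * inner (a x) (x - y) - t * inner (a y) (x - y)"
      using mult_nonneg_nonneg[OF st(1) ax] ay st mult_nonneg_nonpos[of t "inner (a y) (x - y)"] by simp
    also have "\<dots> = inner ((x + s *\<^sub>R a x) - (y + t *\<^sub>R a y)) (x - y)"
    proof -
      have "(x + s *\<^sub>R a x) - (y + t *\<^sub>R a y) = (x - y) + s *\<^sub>R a x - t *\<^sub>R a y" by simp
      then show ?thesis by (simp only: inner_diff_left[of "x - y + s *\<^sub>R a x"] inner_add_left inner_scaleR_left power2_norm_eq_inner)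
    qed
    also have "\<dots> \<le> norm ((x + s *\<^sub>R a x) - (y + t *\<^sub>R a y)) * norm (x - y)"
      by (rule norm_cauchy_schwarz)
    finally have "norm (x - y) * norm (x - y) \<le> norm ((x + s *\<^sub>R a x) - (y + t *\<^sub>R a y)) * norm (x - y)"
      by (simp add: power2_eq_square)
    then have "norm (x - y) \<le> norm ((x + s *\<^sub>R a x) - (y + t *\<^sub>R a y))"
      by (cases "x = y") auto
    then show "dist x y \<le> 1 * dist (x + s *\<^sub>R a x) (y + t *\<^sub>R a y)" by (simp add: dist_norm)
  qed (auto simp: dist_commute)
  then show ?thesis by simp
qed

text \<open>By \<open>omega_dir_cone\<close> the phase strictly increases along any vector within
  sixty degrees of k, so no two zeros of the phase differ by such a vector.\<close>

lemma fusion_set_cone: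
  assumes x: "x \<in> fusion_set k" and y: "y \<in> fusion_set k"
  shows "inner k (x - y) \<le> norm k * norm (x - y) / 2"
proof (rule ccontr)
  assume "\<not> ?thesis"
  then have v: "norm k * norm (x - y) / 2 < inner k (x - y)" by simp
  define \<phi> where "\<phi> q = omega (k + q) - omega k - omega q" for q
  define h where "h t = \<phi> (y + t *\<^sub>R (x - y))" for t :: real
  have "h 0 < h 1"
  proof (rule DERIV_pos_imp_increasing[of 0 1 h])
    fix t :: real
    define p where "p = y + t *\<^sub>R (x - y)"
    have "(\<phi> has_derivative (\<lambda>h. inner h ((3/2) *\<^sub>R (omega_dir (k + p) - omega_dir p)))) (at p)"
      using GDERIV_phase2[of k p] unfolding gderiv_def \<phi>_def .
    then have "(h has_derivative (\<lambda>s. inner (0 + s *\<^sub>R (x - y)) ((3/2) *\<^sub>R (omega_dir (k + p) - omega_dir p)))) (at t)"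
      unfolding h_def p_def
      by (rule has_derivative_compose[rotated])
         (intro has_derivative_add has_derivative_const has_derivative_scaleR_left has_derivative_ident)
    then have "(h has_real_derivative (3/2) * inner (omega_dir (k + p) - omega_dir p) (x - y)) (at t)"
      unfolding has_field_derivative_def
      by (rule has_derivative_eq_rhs) (auto simp: inner_commute)
    moreover have "0 < inner (omega_dir (k + p) - omega_dir p) (x - y)"
      by (rule omega_dir_cone[OF _ v]) simp
    ultimately show "\<exists>d. (h has_real_derivative d) (at t) \<and> 0 < d"
      by (intro exI[of _ "(3/2) * inner (omega_dir (k + p) - omega_dir p) (x - y)"]) auto
  qed simp
  then show False using x y by (simp add: h_def \<phi>_def fusion_set_def)
qed

text \<open>The constant direction k is transversal: chords of the surface make an angle of at least
  sixty degrees with its line, so adding a multiple of k shortens a chord at most to half. This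
  gives L = 2.\<close>

lemma fusion_set_mass:
  fixes k c :: "'a::euclidean_space"
  assumes k: "k \<noteq> 0" and r: "0 < r"
  shows "hausdorff_outer (DIM('a) - 1) (fusion_set k \<inter> cball c r)
     \<le> ennreal (cube_const TYPE('a) * (2 * r) ^ (DIM('a) - 1))"
proof (rule hausdorff_outer_transversal[OF r, where a = "\<lambda>_. k" and c = c])
  fix x y and s t :: real
  assume x: "x \<in> fusion_set k \<inter> cball c r" and y: "y \<in> fusion_set k \<inter> cball c r"
  define v where "v = x - y"
  define u where "u = s - t"
  have 1: "inner k v \<le> norm k * norm v / 2" "- inner k v \<le> norm k * norm v / 2"
    using fusion_set_cone[of x k y] fusion_set_cone[of y k x] x y
    by (auto simp: v_def inner_diff_right norm_minus_commute)
  have "- (u * inner k v) \<le> \<bar>u\<bar> * (norm k * norm v / 2)"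
  proof -
    have "- (u * inner k v) \<le> \<bar>u\<bar> * \<bar>inner k v\<bar>" by (metis abs_ge_minus_self abs_mult)
    also have "\<dots> \<le> \<bar>u\<bar> * (norm k * norm v / 2)" using 1 by (intro mult_left_mono) auto
    finally show ?thesis .
  qed
  moreover have "0 \<le> (norm v / 2 - \<bar>u\<bar> * norm k)\<^sup>2" by simp
  then have "\<bar>u\<bar> * (norm k * norm v) \<le> (norm v)\<^sup>2 / 4 + u\<^sup>2 * (norm k)\<^sup>2"
    by (simp add: power2_diff power_mult_distrib power_divide mult_ac)
  ultimately have "(norm v)\<^sup>2 / 4 \<le> (norm v)\<^sup>2 + 2 * (u * inner k v) + u\<^sup>2 * (norm k)\<^sup>2"
    using zero_le_power2[of "norm v"] by linarith
  also have "\<dots> = (norm (v + u *\<^sub>R k))\<^sup>2"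
    unfolding power2_norm_eq_inner by (simp add: inner_add_left inner_add_right inner_commute power2_eq_square)
  finally have "(norm v / 2)\<^sup>2 \<le> (norm (v + u *\<^sub>R k))\<^sup>2" by (simp add: power_divide)
  then have "norm v / 2 \<le> norm (v + u *\<^sub>R k)" by (rule power2_le_imp_le) simp
  moreover have "v + u *\<^sub>R k = (x + s *\<^sub>R k) - (y + t *\<^sub>R k)" by (simp add: v_def u_def algebra_simps)
  ultimately show "dist x y \<le> 2 * dist (x + s *\<^sub>R k) (y + t *\<^sub>R k)"
    unfolding dist_norm v_def[symmetric] by (metis mult.commute pos_divide_le_eq zero_less_numeral)
qed (use k in auto)

text \<open>On the surface q is not longer than k + q, so both roots in
  \<open>omega_dir_strong_mono\<close> are at most that of |k + q|. The bound weakens as q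
  grows.\<close>

lemma fusion_set_gradient:
  assumes k: "k \<noteq> 0" and q: "q \<in> fusion_set k"
  shows "norm k / (2 * sqrt (norm (k + q))) \<le> norm (omega_dir (k + q) - omega_dir q)"
proof -
  define g where "g = omega_dir (k + q) - omega_dir q"
  define s where "s = sqrt (norm (k + q))"
  have "0 < norm k" using k by simp
  then have "0 < norm (k + q)" using fusion_set_le(2)[OF q] by linarith
  then have s: "0 < s" unfolding s_def by (rule real_sqrt_gt_zero)
  have "(norm k)\<^sup>2 \<le> inner g k * (s + sqrt (norm q))"
    using omega_dir_strong_mono[of "k + q" q] by (simp add: g_def s_def)
  also have "\<dots> \<le> (norm g * norm k) * (2 * s)"
    using fusion_set_le(1)[OF q] norm_cauchy_schwarz[of g k] s by (intro mult_mono) (auto simp: s_def)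
  finally have "norm k * norm k \<le> (norm g * (2 * s)) * norm k" by (simp add: power2_eq_square mult_ac)
  then have "norm k \<le> norm g * (2 * s)" using k by simp
  then show ?thesis using s by (simp add: g_def[symmetric] s_def[symmetric] pos_divide_le_eq mult_ac)
qed

section \<open>Size of the interaction coefficient\<close>

lemma V_commute: "V x y z = V x z y"
  by (simp add: V_def Lc_def inner_commute algebra_simps)

lemma Lc_bounds: "0 \<le> Lc y z" "Lc y z \<le> 2 * (norm y * norm z)"
  using Cauchy_Schwarz_ineq2[of y z] by (auto simp: Lc_def)

text \<open>The bracket has size c/a, the root of |z|/|x|, while the prefactor contributes |x|^3
  |z|^(3/2) to the square. Only the middle term relies on cancellation: its denominator contains
  |z|, but \<open>Lc x (- y)\<close> is |x||y| - x.y, which is at most |z|^2 / 2 because x - y =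
  z.\<close>

lemma V_bound:
  assumes x: "x = y + z" and zy: "norm z \<le> norm y" and yx: "norm y \<le> norm x"
  shows "(V x y z)\<^sup>2 \<le> (norm x)\<^sup>2 * sqrt (norm z) ^ 5"
proof (cases "z = 0")
  case True
  then show ?thesis by (simp add: V_def omega_def)
next
  case False
  define a b c where "a = sqrt (norm x)" and "b = sqrt (norm y)" and "c = sqrt (norm z)"
  have n: "norm x = a\<^sup>2" "norm y = b\<^sup>2" "norm z = c\<^sup>2" by (simp_all add: a_def b_def c_def)
  have c: "0 < c" using False by (simp add: c_def)
  have cb: "c \<le> b" and ba: "b \<le> a" using zy yx by (simp_all add: a_def b_def c_def)
  have b: "0 < b" and a: "0 < a" using c cb ba by auto
  have a2: "a\<^sup>2 \<le> 2 * b\<^sup>2" using norm_triangle_ineq[of y z] zy unfolding x[symmetric] n by linarith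
  define T1 T2 T3 where "T1 = Lc y z / (b * c * a\<^sup>2)" and "T2 = Lc x (- y) / (a * b * c\<^sup>2)"
    and "T3 = Lc x (- z) / (a * c * b\<^sup>2)"
  have T0: "0 \<le> T1" "0 \<le> T2" "0 \<le> T3"
    using a b c unfolding T1_def T2_def T3_def by (intro divide_nonneg_nonneg Lc_bounds(1); simp)+
  have T1: "T1 \<le> 2 * (c / a)"
  proof -
    have "T1 \<le> 2 * (b\<^sup>2 * c\<^sup>2) / (b * c * a\<^sup>2)"
      unfolding T1_def using Lc_bounds(2)[of y z] a b c by (intro divide_right_mono) (auto simp: n)
    also have "\<dots> = 2 * (c / a) * (b / a)" using a b c by (simp add: power2_eq_square field_simps)
    also have "\<dots> \<le> 2 * (c / a) * 1" using a b c ba by (intro mult_left_mono) auto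
    finally show ?thesis by simp
  qed
  have T2: "T2 \<le> c / a"
  proof -
    have "(norm z)\<^sup>2 = (norm x)\<^sup>2 + (norm y)\<^sup>2 - 2 * inner x y"
      unfolding power2_norm_eq_inner using x by (simp add: inner_add_left inner_add_right inner_commute)
    moreover have "0 \<le> (norm x - norm y)\<^sup>2" by simp
    ultimately have "2 * Lc x (- y) \<le> (norm z)\<^sup>2" by (simp add: Lc_def power2_diff)
    then have "T2 \<le> (c\<^sup>2 * c\<^sup>2) / (a * b * c\<^sup>2)"
      unfolding T2_def using a b c Lc_bounds(1)[of x "- y"] by (intro divide_right_mono) (auto simp: n power2_eq_square)
    also have "\<dots> = (c / a) * (c / b)" using a b c by (simp add: power2_eq_square field_simps)
    also have "\<dots> \<le> (c / a) * 1" using a b c cb by (intro mult_left_mono) auto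
    finally show ?thesis by simp
  qed
  have T3: "T3 \<le> 4 * (c / a)"
  proof -
    have "T3 \<le> 2 * (a\<^sup>2 * c\<^sup>2) / (a * c * b\<^sup>2)"
      unfolding T3_def using Lc_bounds(2)[of x "- z"] a b c by (intro divide_right_mono) (auto simp: n)
    also have "\<dots> = 2 * (c / a) * (a\<^sup>2 / b\<^sup>2)" using a b c by (simp add: power2_eq_square field_simps)
    also have "\<dots> \<le> 2 * (c / a) * 2" using a b c a2 by (intro mult_left_mono) (auto simp: divide_le_eq)
    finally show ?thesis by simp
  qed
  define P where "P = sqrt (omega x * omega y * omega z)"
  have P2: "P\<^sup>2 \<le> a ^ 6 * c ^ 3"
  proof -
    have "P\<^sup>2 = a ^ 3 * b ^ 3 * c ^ 3" by (simp add: P_def omega_eq a_def b_def c_def)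
    also have "\<dots> \<le> a ^ 3 * a ^ 3 * c ^ 3" using a b c ba by (intro mult_right_mono mult_left_mono power_mono) auto
    finally show ?thesis by (simp add: power_add[symmetric])
  qed
  define B where "B = T1 - T2 - T3"
  have "\<bar>B\<bar> \<le> 5 * (c / a)" using T0 T1 T2 T3 c a unfolding B_def by (auto simp: abs_le_iff)
  then have B2: "B\<^sup>2 \<le> (5 * (c / a))\<^sup>2" using power2_le_iff_abs_le[of "5 * (c / a)" B] a c by simp
  define \<kappa> where "\<kappa> = 1 / (8 * pi * sqrt 2)"
  have kap: "\<kappa>\<^sup>2 * 25 \<le> 1"
  proof -
    have "\<kappa>\<^sup>2 = 1 / (128 * pi\<^sup>2)" by (simp add: \<kappa>_def power_divide power_mult_distrib)
    moreover have "1 \<le> pi\<^sup>2" using pi_gt3 by (intro one_le_power) simp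
    ultimately show ?thesis by (simp add: divide_le_eq)
  qed
  have "V x y z = \<kappa> * P * B"
    by (simp add: V_def \<kappa>_def P_def B_def T1_def T2_def T3_def a_def b_def c_def mult_ac)
  then have "(V x y z)\<^sup>2 = \<kappa>\<^sup>2 * (P\<^sup>2 * B\<^sup>2)" by (simp add: power_mult_distrib)
  also have "\<dots> \<le> \<kappa>\<^sup>2 * ((a ^ 6 * c ^ 3) * (5 * (c / a))\<^sup>2)"
    using P2 B2 a c by (intro mult_left_mono mult_mono) auto
  also have "\<dots> = (\<kappa>\<^sup>2 * 25) * (a ^ 4 * c ^ 5)"
    using a by (simp add: power_divide power_mult_distrib field_simps power_add[symmetric] eval_nat_numeral)
  also have "\<dots> \<le> 1 * (a ^ 4 * c ^ 5)" using kap a c by (intro mult_right_mono) auto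
  also have "\<dots> = (norm x)\<^sup>2 * sqrt (norm z) ^ 5" by (simp add: n(1) c_def power_mult[symmetric])
  finally show ?thesis .
qed

section \<open>Weights and summation over unit shells\<close>

lemma jap_ge: "1 \<le> jap k" "norm k \<le> jap k"
  by (auto simp: jap_def intro: real_le_rsqrt)

lemma jap_pos [simp]: "0 < jap k"
  using jap_ge(1)[of k] by linarith

lemma jap_minus_commute: "jap (x - y) = jap (y - x)"
  by (simp add: jap_def norm_minus_commute)

lemma jap_mono: "norm x \<le> norm y \<Longrightarrow> jap x \<le> jap y"
  by (simp add: jap_def power_mono)

lemma jap_measurable [measurable]: "jap \<in> borel_measurable borel"
  unfolding jap_def[abs_def] by measurable

text \<open>The terms are the product of the weight bound (2/(j+1))^(m+2) on shell j and the mass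
  growth (j+1)^m.\<close>

definition shell_const :: "nat \<Rightarrow> real" where
  "shell_const m = (\<Sum>j. 2 ^ (m + 2) * (1 / real (Suc j) ^ 2))"

lemma shell_const_summable: "summable (\<lambda>j. 2 ^ (m + 2) * (1 / real (Suc j) ^ 2))"
proof (intro summable_mult)
  have "summable (\<lambda>j. inverse (real j ^ 2))" by (rule inverse_power_summable) simp
  then have "summable (\<lambda>j. inverse (real (Suc j) ^ 2))" by (subst summable_Suc_iff)
  then show "summable (\<lambda>j. 1 / real (Suc j) ^ 2)" by (simp only: inverse_eq_divide)
qed

lemma shell_const_nonneg: "0 \<le> shell_const m"
  unfolding shell_const_def by (intro suminf_nonneg shell_const_summable) auto

text \<open>Mass growth of order m needs two further powers in the weight to leave the summable
  1/(j+1)^2. Used with m = d - 1 on the surfaces and with m = d for Lebesgue measure.\<close>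

lemma nn_integral_jap_le:
  fixes \<nu> :: "'a::euclidean_space measure"
  assumes sets: "sets borel \<subseteq> sets \<nu>" and sp: "space \<nu> = UNIV" and C: "0 \<le> C"
    and mass: "\<And>r. 0 < r \<Longrightarrow> emeasure \<nu> (cball c r) \<le> ennreal (C * r ^ m)"
  shows "(\<integral>\<^sup>+ q. ennreal (1 / jap (q - c) ^ (m + 2)) \<partial>\<nu>) \<le> ennreal (C * shell_const m)"
proof -
  have cb: "cball c r \<in> sets \<nu>" for r using sets by auto
  define w where "w j = (2 / real (Suc j)) ^ (m + 2)" for j :: nat
  have pt: "ennreal (1 / jap (q - c) ^ (m + 2)) \<le> (\<Sum>j. ennreal (w j) * indicator (cball c (real (Suc j))) q)" for q
  proof -
    define j where "j = nat \<lfloor>norm (q - c)\<rfloor>"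
    have j: "real j \<le> norm (q - c)" "norm (q - c) \<le> real (Suc j)"
      using norm_ge_zero[of "q - c"] unfolding j_def by linarith+
    have "real (Suc j) / 2 \<le> jap (q - c)"
      using jap_ge[of "q - c"] j(1) by simp
    then have "1 / jap (q - c) \<le> 2 / real (Suc j)" by (simp add: field_simps)
    then have "(1 / jap (q - c)) ^ (m + 2) \<le> w j" unfolding w_def
      by (intro power_mono) (auto simp: less_imp_le)
    then have "ennreal (1 / jap (q - c) ^ (m + 2)) \<le> ennreal (w j) * indicator (cball c (real (Suc j))) q"
      using j(2) by (simp add: power_one_over dist_norm norm_minus_commute ennreal_leI)
    also have "\<dots> \<le> (\<Sum>j. ennreal (w j) * indicator (cball c (real (Suc j))) q)"
    proof -
      define f where "f i = ennreal (w i) * indicator (cball c (real (Suc i))) q" for i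
      have "f j \<le> suminf f" using sum_le_suminf[of f "{j}"] by simp
      then show ?thesis unfolding f_def[abs_def] .
    qed
    finally show ?thesis .
  qed
  have "(\<integral>\<^sup>+ q. ennreal (1 / jap (q - c) ^ (m + 2)) \<partial>\<nu>)
      \<le> (\<integral>\<^sup>+ q. (\<Sum>j. ennreal (w j) * indicator (cball c (real (Suc j))) q) \<partial>\<nu>)"
    by (intro nn_integral_mono pt)
  also have "\<dots> = (\<Sum>j. \<integral>\<^sup>+ q. ennreal (w j) * indicator (cball c (real (Suc j))) q \<partial>\<nu>)"
    using cb by (intro nn_integral_suminf) auto
  also have "\<dots> = (\<Sum>j. ennreal (w j) * emeasure \<nu> (cball c (real (Suc j))))"
    using cb by (intro suminf_cong nn_integral_cmult_indicator)
  also have "\<dots> \<le> (\<Sum>j. ennreal (C * (2 ^ (m + 2) * (1 / real (Suc j) ^ 2))))"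
  proof (intro suminf_le summableI)
    fix j
    have "ennreal (w j) * emeasure \<nu> (cball c (real (Suc j))) \<le> ennreal (w j) * ennreal (C * real (Suc j) ^ m)"
      by (intro mult_left_mono mass) auto
    also have "\<dots> = ennreal (w j * (C * real (Suc j) ^ m))"
      using C by (subst ennreal_mult) (auto simp: w_def)
    also have "w j * (C * real (Suc j) ^ m) = C * (2 ^ (m + 2) * (1 / real (Suc j) ^ 2))"
      unfolding w_def power_divide power_add by (simp add: field_simps del: of_nat_Suc)
    finally show "ennreal (w j) * emeasure \<nu> (cball c (real (Suc j))) \<le> ennreal (C * (2 ^ (m + 2) * (1 / real (Suc j) ^ 2)))" .
  qed
  also have "\<dots> = ennreal (\<Sum>j. C * (2 ^ (m + 2) * (1 / real (Suc j) ^ 2)))"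
    using C by (intro suminf_ennreal2 summable_mult[OF shell_const_summable]) auto
  also have "\<dots> = ennreal (C * shell_const m)"
    unfolding shell_const_def using suminf_mult[OF shell_const_summable] by simp
  finally show ?thesis .
qed

definition decay_kernel :: "'a::euclidean_space \<Rightarrow> 'a \<Rightarrow> real" where
  "decay_kernel k q = 4 * pi * (V k (k - q) q)\<^sup>2 / norm ((3/2) *\<^sub>R (omega_dir (k - q) - omega_dir q))"

text \<open>The factor is 8 pi rather than 4 pi because the last two terms of \<open>S\<close>
  coincide.\<close>

definition fusion_kernel :: "'a::euclidean_space \<Rightarrow> 'a \<Rightarrow> real" where
  "fusion_kernel k q = 8 * pi * (V (k + q) k q)\<^sup>2 / norm ((3/2) *\<^sub>R (omega_dir (k + q) - omega_dir q))"

lemma kernel_nonneg [simp]: "0 \<le> decay_kernel k q" "0 \<le> fusion_kernel k q"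
  by (simp_all add: decay_kernel_def fusion_kernel_def)

lemma kernel_0 [simp]: "decay_kernel 0 q = 0" "fusion_kernel 0 q = 0"
  by (simp_all add: decay_kernel_def fusion_kernel_def V_def omega_def)

lemma V_bound_both:
  assumes x: "x = y + z" and "norm z \<le> norm x" "norm y \<le> norm x"
  shows "(V x y z)\<^sup>2 \<le> (norm x)\<^sup>2 * sqrt (min (norm y) (norm z)) ^ 5"
proof (cases "norm z \<le> norm y")
  case True
  then show ?thesis using V_bound[OF x True] assms by (simp add: min_def)
next
  case False
  then show ?thesis
    using V_bound[of x z y] assms V_commute[of x y z] by (simp add: min_def add.commute)
qed

text \<open>Both forms are needed, since either of q and k - q may carry the weight against which
  the kernel is integrated.\<close>

lemma decay_kernel_le:
  assumes q: "q \<in> decay_set k" and k: "k \<noteq> 0"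
  shows "decay_kernel k q \<le> 64 * pi * sqrt (norm k) ^ 3 * sqrt (norm q) ^ 5"
    "decay_kernel k q \<le> 64 * pi * sqrt (norm k) ^ 3 * sqrt (norm (k - q)) ^ 5"
proof -
  define s where "s = sqrt (norm k)"
  define m where "m = sqrt (min (norm (k - q)) (norm q)) ^ 5"
  define g where "g = norm (omega_dir (k - q) - omega_dir q)"
  have s: "0 < s" "norm k = s\<^sup>2" using k by (simp_all add: s_def)
  have m: "0 \<le> m" by (simp add: m_def)
  have V: "(V k (k - q) q)\<^sup>2 \<le> (s\<^sup>2)\<^sup>2 * m"
    using V_bound_both[of k "k - q" q] decay_set_le[OF q] by (simp add: m_def s(2)[symmetric])
  have g: "s / 6 \<le> g" using decay_set_gradient[OF q k] by (simp add: s_def g_def)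
  have g0: "0 < g" using g s by linarith
  have "decay_kernel k q = 4 * pi * (V k (k - q) q)\<^sup>2 / ((3/2) * g)"
    unfolding decay_kernel_def g_def by simp
  also have "\<dots> \<le> 4 * pi * ((s\<^sup>2)\<^sup>2 * m) / ((3/2) * g)"
    using V g0 by (intro divide_right_mono mult_left_mono) auto
  also have "\<dots> \<le> 4 * pi * ((s\<^sup>2)\<^sup>2 * m) / ((3/2) * (s / 6))"
    using g s g0 m by (intro divide_left_mono mult_left_mono) auto
  also have "\<dots> = 16 * pi * s ^ 3 * m"
    using s(1) by (simp add: field_simps eval_nat_numeral)
  \<comment> \<open>The constant is enlarged to that of the fusion kernel, so that one transition
    constant serves both.\<close>
  also have "\<dots> \<le> 64 * pi * s ^ 3 * m" using s m by (intro mult_right_mono) auto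
  finally have 1: "decay_kernel k q \<le> 64 * pi * s ^ 3 * m" .
  have "m \<le> sqrt (norm q) ^ 5" "m \<le> sqrt (norm (k - q)) ^ 5"
    unfolding m_def by (intro power_mono real_sqrt_le_mono; simp)+
  then have "64 * pi * s ^ 3 * m \<le> 64 * pi * s ^ 3 * sqrt (norm q) ^ 5"
    "64 * pi * s ^ 3 * m \<le> 64 * pi * s ^ 3 * sqrt (norm (k - q)) ^ 5"
    using s by (intro mult_left_mono; simp)+
  with 1 show "decay_kernel k q \<le> 64 * pi * sqrt (norm k) ^ 3 * sqrt (norm q) ^ 5"
    "decay_kernel k q \<le> 64 * pi * sqrt (norm k) ^ 3 * sqrt (norm (k - q)) ^ 5"
    unfolding s_def by linarith+
qed

text \<open>Dividing by the weak gradient bound leaves s^5 min(a,b)^5 / a^2. As s is at most sqrt 2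
  * max(a,b), and max times min is ab, the variables separate; 6 bounds (sqrt 2)^5, and 64 is 6 *
  32/3.\<close>

lemma fusion_kernel_le:
  assumes q: "q \<in> fusion_set k" and k: "k \<noteq> 0"
  shows "fusion_kernel k q \<le> 64 * pi * sqrt (norm k) ^ 3 * sqrt (norm q) ^ 5"
proof -
  define a b s where "a = sqrt (norm k)" and "b = sqrt (norm q)" and "s = sqrt (norm (k + q))"
  define g where "g = norm (omega_dir (k + q) - omega_dir q)"
  have a: "0 < a" "norm k = a\<^sup>2" and b: "0 \<le> b" "norm q = b\<^sup>2" using k by (simp_all add: a_def b_def)
  have as: "a \<le> s" using fusion_set_le(2)[OF q] by (simp add: a_def s_def)
  have "0 < s" using as a(1) by linarith
  then have s: "0 < s" "norm (k + q) = s\<^sup>2" by (simp_all add: s_def)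
  have s2: "s\<^sup>2 \<le> a\<^sup>2 + b\<^sup>2" using norm_triangle_ineq[of k q] a b s by simp
  have smin: "sqrt (min (norm k) (norm q)) = min a b"
    by (auto simp: min_def a_def b_def)
  have V: "(V (k + q) k q)\<^sup>2 \<le> (s\<^sup>2)\<^sup>2 * (min a b) ^ 5"
    using V_bound_both[of "k + q" k q] fusion_set_le[OF q]
    by (simp add: s(2) smin)
  have key: "s ^ 5 * (min a b) ^ 5 \<le> 6 * (a ^ 5 * b ^ 5)"
  proof -
    define M where "M = max a b"
    have M: "0 \<le> M" "a\<^sup>2 \<le> M\<^sup>2" "b\<^sup>2 \<le> M\<^sup>2" using a b by (auto simp: M_def intro!: power_mono)
    have "s\<^sup>2 \<le> (sqrt 2 * M)\<^sup>2" using s2 M by (simp add: power_mult_distrib)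
    then have "s \<le> sqrt 2 * M" by (rule power2_le_imp_le) (use M in simp)
    then have "s ^ 5 \<le> (sqrt 2 * M) ^ 5" using s by (intro power_mono) auto
    also have "\<dots> = (sqrt 2) ^ 5 * M ^ 5" by (simp add: power_mult_distrib)
    also have "\<dots> \<le> 6 * M ^ 5"
    proof -
      have "(sqrt 2) ^ 5 = 4 * sqrt (2::real)" by (simp add: eval_nat_numeral)
      moreover have "sqrt 2 \<le> (3/2::real)" by (rule real_le_lsqrt) (auto simp: power2_eq_square)
      ultimately show ?thesis using M by (intro mult_right_mono) auto
    qed
    finally have "s ^ 5 * (min a b) ^ 5 \<le> (6 * M ^ 5) * (min a b) ^ 5"
      using a b by (intro mult_right_mono) auto
    also have "\<dots> = 6 * (a ^ 5 * b ^ 5)" by (simp add: M_def max_def min_def mult_ac)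
    finally show ?thesis .
  qed
  have g: "a\<^sup>2 / (2 * s) \<le> g" using fusion_set_gradient[OF k q] by (simp add: s_def g_def a(2))
  have g0: "0 < g" using g a s by (intro less_le_trans[OF _ g]) auto
  have "fusion_kernel k q = 8 * pi * (V (k + q) k q)\<^sup>2 / ((3/2) * g)"
    unfolding fusion_kernel_def g_def by simp
  also have "\<dots> \<le> 8 * pi * ((s\<^sup>2)\<^sup>2 * (min a b) ^ 5) / ((3/2) * g)"
    using V g0 by (intro divide_right_mono mult_left_mono) auto
  also have "\<dots> \<le> 8 * pi * ((s\<^sup>2)\<^sup>2 * (min a b) ^ 5) / ((3/2) * (a\<^sup>2 / (2 * s)))"
    using g s g0 a b by (intro divide_left_mono mult_left_mono) auto
  also have "\<dots> = (32/3) * pi * (s ^ 5 * (min a b) ^ 5) / a\<^sup>2"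
    using s(1) a(1) by (simp add: field_simps eval_nat_numeral)
  also have "\<dots> \<le> (32/3) * pi * (6 * (a ^ 5 * b ^ 5)) / a\<^sup>2"
    using key by (intro divide_right_mono mult_left_mono) auto
  also have "\<dots> = 64 * pi * a ^ 3 * b ^ 5"
    using a(1) by (simp add: field_simps eval_nat_numeral)
  finally show ?thesis by (simp add: a_def b_def)
qed

section \<open>Collision measures\<close>

definition decay_measure :: "'a::euclidean_space \<Rightarrow> 'a measure" where
  "decay_measure k = density hmeas (\<lambda>q. ennreal (indicator (decay_set k) q * decay_kernel k q))"

definition fusion_measure :: "'a::euclidean_space \<Rightarrow> 'a measure" where
  "fusion_measure k = density hmeas (\<lambda>q. ennreal (indicator (fusion_set k) q * fusion_kernel k q))"

lemma sets_collision_measure [simp, measurable_cong]: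
  "sets (decay_measure k) = sets borel" "sets (fusion_measure k) = sets borel"
  by (simp_all add: decay_measure_def fusion_measure_def)

lemma space_collision_measure [simp]:
  "space (decay_measure k) = UNIV" "space (fusion_measure k) = UNIV"
  by (simp_all add: decay_measure_def fusion_measure_def)

lemma omega_measurable [measurable]: "omega \<in> borel_measurable borel"
  unfolding omega_def[abs_def] by measurable

lemma omega_dir_measurable [measurable]: "omega_dir \<in> borel_measurable borel"
  unfolding omega_dir_def[abs_def] by measurable

lemma V_measurable [measurable (raw)]:
  assumes [measurable]: "f \<in> borel_measurable M" "g \<in> borel_measurable M" "h \<in> borel_measurable M"
  shows "(\<lambda>x. V (f x) (g x) (h x)) \<in> borel_measurable M"
  unfolding V_def Lc_def by measurable

lemma kernel_measurable [measurable (raw)]: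
  assumes [measurable]: "f \<in> borel_measurable M" "g \<in> borel_measurable M"
  shows "(\<lambda>x. decay_kernel (f x) (g x)) \<in> borel_measurable M"
    "(\<lambda>x. fusion_kernel (f x) (g x)) \<in> borel_measurable M"
  unfolding decay_kernel_def fusion_kernel_def by measurable

lemma resonance_set_borel [measurable]: "decay_set k \<in> sets borel" "fusion_set k \<in> sets borel"
  unfolding decay_set_def fusion_set_def by measurable

lemma integral_collision_measure:
  fixes f :: "'a::euclidean_space \<Rightarrow> real"
  assumes [measurable]: "f \<in> borel_measurable borel"
  shows "integral\<^sup>L (decay_measure k) f = (\<integral>q. indicator (decay_set k) q * (decay_kernel k q * f q) \<partial>hmeas)"
    "integral\<^sup>L (fusion_measure k) f = (\<integral>q. indicator (fusion_set k) q * (fusion_kernel k q * f q) \<partial>hmeas)"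
  unfolding decay_measure_def fusion_measure_def
  by (subst integral_density; simp add: mult.assoc)+

lemma integrable_collision_measure:
  fixes f :: "'a::euclidean_space \<Rightarrow> real"
  assumes [measurable]: "f \<in> borel_measurable borel"
  shows "integrable (decay_measure k) f \<longleftrightarrow> integrable hmeas (\<lambda>q. indicator (decay_set k) q * (decay_kernel k q * f q))"
    "integrable (fusion_measure k) f \<longleftrightarrow> integrable hmeas (\<lambda>q. indicator (fusion_set k) q * (fusion_kernel k q * f q))"
  unfolding decay_measure_def fusion_measure_def
  by (subst integrable_density; simp add: mult.assoc)+

lemma AE_collision_measure:
  "AE q in decay_measure k. q \<in> decay_set k" "AE q in fusion_measure k. q \<in> fusion_set k"
  unfolding decay_measure_def fusion_measure_def
  by (subst AE_density; auto simp: indicator_def intro!: AE_I2)+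

lemma grad_phase:
  "grad (\<lambda>q. omega k - omega (k - q) - omega q) q = (3/2) *\<^sub>R (omega_dir (k - q) - omega_dir q)"
  "grad (\<lambda>q. omega (k + q) - omega k - omega q) q = (3/2) *\<^sub>R (omega_dir (k + q) - omega_dir q)"
  by (rule grad_eq GDERIV_phase1 GDERIV_phase2)+

lemma integral_hausdorff_eq:
  fixes f :: "'a::euclidean_space \<Rightarrow> real"
  assumes [measurable]: "f \<in> borel_measurable borel"
  shows "integral\<^sup>L (hausdorff (DIM('a) - 1)) f = integral\<^sup>L hmeas f"
    "integrable (hausdorff (DIM('a) - 1)) f \<longleftrightarrow> integrable hmeas f"
  unfolding hmeas_def
  by (simp_all only: integral_distr[OF id_measurable_hausdorff assms] integrable_distr_eq[OF id_measurable_hausdorff assms])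

definition decay_density :: "('a::euclidean_space \<Rightarrow> real) \<Rightarrow> 'a \<Rightarrow> 'a \<Rightarrow> real" where
  "decay_density n k q = n (k - q) * n q - n k * n (k - q) - n k * n q"

definition fusion_density :: "('a::euclidean_space \<Rightarrow> real) \<Rightarrow> 'a \<Rightarrow> 'a \<Rightarrow> real" where
  "fusion_density n k q = n k * n q - n (k + q) * n k - n (k + q) * n q"

lemma delta_integral_decay:
  fixes n :: "'a::euclidean_space \<Rightarrow> real"
  assumes [measurable]: "n \<in> borel_measurable borel"
  shows "delta_integral (\<lambda>q. omega k - omega (k - q) - omega q) (\<lambda>q. R0 n k (k - q) q)
      = integral\<^sup>L (decay_measure k) (decay_density n k)"
    "delta_integrable (\<lambda>q. omega k - omega (k - q) - omega q) (\<lambda>q. R0 n k (k - q) q)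
      \<longleftrightarrow> integrable (decay_measure k) (decay_density n k)"
proof -
  have m [measurable]: "decay_density n k \<in> borel_measurable borel" unfolding decay_density_def[abs_def] by measurable
  have e: "indicat_real (decay_set k) q *\<^sub>R (R0 n k (k - q) q / norm (grad (\<lambda>q. omega k - omega (k - q) - omega q) q))
      = indicator (decay_set k) q * (decay_kernel k q * decay_density n k q)" for q
    unfolding R0_def grad_phase decay_kernel_def decay_density_def by simp
  show "delta_integral (\<lambda>q. omega k - omega (k - q) - omega q) (\<lambda>q. R0 n k (k - q) q)
      = integral\<^sup>L (decay_measure k) (decay_density n k)"
    unfolding delta_integral_def set_lebesgue_integral_def decay_set_def[symmetric] e
    by (subst integral_hausdorff_eq) (simp_all add: integral_collision_measure)
  show "delta_integrable (\<lambda>q. omega k - omega (k - q) - omega q) (\<lambda>q. R0 n k (k - q) q)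
      \<longleftrightarrow> integrable (decay_measure k) (decay_density n k)"
    unfolding delta_integrable_def set_integrable_def decay_set_def[symmetric] e
    by (subst integral_hausdorff_eq) (simp_all add: integrable_collision_measure)
qed

lemma delta_integral_fusion:
  fixes n :: "'a::euclidean_space \<Rightarrow> real"
  assumes [measurable]: "n \<in> borel_measurable borel"
  shows "2 * delta_integral (\<lambda>q. omega (k + q) - omega k - omega q) (\<lambda>q. R0 n (k + q) k q)
      = integral\<^sup>L (fusion_measure k) (fusion_density n k)"
    "delta_integrable (\<lambda>q. omega (k + q) - omega k - omega q) (\<lambda>q. R0 n (k + q) k q)
      \<longleftrightarrow> integrable (fusion_measure k) (fusion_density n k)"
proof -
  have m [measurable]: "fusion_density n k \<in> borel_measurable borel" unfolding fusion_density_def[abs_def] by measurable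
  have e: "indicat_real (fusion_set k) q *\<^sub>R (R0 n (k + q) k q / norm (grad (\<lambda>q. omega (k + q) - omega k - omega q) q))
      = (1/2) * (indicator (fusion_set k) q * (fusion_kernel k q * fusion_density n k q))" for q
    unfolding R0_def grad_phase fusion_kernel_def fusion_density_def by simp
  show "2 * delta_integral (\<lambda>q. omega (k + q) - omega k - omega q) (\<lambda>q. R0 n (k + q) k q)
      = integral\<^sup>L (fusion_measure k) (fusion_density n k)"
    unfolding delta_integral_def set_lebesgue_integral_def fusion_set_def[symmetric] e
    by (subst integral_hausdorff_eq) (simp_all add: integral_collision_measure)
  show "delta_integrable (\<lambda>q. omega (k + q) - omega k - omega q) (\<lambda>q. R0 n (k + q) k q)
      \<longleftrightarrow> integrable (fusion_measure k) (fusion_density n k)"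
    unfolding delta_integrable_def set_integrable_def fusion_set_def[symmetric] e integrable_collision_measure(2)[OF m]
    by (subst integral_hausdorff_eq, measurable) (simp only: integrable_mult_left_iff, simp)
qed

lemma S_eq:
  assumes "n \<in> borel_measurable borel"
  shows "S n k = integral\<^sup>L (decay_measure k) (decay_density n k) - integral\<^sup>L (fusion_measure k) (fusion_density n k)"
  unfolding S_def delta_integral_decay(1)[OF assms] delta_integral_fusion(1)[OF assms, symmetric] by simp

lemma S_converges_iff:
  assumes "n \<in> borel_measurable borel"
  shows "S_converges n k \<longleftrightarrow>
    integrable (decay_measure k) (decay_density n k) \<and> integrable (fusion_measure k) (fusion_density n k)"
  unfolding S_converges_def delta_integral_decay(2)[OF assms] delta_integral_fusion(2)[OF assms] by simp

section \<open>Integrals over the surfaces, uniformly in \<open>k\<close>\<close>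

lemma emeasure_density_hmeas:
  assumes [measurable]: "X \<in> sets borel" "Y \<in> sets borel"
  shows "emeasure (density hmeas (indicator X)) Y = emeasure hmeas (X \<inter> Y)"
proof -
  have "emeasure (density hmeas (indicator X)) Y = (\<integral>\<^sup>+ q. indicator X q * indicator Y q \<partial>hmeas)"
    by (rule emeasure_density) auto
  also have "\<dots> = (\<integral>\<^sup>+ q. indicator (X \<inter> Y) q \<partial>hmeas)" by (simp only: indicator_inter_arith)
  also have "\<dots> = emeasure hmeas (X \<inter> Y)" by (rule nn_integral_indicator) auto
  finally show ?thesis .
qed

lemma hmeas_resonance_mass:
  fixes k c :: "'a::euclidean_space"
  assumes k: "k \<noteq> 0" and r: "0 < r"
  defines "C \<equiv> cube_const TYPE('a) * 2 ^ (DIM('a) - 1)"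
  shows "emeasure (density hmeas (indicator (decay_set k))) (cball c r) \<le> ennreal (C * r ^ (DIM('a) - 1))"
    "emeasure (density hmeas (indicator (fusion_set k))) (cball c r) \<le> ennreal (C * r ^ (DIM('a) - 1))"
proof -
  have "cube_const TYPE('a) * r ^ (DIM('a) - 1) \<le> C * r ^ (DIM('a) - 1)"
    using cube_const_nonneg[where 'a = 'a] r unfolding C_def by (intro mult_right_mono) (auto simp: mult_le_cancel_left1)
  then show "emeasure (density hmeas (indicator (decay_set k))) (cball c r) \<le> ennreal (C * r ^ (DIM('a) - 1))"
    using decay_set_mass[OF k r, of c] by (simp add: emeasure_density_hmeas emeasure_hmeas order_trans[OF _ ennreal_leI])
  show "emeasure (density hmeas (indicator (fusion_set k))) (cball c r) \<le> ennreal (C * r ^ (DIM('a) - 1))"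
    using fusion_set_mass[OF k r, of c]
    by (simp add: emeasure_density_hmeas emeasure_hmeas C_def power_mult_distrib mult.assoc)
qed

text \<open>Measurability of integrals with a parameter rests on sigma-finiteness.
  \<open>hmeas\<close> on the whole space lacks it; the bounds on balls supply it on each
  surface.\<close>

lemma sigma_finite_resonance:
  fixes k :: "'a::euclidean_space"
  assumes "k \<noteq> 0"
  shows "sigma_finite_measure (density hmeas (indicator (decay_set k)))"
    "sigma_finite_measure (density hmeas (indicator (fusion_set k)))"
proof -
  have *: "sigma_finite_measure M" if "sets M = sets borel" "\<And>r. 0 < r \<Longrightarrow> emeasure M (cball (0::'a) r) \<noteq> \<infinity>" for M
  proof
    have "(\<Union>n::nat. cball (0::'a) (real (Suc n))) = UNIV"
    proof (safe intro!: UNIV_I)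
      fix x :: 'a
      obtain n :: nat where "norm x < real n" using reals_Archimedean2 by blast
      then show "x \<in> (\<Union>n::nat. cball 0 (real (Suc n)))" by (intro UN_I[of n]) auto
    qed
    then show "\<exists>A. countable A \<and> A \<subseteq> sets M \<and> \<Union> A = space M \<and> (\<forall>a\<in>A. emeasure M a \<noteq> \<infinity>)"
      using that sets_eq_imp_space_eq[OF that(1)]
      by (intro exI[of _ "range (\<lambda>n::nat. cball (0::'a) (real (Suc n)))"]) (auto simp del: of_nat_Suc)
  qed
  show "sigma_finite_measure (density hmeas (indicator (decay_set k)))"
    by (intro *) (use hmeas_resonance_mass(1)[OF assms, of _ 0] in \<open>force simp: top_unique\<close>)+
  show "sigma_finite_measure (density hmeas (indicator (fusion_set k)))"
    by (intro *) (use hmeas_resonance_mass(2)[OF assms, of _ 0] in \<open>force simp: top_unique\<close>)+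
qed

text \<open>The constant of the kernel bounds, the surface mass (with the factor L = 2 of the fusion
  surface) and the shell sum.\<close>

definition transition_const :: "'a::euclidean_space itself \<Rightarrow> real" where
  "transition_const _ = 64 * pi * (cube_const TYPE('a) * 2 ^ (DIM('a) - 1) * shell_const (DIM('a) - 1))"

lemma transition_const_nonneg: "0 \<le> transition_const TYPE('a::euclidean_space)"
  unfolding transition_const_def by (intro mult_nonneg_nonneg cube_const_nonneg shell_const_nonneg) auto

lemma sqrt_power_le_jap: "sqrt (norm q) ^ m \<le> jap q ^ j" if "m \<le> 2 * j"
proof -
  have "sqrt (norm q) \<le> sqrt (jap q)" using jap_ge(2) by simp
  then have "sqrt (norm q) ^ m \<le> sqrt (jap q) ^ m" by (intro power_mono) auto
  also have "\<dots> \<le> sqrt (jap q) ^ (2 * j)" using jap_ge(1)[of q] that by (intro power_increasing) auto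
  also have "\<dots> = jap q ^ j" by (simp add: power_mult less_imp_le)
  finally show ?thesis .
qed

lemma weight_le:
  fixes q :: "'a::euclidean_space"
  assumes "m \<le> 2 * j" "j + d + 1 \<le> i" "y \<le> sqrt (norm q) ^ m"
  shows "y / jap q ^ i \<le> 1 / jap q ^ (d + 1)"
proof -
  have "y / jap q ^ i \<le> jap q ^ j / jap q ^ (j + d + 1)"
    using assms sqrt_power_le_jap[OF assms(1), of q] jap_ge(1)[of q]
    by (intro frac_le power_increasing) auto
  also have "\<dots> = 1 / jap q ^ (d + 1)" by (simp add: power_add field_simps less_imp_neq[OF jap_pos, symmetric])
  finally show ?thesis .
qed

text \<open>The kernel bounds separate the variables: |k|^(3/2) is \<open>omega k\<close>, and |q -
  c|^(5/2) is charged to f. What remains is a weight of exponent d + 1 = (d - 1) + 2, which the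
  surface mass can integrate. The base point c may be k only for decays.\<close>

lemma nn_integral_resonance_le:
  fixes f :: "'a::euclidean_space \<Rightarrow> real"
  assumes k: "k \<noteq> 0" and [measurable]: "f \<in> borel_measurable borel" and f0: "\<And>q. 0 \<le> f q"
    and le: "\<And>q. sqrt (norm (q - c)) ^ 5 * f q \<le> 1 / jap (q - c) ^ (DIM('a) + 1)"
  shows "c = 0 \<or> c = k \<Longrightarrow> (\<integral>\<^sup>+ q. ennreal (f q) \<partial>decay_measure k) \<le> ennreal (transition_const TYPE('a) * sqrt (norm k) ^ 3)"
    "c = 0 \<Longrightarrow> (\<integral>\<^sup>+ q. ennreal (f q) \<partial>fusion_measure k) \<le> ennreal (transition_const TYPE('a) * sqrt (norm k) ^ 3)"
proof -
  define C where "C = cube_const TYPE('a) * 2 ^ (DIM('a) - 1)"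
  have C: "0 \<le> C" by (simp add: C_def cube_const_nonneg)
  have D: "DIM('a) - 1 + 2 = DIM('a) + 1" using DIM_positive[where 'a = 'a] by linarith
  have gen: "(\<integral>\<^sup>+ q. ennreal (f q) \<partial>density hmeas (\<lambda>q. ennreal (indicator X q * K q))) \<le> ennreal (transition_const TYPE('a) * sqrt (norm k) ^ 3)"
    if [measurable]: "X \<in> sets borel" "K \<in> borel_measurable borel"
      and K0: "\<And>q. 0 \<le> K q" and K: "\<And>q. q \<in> X \<Longrightarrow> K q \<le> 64 * pi * sqrt (norm k) ^ 3 * sqrt (norm (q - c)) ^ 5"
      and mass: "\<And>r. 0 < r \<Longrightarrow> emeasure (density hmeas (indicator X)) (cball c r) \<le> ennreal (C * r ^ (DIM('a) - 1))"
    for X and K :: "'a \<Rightarrow> real"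
  proof -
    have "(\<integral>\<^sup>+ q. ennreal (f q) \<partial>density hmeas (\<lambda>q. ennreal (indicator X q * K q)))
        = (\<integral>\<^sup>+ q. ennreal (indicator X q * K q) * ennreal (f q) \<partial>hmeas)"
      by (rule nn_integral_density) auto
    also have "\<dots> \<le> (\<integral>\<^sup>+ q. ennreal (64 * pi * sqrt (norm k) ^ 3) * (indicator X q * ennreal (1 / jap (q - c) ^ (DIM('a) + 1))) \<partial>hmeas)"
    proof (rule nn_integral_mono)
      fix q
      show "ennreal (indicator X q * K q) * ennreal (f q) \<le> ennreal (64 * pi * sqrt (norm k) ^ 3) * (indicator X q * ennreal (1 / jap (q - c) ^ (DIM('a) + 1)))"
      proof (cases "q \<in> X")
        case True
        have "K q * f q \<le> (64 * pi * sqrt (norm k) ^ 3 * sqrt (norm (q - c)) ^ 5) * f q"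
          using K[OF True] f0 by (intro mult_right_mono) auto
        also have "\<dots> \<le> 64 * pi * sqrt (norm k) ^ 3 * (1 / jap (q - c) ^ (DIM('a) + 1))"
          unfolding mult.assoc using le[of q] by (intro mult_left_mono) auto
        finally show ?thesis using True K0 f0 by (simp add: ennreal_mult[symmetric] ennreal_leI less_imp_le)
      qed simp
    qed
    also have "\<dots> = ennreal (64 * pi * sqrt (norm k) ^ 3) * (\<integral>\<^sup>+ q. indicator X q * ennreal (1 / jap (q - c) ^ (DIM('a) + 1)) \<partial>hmeas)"
      by (rule nn_integral_cmult) measurable
    also have "(\<integral>\<^sup>+ q. indicator X q * ennreal (1 / jap (q - c) ^ (DIM('a) + 1)) \<partial>hmeas) = (\<integral>\<^sup>+ q. ennreal (1 / jap (q - c) ^ (DIM('a) - 1 + 2)) \<partial>density hmeas (indicator X))"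
      unfolding D by (rule nn_integral_density[symmetric]) auto
    also have "\<dots> \<le> ennreal (C * shell_const (DIM('a) - 1))"
      by (rule nn_integral_jap_le[OF _ _ C mass]) auto
    also have "ennreal (64 * pi * sqrt (norm k) ^ 3) * ennreal (C * shell_const (DIM('a) - 1)) = ennreal (transition_const TYPE('a) * sqrt (norm k) ^ 3)"
    proof -
      have "ennreal (64 * pi * sqrt (norm k) ^ 3) * ennreal (C * shell_const (DIM('a) - 1)) = ennreal (64 * pi * sqrt (norm k) ^ 3 * (C * shell_const (DIM('a) - 1)))"
        using C shell_const_nonneg[of "DIM('a) - 1"] by (intro ennreal_mult[symmetric]) auto
      then show ?thesis by (simp add: transition_const_def C_def mult_ac)
    qed
    finally show ?thesis by (simp add: mult_left_mono)
  qed
  show "(\<integral>\<^sup>+ q. ennreal (f q) \<partial>decay_measure k) \<le> ennreal (transition_const TYPE('a) * sqrt (norm k) ^ 3)" if "c = 0 \<or> c = k"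
    unfolding decay_measure_def
  proof (rule gen)
    show "decay_kernel k q \<le> 64 * pi * sqrt (norm k) ^ 3 * sqrt (norm (q - c)) ^ 5" if "q \<in> decay_set k" for q
      using decay_kernel_le[OF that k] \<open>c = 0 \<or> c = k\<close> by (auto simp: norm_minus_commute)
  qed (use hmeas_resonance_mass(1)[OF k] in \<open>auto simp: C_def\<close>)
  show "(\<integral>\<^sup>+ q. ennreal (f q) \<partial>fusion_measure k) \<le> ennreal (transition_const TYPE('a) * sqrt (norm k) ^ 3)" if "c = 0"
    unfolding fusion_measure_def
  proof (rule gen)
    show "fusion_kernel k q \<le> 64 * pi * sqrt (norm k) ^ 3 * sqrt (norm (q - c)) ^ 5" if "q \<in> fusion_set k" for q
      using fusion_kernel_le[OF that k] \<open>c = 0\<close> by auto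
  qed (use hmeas_resonance_mass(2)[OF k] in \<open>auto simp: C_def\<close>)
qed

text \<open>The similarity \<open>transport e k\<close>, a scaled Householder reflection, maps the unit vector \<open>e\<close>
  to \<open>k\<close>; it carries the resonance surfaces of \<open>e\<close> to those of \<open>k\<close> and is jointly measurable.\<close>

definition transport :: "'a::euclidean_space \<Rightarrow> 'a \<Rightarrow> 'a \<Rightarrow> 'a" where
  "transport e k q = (let v = e - sgn k in norm k *\<^sub>R (q - (2 * inner v q / inner v v) *\<^sub>R v))"

lemma transport_measurable [measurable (raw)]:
  assumes [measurable]: "f \<in> borel_measurable M" "g \<in> borel_measurable M"
  shows "(\<lambda>x. transport e (f x) (g x)) \<in> borel_measurable M"
  unfolding transport_def Let_def sgn_div_norm by measurable

lemma transport_add: "transport e k (p + q) = transport e k p + transport e k q"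
  by (simp add: transport_def Let_def algebra_simps inner_add_right add_divide_distrib)

lemma transport_diff: "transport e k (p - q) = transport e k p - transport e k q"
  by (simp add: transport_def Let_def algebra_simps inner_diff_right diff_divide_distrib)

lemma transport_scaleR: "transport e k (c *\<^sub>R q) = c *\<^sub>R transport e k q"
  by (simp add: transport_def Let_def scaleR_diff_right mult_ac)

lemma norm_transport: "norm (transport e k q) = norm k * norm q"
proof -
  define v where "v = e - sgn k"
  \<comment> \<open>If k is a positive multiple of e then v = 0; division by zero then makes the map
    a plain dilation.\<close>
  have "(norm (q - (2 * inner v q / inner v v) *\<^sub>R v))\<^sup>2 = (norm q)\<^sup>2"
    unfolding power2_norm_eq_inner
    by (cases "v = 0") (simp_all add: inner_diff_left inner_diff_right inner_commute field_simps)
  then show ?thesis by (simp add: transport_def Let_def v_def)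
qed

lemma transport_self:
  assumes "norm e = 1"
  shows "transport e k e = k"
proof (cases "k = 0")
  case False
  define v where "v = e - sgn k"
  have e: "inner e e = 1" using assms by (simp add: norm_eq_1)
  have s: "inner (sgn k) (sgn k) = 1" using False by (simp add: norm_sgn flip: norm_eq_1)
  have "inner v v = 2 * inner v e"
    using e s by (simp add: v_def inner_diff_left inner_diff_right inner_commute)
  then have "(2 * inner v e / inner v v) *\<^sub>R v = v" by (cases "v = 0") (simp_all flip: \<open>inner v v = 2 * inner v e\<close>)
  then have "transport e k e = norm k *\<^sub>R sgn k" by (simp add: transport_def Let_def v_def)
  then show ?thesis using False by (simp add: sgn_div_norm)
qed (simp add: transport_def)

lemma dist_transport: "dist (transport e k p) (transport e k q) = norm k * dist p q"
  by (simp add: dist_norm transport_diff[symmetric] norm_transport)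

lemma surj_transport:
  assumes "k \<noteq> 0"
  shows "surj (transport e k)"
proof (rule linear_inj_imp_surj)
  show "linear (transport e k)" by (intro linearI transport_add transport_scaleR)
  show "inj (transport e k)"
    by (rule injI) (use assms dist_transport[of e k] in \<open>metis dist_eq_0_iff mult_eq_0_iff norm_eq_zero\<close>)
qed

lemma omega_transport: "omega (transport e k q) = sqrt (norm k) ^ 3 * omega q"
  by (simp add: omega_eq norm_transport real_sqrt_mult power_mult_distrib)

lemma transport_resonance:
  assumes e: "norm e = 1" and k: "k \<noteq> 0"
  shows "transport e k q \<in> decay_set k \<longleftrightarrow> q \<in> decay_set e"
    "transport e k q \<in> fusion_set k \<longleftrightarrow> q \<in> fusion_set e"
proof -
  have d: "k - transport e k q = transport e k (e - q)" and a: "k + transport e k q = transport e k (e + q)"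
    by (simp_all add: transport_diff transport_add transport_self[OF e])
  have ke: "omega k = sqrt (norm k) ^ 3 * omega e"
    using omega_transport[of e k e] by (simp add: transport_self[OF e])
  have "omega k - omega (k - transport e k q) - omega (transport e k q) = sqrt (norm k) ^ 3 * (omega e - omega (e - q) - omega q)"
    "omega (k + transport e k q) - omega k - omega (transport e k q) = sqrt (norm k) ^ 3 * (omega (e + q) - omega e - omega q)"
    by (simp_all only: d a ke omega_transport right_diff_distrib)
  then show "transport e k q \<in> decay_set k \<longleftrightarrow> q \<in> decay_set e"
    "transport e k q \<in> fusion_set k \<longleftrightarrow> q \<in> fusion_set e"
    using k by (simp_all only: decay_set_def fusion_set_def mem_Collect_eq mult_eq_0_iff power_eq_0_iff real_sqrt_eq_0_iff norm_eq_zero) simp_all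
qed

lemma integral_resonance_measurable:
  fixes \<kappa> :: "'b \<Rightarrow> 'a::euclidean_space" and f :: "'b \<Rightarrow> 'a \<Rightarrow> real"
  assumes [measurable]: "\<kappa> \<in> borel_measurable M" "(\<lambda>(x, q). f x q) \<in> borel_measurable (M \<Otimes>\<^sub>M borel)"
  shows "(\<lambda>x. integral\<^sup>L (decay_measure (\<kappa> x)) (f x)) \<in> borel_measurable M"
    "(\<lambda>x. integral\<^sup>L (fusion_measure (\<kappa> x)) (f x)) \<in> borel_measurable M"
proof -
  obtain e :: 'a where e: "norm e = 1" using norm_Basis nonempty_Basis by blast
  then have e0: "e \<noteq> 0" by auto
  have fx: "f x \<in> borel_measurable borel" if "x \<in> space M" for x
    using measurable_Pair2[OF assms(2) that] by simp
  define N1 where "N1 = density hmeas (indicator (decay_set e))"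
  define N2 where "N2 = density hmeas (indicator (fusion_set e))"
  interpret N1: sigma_finite_measure N1 unfolding N1_def by (rule sigma_finite_resonance[OF e0])
  interpret N2: sigma_finite_measure N2 unfolding N2_def by (rule sigma_finite_resonance[OF e0])
  have sN [measurable_cong]: "sets N1 = sets borel" "sets N2 = sets borel" by (simp_all add: N1_def N2_def)
  \<comment> \<open>All dependence on k moves from the domain of integration into the integrand; the
    power of |k| is the scaling of (d-1)-dimensional measure.\<close>
  have eq: "integral\<^sup>L hmeas (\<lambda>q. indicator X q * g q) = norm k ^ (DIM('a) - 1) * (\<integral>q. g (transport e k q) \<partial>density hmeas (indicator Y))"
    if k: "k \<noteq> 0" and [measurable]: "X \<in> sets borel" "Y \<in> sets borel" and g [measurable]: "g \<in> borel_measurable borel"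
      and XY: "\<And>q. transport e k q \<in> X \<longleftrightarrow> q \<in> Y" for X Y k and g :: "'a \<Rightarrow> real"
  proof -
    have "integral\<^sup>L hmeas (\<lambda>q. indicator X q * g q) = norm k ^ (DIM('a) - 1) * (\<integral>q. indicator X (transport e k q) * g (transport e k q) \<partial>hmeas)"
      by (rule integral_hmeas_similarity) (use k in \<open>auto simp: dist_transport surj_transport\<close>)
    also have "(\<integral>q. indicator X (transport e k q) * g (transport e k q) \<partial>hmeas) = (\<integral>q. indicator Y q *\<^sub>R g (transport e k q) \<partial>hmeas)"
      using XY by (intro Bochner_Integration.integral_cong) (auto simp: indicator_def)
    also have "\<dots> = (\<integral>q. g (transport e k q) \<partial>density hmeas (\<lambda>q. ennreal (indicator Y q)))"
      by (rule integral_density[symmetric]) auto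
    finally show ?thesis by (simp add: ennreal_indicator)
  qed
  have 1: "integral\<^sup>L (decay_measure k) g = norm k ^ (DIM('a) - 1) * (\<integral>q. decay_kernel k (transport e k q) * g (transport e k q) \<partial>N1)"
    if [measurable]: "g \<in> borel_measurable borel" for g k
  proof (cases "k = 0")
    case True then show ?thesis by (simp add: integral_collision_measure)
  next
    case False
    then show ?thesis unfolding N1_def
      by (subst integral_collision_measure, measurable) (rule eq, simp_all add: transport_resonance[OF e])
  qed
  have 2: "integral\<^sup>L (fusion_measure k) g = norm k ^ (DIM('a) - 1) * (\<integral>q. fusion_kernel k (transport e k q) * g (transport e k q) \<partial>N2)"
    if [measurable]: "g \<in> borel_measurable borel" for g k
  proof (cases "k = 0")
    case True then show ?thesis by (simp add: integral_collision_measure)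
  next
    case False
    then show ?thesis unfolding N2_def
      by (subst integral_collision_measure, measurable) (rule eq, simp_all add: transport_resonance[OF e])
  qed
  have "(\<lambda>x. norm (\<kappa> x) ^ (DIM('a) - 1) * (\<integral>q. decay_kernel (\<kappa> x) (transport e (\<kappa> x) q) * f x (transport e (\<kappa> x) q) \<partial>N1)) \<in> borel_measurable M"
    by measurable
  then show "(\<lambda>x. integral\<^sup>L (decay_measure (\<kappa> x)) (f x)) \<in> borel_measurable M"
    by (rule measurable_cong[THEN iffD1, rotated]) (simp add: 1[OF fx])
  have "(\<lambda>x. norm (\<kappa> x) ^ (DIM('a) - 1) * (\<integral>q. fusion_kernel (\<kappa> x) (transport e (\<kappa> x) q) * f x (transport e (\<kappa> x) q) \<partial>N2)) \<in> borel_measurable M"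
    by measurable
  then show "(\<lambda>x. integral\<^sup>L (fusion_measure (\<kappa> x)) (f x)) \<in> borel_measurable M"
    by (rule measurable_cong[THEN iffD1, rotated]) (simp add: 2[OF fx])
qed

section \<open>Weighted estimates\<close>

lemma jap_nonneg [simp]: "0 \<le> jap k" and jap_neq_0 [simp]: "jap k \<noteq> 0"
  using jap_pos[of k] by linarith+

definition sup_weight :: "'a::euclidean_space \<Rightarrow> real" where
  "sup_weight k = 1 / jap k ^ (4 * DIM('a) + 12)"

definition low_weight :: "'a::euclidean_space \<Rightarrow> real" where
  "low_weight k = 1 / jap k ^ (2 * DIM('a) + 2)"

lemma weights_measurable [measurable]:
  "sup_weight \<in> borel_measurable borel" "low_weight \<in> borel_measurable borel"
  unfolding sup_weight_def[abs_def] low_weight_def[abs_def] by measurable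

lemma weights_pos [simp]: "0 < sup_weight k" "0 < low_weight k"
  by (simp_all add: sup_weight_def low_weight_def)

lemma weights_nonneg [simp]: "0 \<le> sup_weight k" "0 \<le> low_weight k"
  by (simp_all add: less_imp_le)

lemma weights_mono:
  fixes k p :: "'a::euclidean_space"
  assumes "norm k \<le> norm p"
  shows "sup_weight p \<le> sup_weight k" "low_weight p \<le> low_weight k"
  unfolding sup_weight_def low_weight_def
  using jap_mono[OF assms] by (intro divide_left_mono power_mono; simp add: less_imp_le)+

lemma low_weight_le_1:
  fixes k :: "'a::euclidean_space"
  shows "low_weight k \<le> 1"
  using one_le_power[OF jap_ge(1), of k "2 * DIM('a) + 2"] by (simp only: low_weight_def divide_le_eq_1 zero_less_power jap_pos) simp

text \<open>Ten of the 2d + 10 powers between the exponents. They absorb \<open>omega k\<close>, and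
  they make differences of dominated functions small for large k.\<close>

lemma sup_weight_le:
  fixes k :: "'a::euclidean_space"
  shows "sup_weight k \<le> low_weight k * (1 / jap k ^ 10)"
proof -
  have "jap k ^ (2 * DIM('a) + 2) * jap k ^ 10 \<le> jap k ^ (4 * DIM('a) + 12)"
    unfolding power_add[symmetric] using jap_ge(1)[of k] by (intro power_increasing) auto
  then show ?thesis
    unfolding sup_weight_def low_weight_def times_divide_times_eq mult_1_left by (rule divide_left_mono) simp_all
qed

lemma sup_weight_le_low: "sup_weight k \<le> low_weight k"
  using jap_ge(1)[of k] unfolding sup_weight_def low_weight_def
  by (intro divide_left_mono power_increasing) auto

lemma omega_le_jap: "omega k \<le> jap k ^ 2"
  unfolding omega_eq by (rule sqrt_power_le_jap) simp

lemma sup_weight_omega_le: "sup_weight k * omega k \<le> low_weight k"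
proof -
  have "sup_weight k * omega k \<le> (low_weight k * (1 / jap k ^ 10)) * jap k ^ 10"
  proof (intro mult_mono sup_weight_le)
    have "jap k ^ 2 \<le> jap k ^ 10" using jap_ge(1)[of k] by (intro power_increasing) auto
    then show "omega k \<le> jap k ^ 10" using omega_le_jap[of k] by linarith
  qed (auto simp: less_imp_le)
  then show ?thesis by simp
qed

text \<open>In a fusion p = k + q is the longest vector, so its weight can be shared out: two powers
  at k, which cancel \<open>omega k\<close>, and a low weight at q, which is integrated over the
  surface.\<close>

lemma sup_weight_add_le:
  fixes k p q :: "'a::euclidean_space"
  assumes "norm q \<le> norm p" "norm k \<le> norm p"
  shows "sup_weight p \<le> 1 / jap k ^ 2 * low_weight q"
proof -
  have "jap k ^ 2 * jap q ^ (2 * DIM('a) + 2) \<le> jap p ^ 2 * jap p ^ (2 * DIM('a) + 2)"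
    using jap_mono[OF assms(1)] jap_mono[OF assms(2)] by (intro mult_mono power_mono) auto
  also have "\<dots> \<le> jap p ^ (4 * DIM('a) + 12)"
    unfolding power_add[symmetric] using jap_ge(1)[of p] by (intro power_increasing) auto
  finally show ?thesis
    unfolding sup_weight_def low_weight_def times_divide_times_eq mult_1_left by (rule divide_left_mono) simp_all
qed

lemma one_plus_power_le:
  fixes v :: real
  assumes "0 \<le> v" "v \<le> 1"
  shows "(1 + v) ^ m \<le> 1 + 3 ^ m * v"
proof (induction m)
  case (Suc m)
  have "(1 + v) ^ Suc m \<le> (1 + v) * (1 + 3 ^ m * v)"
    using Suc assms by (simp add: mult_left_mono)
  also have "\<dots> = 1 + v + 3 ^ m * v + 3 ^ m * (v * v)" by (simp add: algebra_simps)
  finally have "(1 + v) ^ Suc m \<le> 1 + v + 3 ^ m * v + 3 ^ m * (v * v)" .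
  moreover have "3 ^ m * (v * v) \<le> 3 ^ m * v" using assms by (intro mult_left_mono) (auto simp: mult_left_le)
  moreover have "1 * v \<le> 3 ^ m * v" using assms by (intro mult_right_mono) auto
  ultimately have "(1 + v) ^ Suc m \<le> 1 + 3 * (3 ^ m * v)" by linarith
  then show ?case by simp
qed (use assms in simp)

text \<open>In a decay \<open>k = b + h\<close> the large wave vector \<open>b\<close> is shorter than \<open>k\<close> only by a factor
  \<open>1 + O(omega h / omega k)\<close>; this resonance gain of \<open>3/2\<close> powers beats the growth of the kernel.\<close>

lemma weight_increment:
  fixes k b h :: "'a::euclidean_space"
  assumes k: "k \<noteq> 0" and res: "omega k = omega b + omega h" and hb: "norm h \<le> norm b"
  shows "1 / jap b ^ m \<le> 1 / jap k ^ m * (1 + 2 * 3 ^ m * (omega h / omega k))"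
proof -
  have wk: "0 < omega k" using k by (simp add: less_le)
  have "omega h \<le> omega b" using hb by (simp add: omega_le_iff)
  then have b2: "omega k \<le> 2 * omega b" using res by simp
  then have wb: "0 < omega b" using wk by linarith
  then have nb: "0 < norm b" by (metis less_irrefl omega_eq_0_iff zero_less_norm_iff)
  define \<rho> v where "\<rho> = norm k / norm b" and "v = omega h / omega b"
  have kb: "norm b \<le> norm k" using res by (simp flip: omega_le_iff)
  have rho: "1 \<le> \<rho>" using kb nb by (simp add: \<rho>_def)
  \<comment> \<open>As \<rho> is at least 1, it is at most its power 3/2, which is the ratio of the
    frequencies and hence 1 + v by resonance.\<close>
  have "1 \<le> sqrt \<rho>" using rho by simp
  then have "\<rho> \<le> sqrt \<rho> ^ 3"
    using rho mult_left_mono[of 1 "sqrt \<rho>" \<rho>] by (simp add: power3_eq_cube)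
  also have "sqrt \<rho> ^ 3 = omega k / omega b"
    by (simp add: omega_eq \<rho>_def real_sqrt_divide power_divide)
  also have "\<dots> = 1 + v" using wb nb res by (simp add: v_def add_divide_distrib)
  finally have rv: "\<rho> \<le> 1 + v" .
  have v: "0 \<le> v" "v \<le> 1" "v \<le> 2 * (omega h / omega k)"
  proof -
    show "0 \<le> v" "v \<le> 1" using wb \<open>omega h \<le> omega b\<close> by (simp_all add: v_def)
    have "omega h * omega k \<le> omega h * (2 * omega b)" using b2 by (intro mult_left_mono) auto
    then show "v \<le> 2 * (omega h / omega k)" using wb wk by (simp add: v_def field_simps)
  qed
  \<comment> \<open>Scaling by \<rho> also enlarges the constant 1 under the root of
    \<open>jap\<close>, which is in the right direction.\<close>
  have "jap k \<le> \<rho> * jap b"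
  proof -
    have "(norm k)\<^sup>2 = \<rho>\<^sup>2 * (norm b)\<^sup>2" using nb by (simp add: \<rho>_def power_divide)
    moreover have "1 \<le> \<rho>\<^sup>2" using rho by (simp add: one_le_power)
    ultimately have "1 + (norm k)\<^sup>2 \<le> \<rho>\<^sup>2 * (1 + (norm b)\<^sup>2)" by (simp add: algebra_simps)
    then have "jap k \<le> sqrt (\<rho>\<^sup>2 * (1 + (norm b)\<^sup>2))" by (simp add: jap_def)
    also have "\<dots> = \<rho> * jap b" using rho by (simp add: jap_def real_sqrt_mult)
    finally show ?thesis .
  qed
  also have "\<dots> \<le> (1 + v) * jap b" using rv by (intro mult_right_mono) (auto simp: less_imp_le)
  finally have "jap k ^ m \<le> ((1 + v) * jap b) ^ m" by (intro power_mono) (auto simp: less_imp_le)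
  also have "\<dots> \<le> (1 + 3 ^ m * v) * jap b ^ m"
    unfolding power_mult_distrib using v by (intro mult_right_mono one_plus_power_le) (auto simp: less_imp_le)
  also have "\<dots> \<le> (1 + 3 ^ m * (2 * (omega h / omega k))) * jap b ^ m"
    using v by (intro mult_right_mono add_left_mono mult_left_mono) (auto simp: less_imp_le)
  finally have "jap k ^ m \<le> (1 + 3 ^ m * (2 * (omega h / omega k))) * jap b ^ m" .
  then show ?thesis by (simp add: field_simps)
qed

lemma integral_weight_bound:
  fixes f g :: "'b \<Rightarrow> real"
  assumes [measurable]: "f \<in> borel_measurable M"
    and le: "AE q in M. \<bar>f q\<bar> \<le> g q" and g: "integrable M g"
  shows "integrable M f" "\<bar>integral\<^sup>L M f\<bar> \<le> integral\<^sup>L M g"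
proof -
  show f: "integrable M f" by (rule Bochner_Integration.integrable_bound[OF g]) (use le in auto)
  have "\<bar>integral\<^sup>L M f\<bar> \<le> (\<integral>q. \<bar>f q\<bar> \<partial>M)" by (rule integral_abs_bound)
  also have "\<dots> \<le> integral\<^sup>L M g" using f g le by (intro integral_mono_AE) auto
  finally show "\<bar>integral\<^sup>L M f\<bar> \<le> integral\<^sup>L M g" .
qed

lemma integral_resonance_le:
  fixes f :: "'a::euclidean_space \<Rightarrow> real"
  assumes f [measurable]: "f \<in> borel_measurable borel" and f0: "\<And>q. 0 \<le> f q"
    and le: "\<And>q. sqrt (norm (q - c)) ^ 5 * f q \<le> 1 / jap (q - c) ^ (DIM('a) + 1)"
  shows "c = 0 \<or> c = k \<Longrightarrow> integrable (decay_measure k) f"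
    "c = 0 \<or> c = k \<Longrightarrow> integral\<^sup>L (decay_measure k) f \<le> transition_const TYPE('a) * omega k"
    "c = 0 \<Longrightarrow> integrable (fusion_measure k) f"
    "c = 0 \<Longrightarrow> integral\<^sup>L (fusion_measure k) f \<le> transition_const TYPE('a) * omega k"
proof -
  have 0: "integral\<^sup>N (decay_measure 0) g = 0 \<and> integral\<^sup>N (fusion_measure 0) g = 0" if "g \<in> borel_measurable borel" for g :: "'a \<Rightarrow> ennreal"
  proof -
    have "g \<in> borel_measurable hmeas" using that by simp
    then show ?thesis by (simp add: decay_measure_def fusion_measure_def nn_integral_density[of "\<lambda>_. 0"])
  qed
  have C: "0 \<le> transition_const TYPE('a) * omega k" by (simp add: transition_const_nonneg)
  have gen: "integrable M f \<and> integral\<^sup>L M f \<le> transition_const TYPE('a) * omega k"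
    if M: "sets M = sets borel" and b: "(\<integral>\<^sup>+ q. ennreal (f q) \<partial>M) \<le> ennreal (transition_const TYPE('a) * omega k)" for M
  proof -
    have [measurable]: "f \<in> borel_measurable M" using f by (simp add: measurable_cong_sets[OF M refl])
    have "(\<integral>\<^sup>+ q. ennreal (norm (f q)) \<partial>M) < \<infinity>"
      using b f0 by (simp add: le_less_trans[OF _ ennreal_less_top])
    then have i: "integrable M f" by (intro integrableI_bounded) auto
    have "ennreal (integral\<^sup>L M f) \<le> ennreal (transition_const TYPE('a) * omega k)"
      using b nn_integral_eq_integral[OF i] f0 by simp
    then show ?thesis using i C by simp
  qed
  have d: "integrable (decay_measure k) f \<and> integral\<^sup>L (decay_measure k) f \<le> transition_const TYPE('a) * omega k" if c: "c = 0 \<or> c = k"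
    by (rule gen) (use nn_integral_resonance_le(1)[OF _ f f0 le c] 0 in \<open>cases "k = 0"; simp add: omega_eq\<close>)+
  have e: "integrable (fusion_measure k) f \<and> integral\<^sup>L (fusion_measure k) f \<le> transition_const TYPE('a) * omega k" if c: "c = 0"
    by (rule gen) (use nn_integral_resonance_le(2)[OF _ f f0 le c] 0 in \<open>cases "k = 0"; simp add: omega_eq\<close>)+
  show "c = 0 \<or> c = k \<Longrightarrow> integrable (decay_measure k) f"
    "c = 0 \<or> c = k \<Longrightarrow> integral\<^sup>L (decay_measure k) f \<le> transition_const TYPE('a) * omega k"
    "c = 0 \<Longrightarrow> integrable (fusion_measure k) f"
    "c = 0 \<Longrightarrow> integral\<^sup>L (fusion_measure k) f \<le> transition_const TYPE('a) * omega k"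
    using d e by auto
qed

text \<open>The power |q|^(5/2) costs three powers of \<open>jap\<close>, and d + 1 must remain: 3 +
  d + 1 \<le> 2d + 2 is where the dimension enters.\<close>

lemma integral_low_weight:
  fixes k :: "'a::euclidean_space"
  assumes d: "2 \<le> DIM('a)"
  shows "integrable (decay_measure k) low_weight"
    "integral\<^sup>L (decay_measure k) low_weight \<le> transition_const TYPE('a) * omega k"
    "integrable (decay_measure k) (\<lambda>q. low_weight (k - q))"
    "integral\<^sup>L (decay_measure k) (\<lambda>q. low_weight (k - q)) \<le> transition_const TYPE('a) * omega k"
    "integrable (fusion_measure k) low_weight"
    "integral\<^sup>L (fusion_measure k) low_weight \<le> transition_const TYPE('a) * omega k"
proof -
  have le: "sqrt (norm q) ^ 5 * low_weight q \<le> 1 / jap q ^ (DIM('a) + 1)" for q :: 'a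
    using weight_le[of 5 3 "DIM('a)" "2 * DIM('a) + 2" "sqrt (norm q) ^ 5" q] d by (simp add: low_weight_def)
  have 0: "sqrt (norm (q - 0)) ^ 5 * low_weight q \<le> 1 / jap (q - 0) ^ (DIM('a) + 1)" for q :: 'a
    using le[of q] by simp
  have k: "sqrt (norm (q - k)) ^ 5 * low_weight (k - q) \<le> 1 / jap (q - k) ^ (DIM('a) + 1)" for q :: 'a
    using le[of "k - q"] by (simp add: norm_minus_commute jap_minus_commute)
  note R = integral_resonance_le[OF weights_measurable(2) weights_nonneg(2) 0]
  show "integrable (decay_measure k) low_weight" by (rule R(1)) simp
  show "integral\<^sup>L (decay_measure k) low_weight \<le> transition_const TYPE('a) * omega k" by (rule R(2)) simp
  show "integrable (fusion_measure k) low_weight" by (rule R(3)) simp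
  show "integral\<^sup>L (fusion_measure k) low_weight \<le> transition_const TYPE('a) * omega k" by (rule R(4)) simp
  have m: "(\<lambda>q. low_weight (k - q)) \<in> borel_measurable borel" by measurable
  note R' = integral_resonance_le[OF m weights_nonneg(2) k]
  show "integrable (decay_measure k) (\<lambda>q. low_weight (k - q))" by (rule R'(1)) simp
  show "integral\<^sup>L (decay_measure k) (\<lambda>q. low_weight (k - q)) \<le> transition_const TYPE('a) * omega k" by (rule R'(2)) simp
qed

text \<open>Integrates the error term of \<open>weight_increment\<close>, which puts a factor
  \<open>omega\<close> on the short wave vector.\<close>

lemma integral_omega_sup_weight:
  fixes k :: "'a::euclidean_space"
  shows "integrable (decay_measure k) (\<lambda>q. omega q * sup_weight q)"
    "integral\<^sup>L (decay_measure k) (\<lambda>q. omega q * sup_weight q) \<le> transition_const TYPE('a) * omega k"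
    "integrable (decay_measure k) (\<lambda>q. omega (k - q) * sup_weight (k - q))"
    "integral\<^sup>L (decay_measure k) (\<lambda>q. omega (k - q) * sup_weight (k - q)) \<le> transition_const TYPE('a) * omega k"
proof -
  have le: "sqrt (norm q) ^ 5 * (omega q * sup_weight q) \<le> 1 / jap q ^ (DIM('a) + 1)" for q :: 'a
    using weight_le[of 8 4 "DIM('a)" "4 * DIM('a) + 12" "sqrt (norm q) ^ 8" q]
    by (simp add: sup_weight_def omega_eq power_add[symmetric] mult.assoc[symmetric] del: real_sqrt_pow2)
  have 0: "sqrt (norm (q - 0)) ^ 5 * (omega q * sup_weight q) \<le> 1 / jap (q - 0) ^ (DIM('a) + 1)" for q :: 'a
    using le[of q] by simp
  have k: "sqrt (norm (q - k)) ^ 5 * (omega (k - q) * sup_weight (k - q)) \<le> 1 / jap (q - k) ^ (DIM('a) + 1)" for q :: 'a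
    using le[of "k - q"] by (simp add: norm_minus_commute jap_minus_commute)
  have m: "(\<lambda>q. omega q * sup_weight q) \<in> borel_measurable (borel :: 'a measure)"
    "(\<lambda>q. omega (k - q) * sup_weight (k - q)) \<in> borel_measurable borel" by measurable
  have n: "0 \<le> omega q * sup_weight q" for q :: 'a by simp
  note R = integral_resonance_le[OF m(1) n 0] and R' = integral_resonance_le[OF m(2) n k]
  show "integrable (decay_measure k) (\<lambda>q. omega q * sup_weight q)" by (rule R(1)) simp
  show "integral\<^sup>L (decay_measure k) (\<lambda>q. omega q * sup_weight q) \<le> transition_const TYPE('a) * omega k" by (rule R(2)) simp
  show "integrable (decay_measure k) (\<lambda>q. omega (k - q) * sup_weight (k - q))" by (rule R'(1)) simp
  show "integral\<^sup>L (decay_measure k) (\<lambda>q. omega (k - q) * sup_weight (k - q)) \<le> transition_const TYPE('a) * omega k" by (rule R'(2)) simp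
qed

section \<open>Cancellation between influx and damping\<close>

definition damping :: "('a::euclidean_space \<Rightarrow> real) \<Rightarrow> 'a \<Rightarrow> real" where
  "damping n k = (\<integral>q. n q + n (k - q) \<partial>decay_measure k) + (\<integral>q. n q \<partial>fusion_measure k)"

definition influx :: "('a::euclidean_space \<Rightarrow> real) \<Rightarrow> 'a \<Rightarrow> real" where
  "influx n k = (\<integral>q. n (k - q) * n q \<partial>decay_measure k) + (\<integral>q. n (k + q) * (n k + n q) \<partial>fusion_measure k)"

text \<open>The bound is required at every point, since for k other than 0 the resonance surfaces
  are Lebesgue-null and an almost-everywhere bound would say nothing on them.\<close>

definition dominated :: "real \<Rightarrow> ('a::euclidean_space \<Rightarrow> real) \<Rightarrow> bool" where
  "dominated \<beta> n \<longleftrightarrow> n \<in> borel_measurable borel \<and> (\<forall>q. 0 \<le> n q \<and> n q \<le> \<beta> * sup_weight q)"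

text \<open>With c = 2 * 3^(4d+12) from \<open>weight_increments\<close>, \<open>influx_le\<close>
  needs the factor 2c + 1 and \<open>influx_lipschitz\<close> needs 4c + 8; both are at most 16 *
  3^(4d+12).\<close>

definition growth_const :: "'a::euclidean_space itself \<Rightarrow> real" where
  "growth_const _ = 16 * 3 ^ (4 * DIM('a) + 12) * transition_const TYPE('a)"

lemma dominatedD:
  assumes "dominated \<beta> n"
  shows "n \<in> borel_measurable borel" "0 \<le> n q" "n q \<le> \<beta> * sup_weight q" "0 \<le> \<beta>" "n q \<le> \<beta> * low_weight q" "n q \<le> \<beta>"
proof -
  show n: "n \<in> borel_measurable borel" "0 \<le> n q" "n q \<le> \<beta> * sup_weight q" using assms by (auto simp: dominated_def)
  have "0 \<le> \<beta> * sup_weight q" using n by linarith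
  then show b: "0 \<le> \<beta>" using weights_pos(1)[of q] by (metis zero_le_mult_iff not_less)
  have "\<beta> * sup_weight q \<le> \<beta> * low_weight q" using b sup_weight_le_low by (intro mult_left_mono) auto
  then show 1: "n q \<le> \<beta> * low_weight q" using n by linarith
  have "\<beta> * low_weight q \<le> \<beta> * 1" using b low_weight_le_1 by (intro mult_left_mono) auto
  then show "n q \<le> \<beta>" using 1 by linarith
qed

lemma AE_decay:
  "AE q in decay_measure k. omega k = omega (k - q) + omega q \<and> norm q \<le> norm k \<and> norm (k - q) \<le> norm k"
  by (rule AE_mp[OF AE_collision_measure(1)]) (auto simp: decay_set_le, auto simp: decay_set_def)

lemma AE_fusion:
  "AE q in fusion_measure k. norm q \<le> norm (k + q) \<and> norm k \<le> norm (k + q)"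
  by (rule AE_mp[OF AE_collision_measure(2)]) (auto simp: fusion_set_le)

lemma integrable_low:
  fixes f :: "'a::euclidean_space \<Rightarrow> real"
  assumes d: "2 \<le> DIM('a)" and f [measurable]: "f \<in> borel_measurable borel"
  shows "(\<And>q. \<bar>f q\<bar> \<le> c * low_weight q) \<Longrightarrow> integrable (decay_measure k) f"
    "(\<And>q. \<bar>f q\<bar> \<le> c * low_weight (k - q)) \<Longrightarrow> integrable (decay_measure k) f"
    "(\<And>q. norm q \<le> norm (k + q) \<Longrightarrow> norm k \<le> norm (k + q) \<Longrightarrow> \<bar>f q\<bar> \<le> c * low_weight q) \<Longrightarrow> integrable (fusion_measure k) f"
proof -
  show "integrable (decay_measure k) f" if "\<And>q. \<bar>f q\<bar> \<le> c * low_weight q"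
    by (rule integral_weight_bound[where g = "\<lambda>q. c * low_weight q"]) (use that integral_low_weight[OF d] in auto)
  show "integrable (decay_measure k) f" if "\<And>q. \<bar>f q\<bar> \<le> c * low_weight (k - q)"
    by (rule integral_weight_bound[where g = "\<lambda>q. c * low_weight (k - q)"]) (use that integral_low_weight[OF d] in auto)
  show "integrable (fusion_measure k) f"
    if "\<And>q. norm q \<le> norm (k + q) \<Longrightarrow> norm k \<le> norm (k + q) \<Longrightarrow> \<bar>f q\<bar> \<le> c * low_weight q"
  proof (rule integral_weight_bound[where g = "\<lambda>q. c * low_weight q"])
    show "AE q in fusion_measure k. \<bar>f q\<bar> \<le> c * low_weight q"
      using AE_fusion[of k] by eventually_elim (use that in auto)
  qed (use integral_low_weight[OF d] in auto)
qed

lemma fusion_sup_weight: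
  fixes k :: "'a::euclidean_space"
  assumes d: "2 \<le> DIM('a)"
  shows "integrable (fusion_measure k) (\<lambda>q. sup_weight (k + q))"
    "(\<integral>q. sup_weight (k + q) \<partial>fusion_measure k) \<le> transition_const TYPE('a)"
proof -
  have AE: "AE q in fusion_measure k. \<bar>sup_weight (k + q)\<bar> \<le> 1 / jap k ^ 2 * low_weight q"
    using AE_fusion[of k] by eventually_elim (simp only: sup_weight_add_le abs_of_nonneg weights_nonneg)
  have g: "integrable (fusion_measure k) (\<lambda>q. 1 / jap k ^ 2 * low_weight q)"
    using integral_low_weight(5)[OF d] by (rule integrable_mult_right)
  have m: "(\<lambda>q. sup_weight (k + q)) \<in> borel_measurable (fusion_measure k)" by measurable
  show "integrable (fusion_measure k) (\<lambda>q. sup_weight (k + q))" by (rule integral_weight_bound(1)[OF m AE g])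
  have "(\<integral>q. sup_weight (k + q) \<partial>fusion_measure k) \<le> (\<integral>q. 1 / jap k ^ 2 * low_weight q \<partial>fusion_measure k)"
    using integral_weight_bound(2)[OF m AE g] by linarith
  also have "\<dots> = 1 / jap k ^ 2 * (\<integral>q. low_weight q \<partial>fusion_measure k)" by (rule integral_mult_right_zero)
  also have "\<dots> \<le> 1 / jap k ^ 2 * (transition_const TYPE('a) * omega k)"
    using integral_low_weight(6)[OF d] by (intro mult_left_mono) auto
  also have "\<dots> = transition_const TYPE('a) * (omega k / jap k ^ 2)" by simp
  also have "\<dots> \<le> transition_const TYPE('a) * 1"
    using omega_le_jap[of k] transition_const_nonneg[where 'a = 'a] by (intro mult_left_mono) (auto simp: divide_le_eq)
  finally show "(\<integral>q. sup_weight (k + q) \<partial>fusion_measure k) \<le> transition_const TYPE('a)" by simp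
qed

lemma dominated_integrable:
  fixes n m :: "'a::euclidean_space \<Rightarrow> real"
  assumes d: "2 \<le> DIM('a)" and n: "dominated \<beta> n" and m: "dominated \<beta> m"
  shows "integrable (decay_measure k) n" "integrable (decay_measure k) (\<lambda>q. n (k - q))"
    "integrable (decay_measure k) (\<lambda>q. n (k - q) * m q)"
    "integrable (fusion_measure k) n" "integrable (fusion_measure k) (\<lambda>q. n (k + q))"
    "integrable (fusion_measure k) (\<lambda>q. n (k + q) * m q)"
proof -
  note [measurable] = dominatedD(1)[OF n] dominatedD(1)[OF m]
  note N = dominatedD[OF n] and M = dominatedD[OF m]
  show "integrable (decay_measure k) n" "integrable (fusion_measure k) n"
    by (rule integrable_low[OF d, where c = \<beta>]; use N in simp)+
  show "integrable (decay_measure k) (\<lambda>q. n (k - q))"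
    by (rule integrable_low(2)[OF d, where c = \<beta>]) (use N in auto)
  have p: "n p * m q \<le> (\<beta> * \<beta>) * low_weight q" for p q
    using mult_mono[OF N(6)[of p] M(5)[of q] N(4) M(2)[of q]] by (simp add: mult_ac)
  show "integrable (decay_measure k) (\<lambda>q. n (k - q) * m q)"
    by (rule integrable_low(1)[OF d, where c = "\<beta> * \<beta>"]) (use p N(2) M(2) in auto)
  show "integrable (fusion_measure k) (\<lambda>q. n (k + q) * m q)"
    by (rule integrable_low(3)[OF d, where c = "\<beta> * \<beta>"]) (use p N(2) M(2) in auto)
  show "integrable (fusion_measure k) (\<lambda>q. n (k + q))"
  proof (rule integrable_low(3)[OF d, where c = \<beta>])
    fix q assume "norm q \<le> norm (k + q)"
    then have "\<beta> * low_weight (k + q) \<le> \<beta> * low_weight q" using N(4) weights_mono(2) by (intro mult_left_mono) auto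
    then show "\<bar>n (k + q)\<bar> \<le> \<beta> * low_weight q" using N(2,5)[of "k + q"] by simp
  qed simp
qed

lemma S_eq_influx:
  fixes n :: "'a::euclidean_space \<Rightarrow> real"
  assumes d: "2 \<le> DIM('a)" and n: "dominated \<beta> n"
  shows "S n k = influx n k - damping n k * n k" "S_converges n k"
proof -
  note [measurable] = dominatedD(1)[OF n]
  note I = dominated_integrable[OF d n n, of k]
  have 1: "integrable (decay_measure k) (decay_density n k)" "integrable (fusion_measure k) (fusion_density n k)"
    unfolding decay_density_def[abs_def] fusion_density_def[abs_def]
    by (intro Bochner_Integration.integrable_diff integrable_mult_right integrable_mult_left I)+
  have e: "decay_density n k = (\<lambda>q. n (k - q) * n q - n k * (n q + n (k - q)))"
    "fusion_density n k = (\<lambda>q. n k * n q - n (k + q) * (n k + n q))"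
    by (auto simp: decay_density_def fusion_density_def algebra_simps)
  have "integrable (fusion_measure k) (\<lambda>q. n (k + q) * (n k + n q))"
    unfolding distrib_left by (intro Bochner_Integration.integrable_add integrable_mult_left I)
  then show "S n k = influx n k - damping n k * n k"
    unfolding S_eq[OF dominatedD(1)[OF n]] e influx_def damping_def
    using I by (subst Bochner_Integration.integral_diff Bochner_Integration.integral_diff; auto simp: algebra_simps)
  show "S_converges n k" unfolding S_converges_iff[OF dominatedD(1)[OF n]] using 1 by simp
qed

lemma damping_bounds:
  fixes n :: "'a::euclidean_space \<Rightarrow> real"
  assumes d: "2 \<le> DIM('a)" and n: "dominated \<beta> n"
  shows "0 \<le> damping n k" "damping n k \<le> 3 * \<beta> * transition_const TYPE('a) * omega k" "0 \<le> influx n k"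
proof -
  note N = dominatedD[OF n] and I = dominated_integrable[OF d n n, of k] and U = integral_low_weight[OF d, of k]
  show "0 \<le> damping n k" "0 \<le> influx n k"
    unfolding damping_def influx_def using N(2) by (intro add_nonneg_nonneg Bochner_Integration.integral_nonneg mult_nonneg_nonneg; simp)+
  have "(\<integral>q. n q \<partial>decay_measure k) \<le> \<beta> * (\<integral>q. low_weight q \<partial>decay_measure k)"
    "(\<integral>q. n (k - q) \<partial>decay_measure k) \<le> \<beta> * (\<integral>q. low_weight (k - q) \<partial>decay_measure k)"
    "(\<integral>q. n q \<partial>fusion_measure k) \<le> \<beta> * (\<integral>q. low_weight q \<partial>fusion_measure k)"
    unfolding integral_mult_right_zero[symmetric]
    by (intro integral_mono I U integrable_mult_right N(5))+
  moreover have "\<beta> * (\<integral>q. low_weight q \<partial>decay_measure k) \<le> \<beta> * (transition_const TYPE('a) * omega k)"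
    "\<beta> * (\<integral>q. low_weight (k - q) \<partial>decay_measure k) \<le> \<beta> * (transition_const TYPE('a) * omega k)"
    "\<beta> * (\<integral>q. low_weight q \<partial>fusion_measure k) \<le> \<beta> * (transition_const TYPE('a) * omega k)"
    by (intro mult_left_mono U N(4))+
  moreover have "damping n k = (\<integral>q. n q \<partial>decay_measure k) + (\<integral>q. n (k - q) \<partial>decay_measure k) + (\<integral>q. n q \<partial>fusion_measure k)"
    unfolding damping_def using I by simp
  ultimately show "damping n k \<le> 3 * \<beta> * transition_const TYPE('a) * omega k" by (simp add: mult.assoc)
qed

lemma decay_cases:
  fixes k q :: "'a::euclidean_space"
  assumes "omega k = omega (k - q) + omega q"
  obtains h b where "h = q \<and> b = k - q \<or> h = k - q \<and> b = q" "norm h \<le> norm b" "omega k = omega b + omega h"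
  using assms by (cases "norm q \<le> norm (k - q)") (force simp: add.commute)+

lemma weight_increments:
  fixes k b h :: "'a::euclidean_space"
  assumes k: "k \<noteq> 0" and res: "omega k = omega b + omega h" and hb: "norm h \<le> norm b"
  defines "c \<equiv> 2 * 3 ^ (4 * DIM('a) + 12)"
  shows "sup_weight b \<le> sup_weight k * (1 + c * (omega h / omega k))"
    "low_weight b \<le> low_weight k * (1 + c * (omega h / omega k))"
    "sup_weight b \<le> sup_weight k * (1 + c)"
proof -
  have wk: "0 < omega k" using k by (simp add: less_le)
  show 1: "sup_weight b \<le> sup_weight k * (1 + c * (omega h / omega k))"
    unfolding sup_weight_def c_def by (rule weight_increment[OF k res hb])
  have "low_weight b \<le> low_weight k * (1 + 2 * 3 ^ (2 * DIM('a) + 2) * (omega h / omega k))"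
    unfolding low_weight_def by (rule weight_increment[OF k res hb])
  also have "\<dots> \<le> low_weight k * (1 + c * (omega h / omega k))"
    unfolding c_def by (intro mult_left_mono add_left_mono mult_right_mono power_increasing) auto
  finally show "low_weight b \<le> low_weight k * (1 + c * (omega h / omega k))" .
  have "omega h / omega k \<le> 1" using wk res by simp
  then have "sup_weight k * (1 + c * (omega h / omega k)) \<le> sup_weight k * (1 + c * 1)"
    unfolding c_def by (intro mult_left_mono add_left_mono) auto
  from order_trans[OF 1 this] show "sup_weight b \<le> sup_weight k * (1 + c)" by (simp only: mult_1_right)
qed


text \<open>At k = 0 the phase of the fusion vanishes identically, so \<open>fusion_set 0\<close> is
  the whole space; the integrals vanish because the kernels do.\<close>

lemma integral_collision_measure_0 [simp]:
  "integral\<^sup>L (decay_measure 0) f = (0::real)" "integral\<^sup>L (fusion_measure 0) f = (0::real)"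
proof -
  have "AE q in decay_measure 0. f q = 0" "AE q in fusion_measure 0. f q = 0"
    unfolding decay_measure_def fusion_measure_def by (subst AE_density; simp)+
  then show "integral\<^sup>L (decay_measure 0) f = 0" "integral\<^sup>L (fusion_measure 0) f = 0"
    by (auto intro: integral_eq_zero_AE)
qed

lemma growth_const_nonneg: "0 \<le> growth_const TYPE('a::euclidean_space)"
  by (simp add: growth_const_def transition_const_nonneg)

text \<open>Let P be the bound for n at k. In a decay only the long factor n b is replaced by its
  bound, which is P up to the resonance error, while n h is kept: its integral is the decay part of
  the damping. The error has a factor 1 / \<open>omega k\<close>, cancelled by the
  \<open>omega k\<close> of its surface integral. In a fusion n (k + q) is at most P, so n q is kept
  in the same way, and the term with n k is bounded by \<open>fusion_sup_weight\<close>.\<close>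

lemma influx_le:
  fixes n :: "'a::euclidean_space \<Rightarrow> real"
  assumes d: "2 \<le> DIM('a)" and n: "dominated \<beta> n"
  shows "influx n k \<le> (damping n k + growth_const TYPE('a) * \<beta>) * (\<beta> * sup_weight k)"
proof (cases "k = 0")
  case True
  then show ?thesis
    using dominatedD(4)[OF n] growth_const_nonneg[where 'a = 'a] by (simp add: influx_def damping_def)
next
  case k: False
  note [measurable] = dominatedD(1)[OF n]
  note N = dominatedD[OF n] and I = dominated_integrable[OF d n n, of k]
    and U = integral_low_weight[OF d, of k] and E = integral_omega_sup_weight[of k] and F = fusion_sup_weight[OF d, of k]
  define Ct where "Ct = transition_const TYPE('a)"
  define c :: real where "c = 2 * 3 ^ (4 * DIM('a) + 12)"
  have Ct: "0 \<le> Ct" by (simp add: Ct_def transition_const_nonneg)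
  have "(1::real) \<le> 3 ^ (4 * DIM('a) + 12)" by (rule one_le_power) simp
  then have c: "0 \<le> c" "2 * c + 1 \<le> 16 * 3 ^ (4 * DIM('a) + 12)" unfolding c_def by linarith+
  have wk: "0 < omega k" using k by (simp add: less_le)
  define P Q where "P = \<beta> * sup_weight k" and "Q = P * \<beta> * c / omega k"
  have PQ: "0 \<le> P" "0 \<le> Q" using N(4) c wk by (simp_all add: P_def Q_def)
  have helper: "n b * n h \<le> P * n h + Q * (omega h * sup_weight h)"
    if res: "omega k = omega b + omega h" and hb: "norm h \<le> norm b" for b h
  proof -
    have "n b \<le> \<beta> * sup_weight b" by (rule N(3))
    also have "\<dots> \<le> \<beta> * (sup_weight k * (1 + c * (omega h / omega k)))"
      unfolding c_def by (intro mult_left_mono weight_increments(1)[OF k res hb] N(4))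
    also have "\<dots> = P + P * c * omega h / omega k" by (simp add: P_def algebra_simps)
    finally have "n b * n h \<le> (P + P * c * omega h / omega k) * n h" using N(2) by (intro mult_right_mono) auto
    also have "\<dots> = P * n h + (P * c * omega h / omega k) * n h" by (simp add: algebra_simps)
    also have "(P * c * omega h / omega k) * n h \<le> (P * c * omega h / omega k) * (\<beta> * sup_weight h)"
      using PQ c wk by (intro mult_left_mono N(3)) auto
    also have "\<dots> = Q * (omega h * sup_weight h)" by (simp add: Q_def)
    finally show ?thesis by simp
  qed
  \<comment> \<open>Summing over both choices of the short wave vector avoids splitting the surface;
    all summands are nonnegative.\<close>
  let ?g = "\<lambda>q. P * (n q + n (k - q)) + Q * (omega q * sup_weight q + omega (k - q) * sup_weight (k - q))"
  have "AE q in decay_measure k. n (k - q) * n q \<le> ?g q"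
    using AE_decay[of k]
  proof eventually_elim
    case (elim q)
    then obtain h b where hb: "h = q \<and> b = k - q \<or> h = k - q \<and> b = q" "norm h \<le> norm b" "omega k = omega b + omega h"
      using decay_cases by blast
    have "n (k - q) * n q = n b * n h" using hb(1) by (auto simp: mult.commute)
    also have "\<dots> \<le> P * n h + Q * (omega h * sup_weight h)" by (rule helper[OF hb(3,2)])
    also have "\<dots> \<le> ?g q"
      using hb(1) N(2) PQ by (intro add_mono mult_left_mono) auto
    finally show ?case .
  qed
  then have "(\<integral>q. n (k - q) * n q \<partial>decay_measure k) \<le> (\<integral>q. ?g q \<partial>decay_measure k)"
    by (intro integral_mono_AE I Bochner_Integration.integrable_add integrable_mult_right E)
  also have "\<dots> = P * (\<integral>q. n q + n (k - q) \<partial>decay_measure k)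
      + Q * ((\<integral>q. omega q * sup_weight q \<partial>decay_measure k) + (\<integral>q. omega (k - q) * sup_weight (k - q) \<partial>decay_measure k))"
    using I E by (simp only: Bochner_Integration.integral_add integral_mult_right_zero Bochner_Integration.integrable_add integrable_mult_right)
  also have "\<dots> \<le> P * (\<integral>q. n q + n (k - q) \<partial>decay_measure k) + Q * (Ct * omega k + Ct * omega k)"
    unfolding Ct_def by (intro add_left_mono mult_left_mono add_mono E PQ)
  also have "Q * (Ct * omega k + Ct * omega k) = P * \<beta> * Ct * (2 * c)" using wk k by (simp add: Q_def)
  finally have A: "(\<integral>q. n (k - q) * n q \<partial>decay_measure k) \<le> P * (\<integral>q. n q + n (k - q) \<partial>decay_measure k) + P * \<beta> * Ct * (2 * c)" .
  let ?h = "\<lambda>q. P * n q + P * \<beta> * sup_weight (k + q)"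
  have "AE q in fusion_measure k. n (k + q) * (n k + n q) \<le> ?h q"
    using AE_fusion[of k]
  proof eventually_elim
    case (elim q)
    have "n (k + q) * n k \<le> (\<beta> * sup_weight (k + q)) * P" using N PQ unfolding P_def by (intro mult_mono) auto
    moreover have "n (k + q) \<le> P"
      using N(3)[of "k + q"] weights_mono(1)[of k "k + q"] elim mult_left_mono[OF _ N(4)] unfolding P_def by (meson order_trans)
    then have "n (k + q) * n q \<le> P * n q" using N(2) by (intro mult_right_mono) auto
    ultimately show ?case by (simp add: algebra_simps)
  qed
  then have "(\<integral>q. n (k + q) * (n k + n q) \<partial>fusion_measure k) \<le> (\<integral>q. ?h q \<partial>fusion_measure k)"
    unfolding distrib_left
    by (intro integral_mono_AE I F Bochner_Integration.integrable_add integrable_mult_right integrable_mult_left)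
  also have "\<dots> = P * (\<integral>q. n q \<partial>fusion_measure k) + P * \<beta> * (\<integral>q. sup_weight (k + q) \<partial>fusion_measure k)"
    using I F by (simp only: Bochner_Integration.integral_add integral_mult_right_zero Bochner_Integration.integrable_add integrable_mult_right)
  also have "\<dots> \<le> P * (\<integral>q. n q \<partial>fusion_measure k) + P * \<beta> * Ct"
    unfolding Ct_def using F N(4) PQ by (intro add_left_mono mult_left_mono) auto
  finally have B: "(\<integral>q. n (k + q) * (n k + n q) \<partial>fusion_measure k) \<le> P * (\<integral>q. n q \<partial>fusion_measure k) + P * \<beta> * Ct" .
  have "influx n k \<le> P * damping n k + P * \<beta> * Ct * (2 * c + 1)"
    using A B unfolding influx_def damping_def by (simp add: algebra_simps)
  also have "\<dots> \<le> P * damping n k + P * \<beta> * Ct * (16 * 3 ^ (4 * DIM('a) + 12))"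
    using c PQ N(4) Ct by (intro add_left_mono mult_left_mono) auto
  also have "\<dots> = (damping n k + growth_const TYPE('a) * \<beta>) * (\<beta> * sup_weight k)"
    by (simp add: growth_const_def Ct_def P_def algebra_simps)
  finally show ?thesis .
qed

text \<open>With y the Duhamel image of m at k, the left-hand side is the source in the linear
  equation for the difference of the images of n and m. A difference on the long wave vector is
  treated as in \<open>influx_le\<close>, with the low weight. One on the short wave vector or in
  the damping coefficient leaves a heavy weight at k, by which \<open>RP\<close> absorbs
  \<open>omega k\<close>.\<close>

lemma influx_lipschitz:
  fixes n m :: "'a::euclidean_space \<Rightarrow> real"
  assumes d: "2 \<le> DIM('a)" and n: "dominated \<beta> n" and m: "dominated \<beta> m"
    and a: "0 \<le> a" and v: "\<And>q. \<bar>n q - m q\<bar> \<le> a * low_weight q" and y: "\<bar>y\<bar> \<le> \<beta> * sup_weight k"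
  shows "\<bar>influx n k - influx m k - (damping n k - damping m k) * y\<bar>
    \<le> (damping n k + growth_const TYPE('a) * \<beta>) * (a * low_weight k)"
proof (cases "k = 0")
  case True
  then show ?thesis
    using dominatedD(4)[OF n] a growth_const_nonneg[where 'a = 'a] by (simp add: influx_def damping_def)
next
  case k: False
  note [measurable] = dominatedD(1)[OF n] dominatedD(1)[OF m]
  note N = dominatedD[OF n] and M = dominatedD[OF m] and I = dominated_integrable[OF d n n, of k] and J = dominated_integrable[OF d m m, of k]
    and U = integral_low_weight[OF d, of k] and E = integral_omega_sup_weight[of k] and F = fusion_sup_weight[OF d, of k]
  define Ct where "Ct = transition_const TYPE('a)"
  define c :: real where "c = 2 * 3 ^ (4 * DIM('a) + 12)"
  have Ct: "0 \<le> Ct" by (simp add: Ct_def transition_const_nonneg)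
  have "(1::real) \<le> 3 ^ (4 * DIM('a) + 12)" by (rule one_le_power) simp
  then have c: "0 \<le> c" "4 * c + 8 \<le> 16 * 3 ^ (4 * DIM('a) + 12)" unfolding c_def by linarith+
  have wk: "0 < omega k" using k by (simp add: less_le)
  define P Q R where "P = a * low_weight k" and "Q = P * \<beta> * c / omega k" and "R = a * \<beta> * sup_weight k"
  have PQ: "0 \<le> P" "0 \<le> Q" "0 \<le> R" using N(4) c wk a by (simp_all add: P_def Q_def R_def)
  have RP: "R * omega k \<le> P * \<beta>"
    using mult_left_mono[OF sup_weight_omega_le[of k], of "a * \<beta>"] a N(4) by (simp add: P_def R_def mult_ac)
  have helper: "\<bar>n b * n h - m b * m h\<bar> \<le> P * n h + Q * (omega h * sup_weight h) + R * (1 + c) * low_weight h"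
    if res: "omega k = omega b + omega h" and hb: "norm h \<le> norm b" for b h
  proof -
    have "\<bar>n b - m b\<bar> \<le> a * low_weight b" by (rule v)
    also have "\<dots> \<le> a * (low_weight k * (1 + c * (omega h / omega k)))"
      unfolding c_def by (intro mult_left_mono weight_increments(2)[OF k res hb] a)
    also have "\<dots> = P + P * c * omega h / omega k" by (simp add: P_def algebra_simps)
    finally have "\<bar>n b - m b\<bar> * n h \<le> (P + P * c * omega h / omega k) * n h" using N(2) by (intro mult_right_mono) auto
    also have "\<dots> = P * n h + (P * c * omega h / omega k) * n h" by (simp add: algebra_simps)
    also have "(P * c * omega h / omega k) * n h \<le> (P * c * omega h / omega k) * (\<beta> * sup_weight h)"
      using PQ c wk by (intro mult_left_mono N(3)) auto
    also have "\<dots> = Q * (omega h * sup_weight h)" by (simp add: Q_def)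
    finally have 1: "\<bar>n b - m b\<bar> * n h \<le> P * n h + Q * (omega h * sup_weight h)" by simp
    have "m b \<le> \<beta> * (sup_weight k * (1 + c))"
      using M(3)[of b] weight_increments(3)[OF k res hb] mult_left_mono[OF _ N(4)] unfolding c_def by (meson order_trans)
    then have "m b * \<bar>n h - m h\<bar> \<le> \<beta> * (sup_weight k * (1 + c)) * (a * low_weight h)"
      using v M(2) N(4) c by (intro mult_mono) auto
    also have "\<dots> = R * (1 + c) * low_weight h" by (simp add: R_def)
    finally have 2: "m b * \<bar>n h - m h\<bar> \<le> R * (1 + c) * low_weight h" .
    \<comment> \<open>The difference at b is paired with n h and not with m h, so that exactly the
      damping of n appears, the one in the equation for the difference.\<close>
    have "n b * n h - m b * m h = (n b - m b) * n h + m b * (n h - m h)" by (simp add: algebra_simps)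
    then have "\<bar>n b * n h - m b * m h\<bar> \<le> \<bar>(n b - m b) * n h\<bar> + \<bar>m b * (n h - m h)\<bar>" by (metis abs_triangle_ineq)
    also have "\<dots> = \<bar>n b - m b\<bar> * n h + m b * \<bar>n h - m h\<bar>" using N(2) M(2) by (simp add: abs_mult)
    finally show ?thesis using 1 2 by linarith
  qed
  let ?g = "\<lambda>q. P * (n q + n (k - q)) + Q * (omega q * sup_weight q + omega (k - q) * sup_weight (k - q))
      + R * (1 + c) * (low_weight q + low_weight (k - q))"
  let ?I1 = "(\<integral>q. n (k - q) * n q \<partial>decay_measure k) - (\<integral>q. m (k - q) * m q \<partial>decay_measure k)"
  have A1: "AE q in decay_measure k. \<bar>n (k - q) * n q - m (k - q) * m q\<bar> \<le> ?g q"
    using AE_decay[of k]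
  proof eventually_elim
    case (elim q)
    then obtain h b where hb: "h = q \<and> b = k - q \<or> h = k - q \<and> b = q" "norm h \<le> norm b" "omega k = omega b + omega h"
      using decay_cases by blast
    have "\<bar>n (k - q) * n q - m (k - q) * m q\<bar> = \<bar>n b * n h - m b * m h\<bar>" using hb(1) by (auto simp: mult.commute)
    also have "\<dots> \<le> P * n h + Q * (omega h * sup_weight h) + R * (1 + c) * low_weight h" by (rule helper[OF hb(3,2)])
    also have "\<dots> \<le> ?g q"
      using hb(1) N(2) PQ c by (intro add_mono mult_left_mono) auto
    finally show ?case .
  qed
  have g: "integrable (decay_measure k) ?g"
    by (intro I Bochner_Integration.integrable_add integrable_mult_right E U)
  have "\<bar>?I1\<bar> = \<bar>\<integral>q. n (k - q) * n q - m (k - q) * m q \<partial>decay_measure k\<bar>" using I J by simp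
  also have "\<dots> \<le> (\<integral>q. ?g q \<partial>decay_measure k)"
    by (rule integral_weight_bound(2)[OF _ A1 g]) measurable
  also have "\<dots> = P * (\<integral>q. n q + n (k - q) \<partial>decay_measure k)
      + Q * ((\<integral>q. omega q * sup_weight q \<partial>decay_measure k) + (\<integral>q. omega (k - q) * sup_weight (k - q) \<partial>decay_measure k))
      + R * (1 + c) * ((\<integral>q. low_weight q \<partial>decay_measure k) + (\<integral>q. low_weight (k - q) \<partial>decay_measure k))"
    using I E U by (simp only: Bochner_Integration.integral_add integral_mult_right_zero Bochner_Integration.integrable_add integrable_mult_right)
  also have "\<dots> \<le> P * (\<integral>q. n q + n (k - q) \<partial>decay_measure k) + Q * (Ct * omega k + Ct * omega k)
      + R * (1 + c) * (Ct * omega k + Ct * omega k)"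
    unfolding Ct_def using c PQ by (intro add_left_mono mult_left_mono add_mono E U mult_nonneg_nonneg) auto
  also have "Q * (Ct * omega k + Ct * omega k) = P * \<beta> * Ct * (2 * c)" using wk k by (simp add: Q_def)
  also have "R * (1 + c) * (Ct * omega k + Ct * omega k) = (R * omega k) * (Ct * (2 * c + 2))" by (simp add: algebra_simps)
  also have "\<dots> \<le> (P * \<beta>) * (Ct * (2 * c + 2))" using Ct c by (intro mult_right_mono RP) auto
  finally have A: "\<bar>?I1\<bar> \<le> P * (\<integral>q. n q + n (k - q) \<partial>decay_measure k) + P * \<beta> * Ct * (4 * c + 2)"
    by (simp add: algebra_simps)
  let ?h = "\<lambda>q. P * n q + 2 * R * low_weight q + P * \<beta> * sup_weight (k + q)"
  let ?I2 = "(\<integral>q. n (k + q) * (n k + n q) \<partial>fusion_measure k) - (\<integral>q. m (k + q) * (m k + m q) \<partial>fusion_measure k)"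
  have B1: "AE q in fusion_measure k. \<bar>n (k + q) * (n k + n q) - m (k + q) * (m k + m q)\<bar> \<le> ?h q"
    using AE_fusion[of k]
  proof eventually_elim
    case (elim q)
    let ?p = "k + q"
    have vp: "\<bar>n ?p - m ?p\<bar> \<le> P" "\<bar>n ?p - m ?p\<bar> \<le> a * low_weight q"
      using v[of ?p] weights_mono(2)[of k ?p] weights_mono(2)[of q ?p] elim mult_left_mono[OF _ a] unfolding P_def by (meson order_trans)+
    have mp: "m ?p \<le> \<beta> * sup_weight k"
      using M(3)[of ?p] weights_mono(1)[of k ?p] elim mult_left_mono[OF _ N(4)] by (meson order_trans)
    have 1: "\<bar>n ?p - m ?p\<bar> * n q \<le> P * n q" using vp N(2) by (intro mult_right_mono) auto
    have 2: "m ?p * \<bar>n q - m q\<bar> \<le> (\<beta> * sup_weight k) * (a * low_weight q)" using mp v M(2) N(4) by (intro mult_mono) auto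
    have 3: "\<bar>n ?p - m ?p\<bar> * n k \<le> (a * low_weight q) * (\<beta> * sup_weight k)" using vp N a by (intro mult_mono) auto
    have 4: "m ?p * \<bar>n k - m k\<bar> \<le> (\<beta> * sup_weight ?p) * P" using M N(4) v unfolding P_def by (intro mult_mono) auto
    \<comment> \<open>Only the first term feeds the damping. The next two carry a heavy weight at k
      and a low weight at q, and the last is controlled by \<open>fusion_sup_weight\<close>.\<close>
    have "n ?p * (n k + n q) - m ?p * (m k + m q) = (n ?p - m ?p) * n q + m ?p * (n q - m q) + (n ?p - m ?p) * n k + m ?p * (n k - m k)"
      by (simp add: algebra_simps)
    then have "\<bar>n ?p * (n k + n q) - m ?p * (m k + m q)\<bar>
        \<le> \<bar>(n ?p - m ?p) * n q\<bar> + \<bar>m ?p * (n q - m q)\<bar> + \<bar>(n ?p - m ?p) * n k\<bar> + \<bar>m ?p * (n k - m k)\<bar>"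
      by linarith
    also have "\<dots> = \<bar>n ?p - m ?p\<bar> * n q + m ?p * \<bar>n q - m q\<bar> + \<bar>n ?p - m ?p\<bar> * n k + m ?p * \<bar>n k - m k\<bar>"
      using N(2) M(2) by (simp add: abs_mult)
    also have "\<dots> \<le> P * n q + (\<beta> * sup_weight k) * (a * low_weight q) + (a * low_weight q) * (\<beta> * sup_weight k) + (\<beta> * sup_weight ?p) * P"
      by (intro add_mono 1 2 3 4)
    also have "\<dots> = ?h q" by (simp add: R_def algebra_simps)
    finally show ?case .
  qed
  have h: "integrable (fusion_measure k) ?h"
    by (intro I Bochner_Integration.integrable_add integrable_mult_right F U)
  have "\<bar>?I2\<bar> = \<bar>\<integral>q. n (k + q) * (n k + n q) - m (k + q) * (m k + m q) \<partial>fusion_measure k\<bar>"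
    using I J by (simp add: distrib_left)
  also have "\<dots> \<le> (\<integral>q. ?h q \<partial>fusion_measure k)"
    by (rule integral_weight_bound(2)[OF _ B1 h]) measurable
  also have "\<dots> = P * (\<integral>q. n q \<partial>fusion_measure k) + 2 * R * (\<integral>q. low_weight q \<partial>fusion_measure k) + P * \<beta> * (\<integral>q. sup_weight (k + q) \<partial>fusion_measure k)"
    using I F U by (simp only: Bochner_Integration.integral_add integral_mult_right_zero Bochner_Integration.integrable_add integrable_mult_right)
  also have "\<dots> \<le> P * (\<integral>q. n q \<partial>fusion_measure k) + 2 * R * (Ct * omega k) + P * \<beta> * Ct"
    unfolding Ct_def using F N(4) PQ U by (intro add_mono mult_left_mono order_refl) auto
  also have "2 * R * (Ct * omega k) = (R * omega k) * (2 * Ct)" by simp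
  also have "\<dots> \<le> (P * \<beta>) * (2 * Ct)" using Ct by (intro mult_right_mono RP) auto
  finally have B: "\<bar>?I2\<bar> \<le> P * (\<integral>q. n q \<partial>fusion_measure k) + P * \<beta> * Ct * 3" by (simp add: algebra_simps)
  have D: "\<bar>(damping n k - damping m k) * y\<bar> \<le> P * \<beta> * Ct * 3"
  proof -
    let ?v = "\<lambda>q. n q - m q"
    have ie: "integrable (decay_measure k) (\<lambda>q. a * low_weight q)" "integrable (decay_measure k) (\<lambda>q. a * low_weight (k - q))"
      "integrable (fusion_measure k) (\<lambda>q. a * low_weight q)" by (intro integrable_mult_right U)+
    have "\<bar>\<integral>q. ?v q \<partial>decay_measure k\<bar> \<le> (\<integral>q. a * low_weight q \<partial>decay_measure k)"
      "\<bar>\<integral>q. ?v (k - q) \<partial>decay_measure k\<bar> \<le> (\<integral>q. a * low_weight (k - q) \<partial>decay_measure k)"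
      "\<bar>\<integral>q. ?v q \<partial>fusion_measure k\<bar> \<le> (\<integral>q. a * low_weight q \<partial>fusion_measure k)"
      by (rule integral_weight_bound(2)[OF _ _ ie(1)] integral_weight_bound(2)[OF _ _ ie(2)] integral_weight_bound(2)[OF _ _ ie(3)]; (rule AE_I2, rule v | measurable))+
    moreover have "(\<integral>q. a * low_weight q \<partial>decay_measure k) \<le> a * (Ct * omega k)"
      "(\<integral>q. a * low_weight (k - q) \<partial>decay_measure k) \<le> a * (Ct * omega k)"
      "(\<integral>q. a * low_weight q \<partial>fusion_measure k) \<le> a * (Ct * omega k)"
      unfolding integral_mult_right_zero Ct_def by (intro mult_left_mono U a)+
    moreover have "damping n k - damping m k = (\<integral>q. ?v q \<partial>decay_measure k) + (\<integral>q. ?v (k - q) \<partial>decay_measure k) + (\<integral>q. ?v q \<partial>fusion_measure k)"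
      unfolding damping_def using I J by simp
    ultimately have "\<bar>damping n k - damping m k\<bar> \<le> 3 * (a * (Ct * omega k))" by linarith
    then have "\<bar>(damping n k - damping m k) * y\<bar> \<le> 3 * (a * (Ct * omega k)) * (\<beta> * sup_weight k)"
      unfolding abs_mult using y a Ct by (intro mult_mono) auto
    also have "\<dots> = (R * omega k) * (3 * Ct)" by (simp add: R_def)
    also have "\<dots> \<le> (P * \<beta>) * (3 * Ct)" using Ct by (intro mult_right_mono RP) auto
    finally show ?thesis by (simp add: algebra_simps)
  qed
  have "influx n k - influx m k = ?I1 + ?I2" by (simp add: influx_def)
  then have "\<bar>influx n k - influx m k - (damping n k - damping m k) * y\<bar> \<le> \<bar>?I1\<bar> + \<bar>?I2\<bar> + \<bar>(damping n k - damping m k) * y\<bar>"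
    by linarith
  \<comment> \<open>The count is 4c + 2 from decays, 3 from fusions and 3 from the change of the
    damping.\<close>
  also have "\<dots> \<le> P * damping n k + P * \<beta> * Ct * (4 * c + 8)"
    using A B D unfolding damping_def[of n] by (simp add: algebra_simps)
  also have "\<dots> \<le> P * damping n k + P * \<beta> * Ct * (16 * 3 ^ (4 * DIM('a) + 12))"
    using c PQ N(4) Ct by (intro add_left_mono mult_left_mono) auto
  also have "\<dots> = (damping n k + growth_const TYPE('a) * \<beta>) * (a * low_weight k)"
    by (simp add: growth_const_def Ct_def P_def algebra_simps)
  finally show ?thesis .
qed

section \<open>Duhamel iteration\<close>

lemma continuous_on_integral_dominated:
  fixes f :: "real \<Rightarrow> 'b \<Rightarrow> real"
  assumes f: "\<And>t. t \<in> I \<Longrightarrow> f t \<in> borel_measurable M" and g: "integrable M g"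
    and le: "\<And>t. t \<in> I \<Longrightarrow> AE q in M. \<bar>f t q\<bar> \<le> g q" and cont: "\<And>q. continuous_on I (\<lambda>t. f t q)"
  shows "continuous_on I (\<lambda>t. integral\<^sup>L M (f t))"
proof (rule continuous_on_sequentiallyI)
  fix u a assume u: "\<forall>n. u n \<in> I" and a: "a \<in> I" and lim: "u \<longlonglongrightarrow> a"
  show "(\<lambda>n. integral\<^sup>L M (f (u n))) \<longlonglongrightarrow> integral\<^sup>L M (f a)"
  proof (rule integral_dominated_convergence[OF f f g])
    show "AE q in M. (\<lambda>n. f (u n) q) \<longlonglongrightarrow> f a q"
    proof (rule AE_I2)
      fix q show "(\<lambda>n. f (u n) q) \<longlonglongrightarrow> f a q"
        using continuous_on_tendsto_compose[OF cont[of q] lim a] u by auto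
    qed
  qed (use u a le in auto)
qed

lemma primitive_has_derivative:
  fixes h :: "real \<Rightarrow> real"
  assumes h: "continuous_on {0..T} h" and t: "t \<in> {0..T}"
  shows "((\<lambda>t. LINT s:{0..t}|lborel. h s) has_real_derivative h t) (at t within {0..T})"
proof -
  have eq: "(LINT s:{0..x}|lborel. h s) = integral {0..x} h" if "x \<in> {0..T}" for x
  proof (rule set_borel_integral_eq_integral(2))
    have "continuous_on {0..x} h" by (rule continuous_on_subset[OF h]) (use that in auto)
    then show "set_integrable lborel {0..x} h" by (rule borel_integrable_atLeastAtMost')
  qed
  have "((\<lambda>x. integral {0..x} h) has_derivative (*) (h t)) (at t within {0..T})"
    using integral_has_real_derivative[OF h t] unfolding has_field_derivative_def .
  then have "((\<lambda>t. LINT s:{0..t}|lborel. h s) has_derivative (*) (h t)) (at t within {0..T})"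
    by (rule has_derivative_transform[OF t eq, rotated])
  then show ?thesis unfolding has_field_derivative_def .
qed

text \<open>c exp(\<kappa>t) is a supersolution: multiplied by the integrating factor, its distance
  to y is nondecreasing. The size of \<mu> does not enter the bound, so unbounded damping is
  harmless here.\<close>

lemma linear_ode_upper:
  fixes y g \<mu> :: "real \<Rightarrow> real"
  assumes y: "\<And>t. t \<in> {0..T} \<Longrightarrow> (y has_real_derivative g t - \<mu> t * y t) (at t within {0..T})"
    and lam: "continuous_on {0..T} \<mu>"
    and g: "\<And>t. t \<in> {0..T} \<Longrightarrow> g t \<le> (\<kappa> + \<mu> t) * (c * exp (\<kappa> * t))"
    and y0: "y 0 \<le> c" and t: "t \<in> {0..T}"
  shows "y t \<le> c * exp (\<kappa> * t)"
proof -
  define P where "P t = (LINT s:{0..t}|lborel. \<mu> s)" for t :: real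
  define z where "z t = exp (P t) * (c * exp (\<kappa> * t) - y t)" for t
  have dz: "(z has_real_derivative exp (P s) * ((\<kappa> + \<mu> s) * (c * exp (\<kappa> * s)) - g s)) (at s within {0..T})"
    if s: "s \<in> {0..T}" for s
  proof -
    have dP: "(P has_real_derivative \<mu> s) (at s within {0..T})"
      unfolding P_def[abs_def] by (rule primitive_has_derivative[OF lam s])
    show ?thesis unfolding z_def[abs_def]
      by (rule derivative_eq_intros dP y[OF s] refl | simp)+ (simp add: algebra_simps)
  qed
  have "z 0 \<le> z t"
  proof (rule DERIV_nonneg_imp_increasing_open[of 0 t z])
    show "0 \<le> t" using t by simp
    have "continuous_on {0..T} z" by (rule DERIV_continuous_on[OF dz])
    then show "continuous_on {0..t} z" by (rule continuous_on_subset) (use t in auto)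
    fix x assume x: "0 < x" "x < t"
    then have xT: "x \<in> {0..T}" "at x within {0..T} = at x" using t by (auto intro: at_within_Icc_at)
    have "0 \<le> exp (P x) * ((\<kappa> + \<mu> x) * (c * exp (\<kappa> * x)) - g x)" using g[OF xT(1)] by simp
    then show "\<exists>y. (z has_real_derivative y) (at x) \<and> 0 \<le> y" using dz[OF xT(1)] xT(2) by metis
  qed
  moreover have "0 \<le> z 0" using y0 by (simp add: z_def)
  ultimately have "0 \<le> z t" by linarith
  then show ?thesis by (simp add: z_def zero_le_mult_iff)
qed

lemma linear_ode_abs:
  fixes y g \<mu> :: "real \<Rightarrow> real"
  assumes y: "\<And>t. t \<in> {0..T} \<Longrightarrow> (y has_real_derivative g t - \<mu> t * y t) (at t within {0..T})"
    and lam: "continuous_on {0..T} \<mu>"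
    and g: "\<And>t. t \<in> {0..T} \<Longrightarrow> \<bar>g t\<bar> \<le> (\<kappa> + \<mu> t) * (c * exp (\<kappa> * t))"
    and y0: "\<bar>y 0\<bar> \<le> c" and t: "t \<in> {0..T}"
  shows "\<bar>y t\<bar> \<le> c * exp (\<kappa> * t)"
proof -
  have "y t \<le> c * exp (\<kappa> * t)"
    by (rule linear_ode_upper[OF y lam _ _ t]) (use g y0 in \<open>auto simp: abs_le_iff\<close>)
  moreover have "(\<lambda>t. - y t) t \<le> c * exp (\<kappa> * t)"
  proof (rule linear_ode_upper[OF _ lam _ _ t, where g = "\<lambda>t. - g t"])
    show "((\<lambda>t. - y t) has_real_derivative - g s - \<mu> s * - y s) (at s within {0..T})" if "s \<in> {0..T}" for s
      by (rule derivative_eq_intros y[OF that] refl)+ simp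
  qed (use g y0 in \<open>auto simp: abs_le_iff\<close>)
  ultimately show ?thesis by (simp add: abs_le_iff)
qed

text \<open>The upper limit t is moved into the integrand as a condition, so that the integration is
  over one fixed measure.\<close>

lemma primitive_measurable:
  fixes h :: "real \<Rightarrow> 'a::euclidean_space \<Rightarrow> real"
  assumes [measurable]: "(\<lambda>(s, k). h s k) \<in> borel_measurable (borel \<Otimes>\<^sub>M borel)"
  shows "(\<lambda>(t, k). LINT s:{0..t}|lborel. h s k) \<in> borel_measurable (borel \<Otimes>\<^sub>M borel)"
proof -
  have "(\<lambda>x. \<integral>s. (if 0 \<le> s \<and> s \<le> fst x then h s (snd x) else 0) \<partial>lborel) \<in> borel_measurable (borel \<Otimes>\<^sub>M (borel :: 'a measure))"
    by measurable
  moreover have "(\<lambda>x. \<integral>s. (if 0 \<le> s \<and> s \<le> fst x then h s (snd x) else 0) \<partial>lborel) = (\<lambda>(t, k). LINT s:{0..t}|lborel. h s k)"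
    unfolding set_lebesgue_integral_def by (auto simp: indicator_def intro!: Bochner_Integration.integral_cong)
  ultimately show ?thesis by simp
qed

lemma damping_influx_measurable:
  fixes n :: "real \<Rightarrow> 'a::euclidean_space \<Rightarrow> real"
  assumes n: "(\<lambda>(s, k). n s k) \<in> borel_measurable (borel \<Otimes>\<^sub>M borel)"
  shows "(\<lambda>(s, k). damping (n s) k) \<in> borel_measurable (borel \<Otimes>\<^sub>M borel)"
    "(\<lambda>(s, k). influx (n s) k) \<in> borel_measurable (borel \<Otimes>\<^sub>M borel)"
proof -
  have nm [measurable (raw)]: "(\<lambda>x. n (f x) (g x)) \<in> borel_measurable N"
    if "f \<in> borel_measurable N" "g \<in> borel_measurable N" for N f g
    using measurable_compose[OF measurable_Pair[OF that] n] by simp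
  have "(\<lambda>x. (\<integral>q. n (fst x) q + n (fst x) (snd x - q) \<partial>decay_measure (snd x)) + (\<integral>q. n (fst x) q \<partial>fusion_measure (snd x)))
     \<in> borel_measurable (borel \<Otimes>\<^sub>M borel)"
    by (intro borel_measurable_add integral_resonance_measurable) measurable
  then show "(\<lambda>(s, k). damping (n s) k) \<in> borel_measurable (borel \<Otimes>\<^sub>M borel)"
    by (simp add: damping_def case_prod_beta')
  have "(\<lambda>x. (\<integral>q. n (fst x) (snd x - q) * n (fst x) q \<partial>decay_measure (snd x))
        + (\<integral>q. n (fst x) (snd x + q) * (n (fst x) (snd x) + n (fst x) q) \<partial>fusion_measure (snd x)))
     \<in> borel_measurable (borel \<Otimes>\<^sub>M borel)"
    by (intro borel_measurable_add integral_resonance_measurable) measurable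
  then show "(\<lambda>(s, k). influx (n s) k) \<in> borel_measurable (borel \<Otimes>\<^sub>M borel)"
    by (simp add: influx_def case_prod_beta')
qed

lemma dominated_mono:
  assumes "dominated \<beta> n" "\<beta> \<le> \<beta>'"
  shows "dominated \<beta>' n"
proof -
  have "\<beta> * sup_weight q \<le> \<beta>' * sup_weight q" for q :: 'a using assms(2) by (intro mult_right_mono) auto
  then show ?thesis using assms(1) unfolding dominated_def by (meson order_trans)
qed

text \<open>Continuity at each k passes through the surface integrals by dominated convergence. For
  the fusion terms the weight at k + q is traded for that at q, which is shorter on the
  surface.\<close>

lemma damping_influx_continuous:
  fixes n :: "real \<Rightarrow> 'a::euclidean_space \<Rightarrow> real"
  assumes d: "2 \<le> DIM('a)" and n: "\<And>t. t \<in> I \<Longrightarrow> dominated \<beta> (n t)" and cont: "\<And>k. continuous_on I (\<lambda>t. n t k)"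
  shows "continuous_on I (\<lambda>t. damping (n t) k)" "continuous_on I (\<lambda>t. influx (n t) k)"
proof -
  note U = integral_low_weight[OF d, of k]
  have N: "0 \<le> n t q" "n t q \<le> \<beta> * low_weight q" "n t q \<le> \<beta>" "0 \<le> \<beta>" if "t \<in> I" for t q
    using dominatedD[OF n[OF that]] by auto
  have nm: "n t \<in> borel_measurable borel" if "t \<in> I" for t using dominatedD(1)[OF n[OF that]] .
  have p: "n t p * n t q \<le> \<beta> * (\<beta> * low_weight q)" if "t \<in> I" for t p q
    using N[OF that] by (intro mult_mono) auto
  have F: "AE q in fusion_measure k. n t (k + q) \<le> \<beta> * low_weight q" if "t \<in> I" for t
    using AE_fusion[of k]
  proof eventually_elim
    case (elim q)
    then have "\<beta> * low_weight (k + q) \<le> \<beta> * low_weight q" using N(4)[OF that] weights_mono(2) by (intro mult_left_mono) auto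
    then show ?case using N(2)[OF that, of "k + q"] by simp
  qed
  have 1: "continuous_on I (\<lambda>t. \<integral>q. n t q + n t (k - q) \<partial>decay_measure k)"
  proof (rule continuous_on_integral_dominated[where g = "\<lambda>q. \<beta> * low_weight q + \<beta> * low_weight (k - q)"])
    show "(\<lambda>q. n t q + n t (k - q)) \<in> borel_measurable (decay_measure k)" if "t \<in> I" for t
      using nm[OF that] by measurable
    show "AE q in decay_measure k. \<bar>n t q + n t (k - q)\<bar> \<le> \<beta> * low_weight q + \<beta> * low_weight (k - q)" if "t \<in> I" for t
      using N[OF that] by (intro AE_I2) (simp add: add_mono)
  qed (use U in \<open>auto intro!: continuous_intros cont\<close>)
  have 2: "continuous_on I (\<lambda>t. \<integral>q. n t q \<partial>fusion_measure k)"
  proof (rule continuous_on_integral_dominated[where g = "\<lambda>q. \<beta> * low_weight q"])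
    show "AE q in fusion_measure k. \<bar>n t q\<bar> \<le> \<beta> * low_weight q" if "t \<in> I" for t
      using N[OF that] by (intro AE_I2) simp
    show "n t \<in> borel_measurable (fusion_measure k)" if "t \<in> I" for t
      using nm[OF that] by measurable
  qed (use U cont in auto)
  have 3: "continuous_on I (\<lambda>t. \<integral>q. n t (k - q) * n t q \<partial>decay_measure k)"
  proof (rule continuous_on_integral_dominated[where g = "\<lambda>q. \<beta> * (\<beta> * low_weight q)"])
    show "AE q in decay_measure k. \<bar>n t (k - q) * n t q\<bar> \<le> \<beta> * (\<beta> * low_weight q)" if "t \<in> I" for t
      using N(1)[OF that] p[OF that] by (intro AE_I2) simp
    show "(\<lambda>q. n t (k - q) * n t q) \<in> borel_measurable (decay_measure k)" if "t \<in> I" for t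
      using nm[OF that] by measurable
  qed (use U in \<open>auto intro!: continuous_intros cont\<close>)
  have 4: "continuous_on I (\<lambda>t. \<integral>q. n t (k + q) * (n t k + n t q) \<partial>fusion_measure k)"
  proof (rule continuous_on_integral_dominated[where g = "\<lambda>q. \<beta> * low_weight q * \<beta> + \<beta> * (\<beta> * low_weight q)"])
    show "AE q in fusion_measure k. \<bar>n t (k + q) * (n t k + n t q)\<bar> \<le> \<beta> * low_weight q * \<beta> + \<beta> * (\<beta> * low_weight q)" if t: "t \<in> I" for t
      using F[OF t]
    proof eventually_elim
      case (elim q)
      have "n t (k + q) * n t k \<le> \<beta> * low_weight q * \<beta>" using elim N[OF t] by (intro mult_mono) auto
      then have "n t (k + q) * (n t k + n t q) \<le> \<beta> * low_weight q * \<beta> + \<beta> * (\<beta> * low_weight q)"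
        unfolding distrib_left by (intro add_mono p t)
      moreover have "0 \<le> n t (k + q) * (n t k + n t q)" using N(1)[OF t] by simp
      ultimately show ?case by simp
    qed
    show "(\<lambda>q. n t (k + q) * (n t k + n t q)) \<in> borel_measurable (fusion_measure k)" if "t \<in> I" for t
      using nm[OF that] by measurable
  qed (use U in \<open>auto intro!: continuous_intros cont\<close>)
  show "continuous_on I (\<lambda>t. damping (n t) k)" "continuous_on I (\<lambda>t. influx (n t) k)"
    unfolding damping_def influx_def by (intro continuous_on_add 1 2 3 4)+
qed

text \<open>Variation of constants for y' = influx n - damping n * y. From the explicit form joint
  measurability in (t,k) and nonnegativity can be read off.\<close>

definition duhamel :: "('a::euclidean_space \<Rightarrow> real) \<Rightarrow> (real \<Rightarrow> 'a \<Rightarrow> real) \<Rightarrow> real \<Rightarrow> 'a \<Rightarrow> real" where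
  "duhamel n0 n t k = exp (- (LINT s:{0..t}|lborel. damping (n s) k)) *
     (n0 k + (LINT s:{0..t}|lborel. exp (LINT r:{0..s}|lborel. damping (n r) k) * influx (n s) k))"

lemma duhamel_measurable:
  fixes n :: "real \<Rightarrow> 'a::euclidean_space \<Rightarrow> real"
  assumes n: "(\<lambda>(s, k). n s k) \<in> borel_measurable (borel \<Otimes>\<^sub>M borel)" and n0 [measurable]: "n0 \<in> borel_measurable borel"
  shows "(\<lambda>(t, k). duhamel n0 n t k) \<in> borel_measurable (borel \<Otimes>\<^sub>M borel)"
proof -
  note [measurable] = damping_influx_measurable[OF n]
  have P [measurable]: "(\<lambda>(t, k). LINT s:{0..t}|lborel. damping (n s) k) \<in> borel_measurable (borel \<Otimes>\<^sub>M borel)"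
    by (rule primitive_measurable) measurable
  have [measurable]: "(\<lambda>(t, k). LINT s:{0..t}|lborel. exp (LINT r:{0..s}|lborel. damping (n r) k) * influx (n s) k) \<in> borel_measurable (borel \<Otimes>\<^sub>M borel)"
    by (rule primitive_measurable) measurable
  show ?thesis unfolding duhamel_def by measurable
qed

lemma duhamel_derivative:
  fixes n :: "real \<Rightarrow> 'a::euclidean_space \<Rightarrow> real"
  assumes lam: "continuous_on {0..T} (\<lambda>t. damping (n t) k)" and gam: "continuous_on {0..T} (\<lambda>t. influx (n t) k)"
    and t: "t \<in> {0..T}"
  shows "((\<lambda>t. duhamel n0 n t k) has_real_derivative influx (n t) k - damping (n t) k * duhamel n0 n t k) (at t within {0..T})"
proof -
  define P where "P t = (LINT s:{0..t}|lborel. damping (n s) k)" for t :: real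
  define Q where "Q t = (LINT s:{0..t}|lborel. exp (P s) * influx (n s) k)" for t :: real
  have dP: "(P has_real_derivative damping (n s) k) (at s within {0..T})" if "s \<in> {0..T}" for s
    unfolding P_def[abs_def] by (rule primitive_has_derivative[OF lam that])
  have cP: "continuous_on {0..T} P" by (rule DERIV_continuous_on[OF dP])
  have dQ: "(Q has_real_derivative exp (P t) * influx (n t) k) (at t within {0..T})"
    unfolding Q_def[abs_def] by (rule primitive_has_derivative[OF _ t]) (intro continuous_intros cP gam)
  have "((\<lambda>t. exp (- P t) * (n0 k + Q t)) has_real_derivative influx (n t) k - damping (n t) k * (exp (- P t) * (n0 k + Q t))) (at t within {0..T})"
    by (rule derivative_eq_intros dP[OF t] dQ refl | simp)+ (simp add: algebra_simps exp_minus)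
  then show ?thesis by (simp add: duhamel_def P_def Q_def)
qed

lemma duhamel_0 [simp]: "duhamel n0 n 0 k = n0 k"
proof -
  have "(LINT s:{0..0}|lborel. h s) = 0" for h :: "real \<Rightarrow> real"
    using set_borel_integral_eq_integral(2)[of "{0..0}" h] borel_integrable_atLeastAtMost'[of 0 0 h] by simp
  then show ?thesis by (simp add: duhamel_def)
qed

lemma duhamel_nonneg:
  fixes n :: "real \<Rightarrow> 'a::euclidean_space \<Rightarrow> real"
  assumes "\<And>s. s \<in> {0..t} \<Longrightarrow> 0 \<le> influx (n s) k" "0 \<le> n0 k"
  shows "0 \<le> duhamel n0 n t k"
  unfolding duhamel_def set_lebesgue_integral_def
  using assms by (intro mult_nonneg_nonneg add_nonneg_nonneg Bochner_Integration.integral_nonneg) (auto simp: indicator_def)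

context
  fixes n0 :: "'a::euclidean_space \<Rightarrow> real" and M \<kappa> T :: real
  assumes d: "2 \<le> DIM('a)" and n0: "dominated M n0"
    and kappa: "\<kappa> = 2 * growth_const TYPE('a) * M + 1" and T: "T = ln 2 / \<kappa>"
begin

definition trajectory :: "(real \<Rightarrow> 'a \<Rightarrow> real) \<Rightarrow> bool" where
  "trajectory n \<longleftrightarrow> (\<lambda>(s, k). n s k) \<in> borel_measurable (borel \<Otimes>\<^sub>M borel) \<and>
     (\<forall>t\<in>{0..T}. dominated (M * exp (\<kappa> * t)) (n t)) \<and> (\<forall>k. continuous_on {0..T} (\<lambda>t. n t k))"

text \<open>The time factor is the one of \<open>linear_ode_abs\<close>: growth at rate \<kappa> is
  absorbed into the distance.\<close>

definition close_by :: "real \<Rightarrow> (real \<Rightarrow> 'a \<Rightarrow> real) \<Rightarrow> (real \<Rightarrow> 'a \<Rightarrow> real) \<Rightarrow> bool" where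
  "close_by a n m \<longleftrightarrow> (\<forall>t\<in>{0..T}. \<forall>k. \<bar>n t k - m t k\<bar> \<le> a * exp (\<kappa> * t) * low_weight k)"

lemma M_nonneg: "0 \<le> M"
  using dominatedD(4)[OF n0] .

lemma kappa_ge_1: "1 \<le> \<kappa>"
  using growth_const_nonneg[where 'a = 'a] M_nonneg by (simp add: kappa)

lemma T_pos: "0 < T"
  using kappa_ge_1 by (simp add: T)

lemma exp_bounds:
  assumes "t \<in> {0..T}"
  shows "1 \<le> exp (\<kappa> * t)" "exp (\<kappa> * t) \<le> 2" "M * exp (\<kappa> * t) \<le> 2 * M"
proof -
  have "\<kappa> * t \<le> \<kappa> * T" using assms kappa_ge_1 by (intro mult_left_mono) auto
  also have "\<dots> = ln 2" using kappa_ge_1 by (simp add: T)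
  finally have "exp (\<kappa> * t) \<le> exp (ln 2)" by (simp only: exp_le_cancel_iff)
  then show e: "exp (\<kappa> * t) \<le> 2" by simp
  show "1 \<le> exp (\<kappa> * t)" using assms kappa_ge_1 by simp
  show "M * exp (\<kappa> * t) \<le> 2 * M" using mult_left_mono[OF e M_nonneg] by simp
qed

lemma trajectory_dominated:
  assumes "trajectory n" "t \<in> {0..T}"
  shows "dominated (M * exp (\<kappa> * t)) (n t)" "dominated (2 * M) (n t)"
  using assms dominated_mono exp_bounds(3) unfolding trajectory_def by blast+

lemma trajectory_continuous:
  assumes n: "trajectory n"
  shows "continuous_on {0..T} (\<lambda>t. damping (n t) k)" "continuous_on {0..T} (\<lambda>t. influx (n t) k)"
  by (rule damping_influx_continuous[OF d]; use trajectory_dominated[OF n] n in \<open>auto simp: trajectory_def\<close>)+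

text \<open>T is chosen so that exp(\<kappa>T) = 2, which keeps trajectories below 2M. The unit left
  over in \<kappa> is the margin that makes the contraction factor less than 1.\<close>

lemma growth_le: "growth_const TYPE('a) * (M * exp (\<kappa> * t)) \<le> \<kappa> - 1" if "t \<in> {0..T}"
  using mult_left_mono[OF exp_bounds(3)[OF that] growth_const_nonneg[where 'a = 'a]] by (simp add: kappa)

lemma duhamel_trajectory:
  assumes n: "trajectory n"
  shows "trajectory (duhamel n0 n)"
  unfolding trajectory_def
proof (intro conjI ballI allI)
  show m: "(\<lambda>(s, k). duhamel n0 n s k) \<in> borel_measurable (borel \<Otimes>\<^sub>M borel)"
    by (rule duhamel_measurable) (use n dominatedD(1)[OF n0] in \<open>auto simp: trajectory_def\<close>)
  note D = duhamel_derivative[OF trajectory_continuous[OF n]]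
  show "continuous_on {0..T} (\<lambda>t. duhamel n0 n t k)" for k by (rule DERIV_continuous_on[OF D])
  fix t assume t: "t \<in> {0..T}"
  show "dominated (M * exp (\<kappa> * t)) (duhamel n0 n t)"
    unfolding dominated_def
  proof (intro conjI allI)
    show "duhamel n0 n t \<in> borel_measurable borel"
      using measurable_compose[OF measurable_Pair1' m, of t] by simp
    fix k
    show "0 \<le> duhamel n0 n t k"
      by (rule duhamel_nonneg) (use t dominatedD(2)[OF n0] damping_bounds(3)[OF d trajectory_dominated(1)[OF n]] in auto)
    have "duhamel n0 n t k \<le> (M * sup_weight k) * exp (\<kappa> * t)"
    proof (rule linear_ode_upper[OF D trajectory_continuous(1)[OF n] _ _ t])
      show "duhamel n0 n 0 k \<le> M * sup_weight k" using dominatedD(3)[OF n0] by simp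
      fix s assume s: "s \<in> {0..T}"
      have "influx (n s) k \<le> (damping (n s) k + growth_const TYPE('a) * (M * exp (\<kappa> * s))) * (M * exp (\<kappa> * s) * sup_weight k)"
        by (rule influx_le[OF d trajectory_dominated(1)[OF n s]])
      also have "\<dots> \<le> (\<kappa> + damping (n s) k) * (M * exp (\<kappa> * s) * sup_weight k)"
        using growth_le[OF s] M_nonneg by (intro mult_right_mono) auto
      finally show "influx (n s) k \<le> (\<kappa> + damping (n s) k) * (M * sup_weight k * exp (\<kappa> * s))" by (simp add: mult_ac)
    qed
    then show "duhamel n0 n t k \<le> M * exp (\<kappa> * t) * sup_weight k" by (simp add: mult_ac)
  qed
qed

text \<open>The Duhamel map contracts only where the damping is bounded, that is for bounded \<open>k\<close>; for large
  \<open>k\<close> the two solutions are close because both are dominated by the heavier weight.\<close>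

lemma duhamel_contract:
  assumes e: "0 < \<epsilon>"
  shows "\<exists>\<theta>. 0 \<le> \<theta> \<and> \<theta> < 1 \<and> (\<forall>n m a. trajectory n \<longrightarrow> trajectory m \<longrightarrow> 0 \<le> a \<longrightarrow> close_by a n m \<longrightarrow>
     close_by (max (\<theta> * a) \<epsilon>) (duhamel n0 n) (duhamel n0 m))"
proof -
  \<comment> \<open>Beyond this radius M is at most \<epsilon>|k|, so the spare powers of the heavy
    weight push any difference of images below \<epsilon>.\<close>
  define R where "R = M / \<epsilon>"
  define L where "L = 3 * (2 * M) * transition_const TYPE('a) * (sqrt R ^ 3)"
  have R: "0 \<le> R" using e M_nonneg by (simp add: R_def)
  have L: "0 \<le> L" using R M_nonneg transition_const_nonneg[where 'a = 'a] by (simp add: L_def)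
  \<comment> \<open>The ratio (\<lambda> + \<kappa> - 1)/(\<lambda> + \<kappa>) increases with the
    damping \<lambda>; \<theta> is its value at the upper bound L on the ball of radius R.\<close>
  define \<theta> where "\<theta> = (L + (\<kappa> - 1)) / (L + \<kappa>)"
  have th: "0 \<le> \<theta>" "\<theta> < 1" using L kappa_ge_1 by (simp_all add: \<theta>_def)
  have "close_by (max (\<theta> * a) \<epsilon>) (duhamel n0 n) (duhamel n0 m)"
    if n: "trajectory n" and m: "trajectory m" and a: "0 \<le> a" and close: "close_by a n m" for n m a
    unfolding close_by_def
  proof (intro ballI allI)
    fix t k assume t: "t \<in> {0..T}"
    note Dn = duhamel_trajectory[OF n] and Dm = duhamel_trajectory[OF m]
    show "\<bar>duhamel n0 n t k - duhamel n0 m t k\<bar> \<le> max (\<theta> * a) \<epsilon> * exp (\<kappa> * t) * low_weight k"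
    proof (cases "norm k \<le> R")
      case True
      have "omega k \<le> sqrt R ^ 3" unfolding omega_eq using True by (intro power_mono) auto
      then have lam: "damping (n s) k \<le> L" if "s \<in> {0..T}" for s
      proof -
        have "damping (n s) k \<le> 3 * (2 * M) * transition_const TYPE('a) * omega k"
          by (rule damping_bounds(2)[OF d trajectory_dominated(2)[OF n that]])
        also have "\<dots> \<le> L" unfolding L_def using \<open>omega k \<le> sqrt R ^ 3\<close> M_nonneg transition_const_nonneg[where 'a = 'a]
          by (intro mult_left_mono) auto
        finally show ?thesis .
      qed
      define g where "g s = influx (n s) k - influx (m s) k - (damping (n s) k - damping (m s) k) * duhamel n0 m s k" for s
      have "\<bar>(\<lambda>t. duhamel n0 n t k - duhamel n0 m t k) t\<bar> \<le> (\<theta> * a * low_weight k) * exp (\<kappa> * t)"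
      proof (rule linear_ode_abs[OF _ trajectory_continuous(1)[OF n] _ _ t])
        fix s assume s: "s \<in> {0..T}"
        show "((\<lambda>t. duhamel n0 n t k - duhamel n0 m t k) has_real_derivative
            g s - damping (n s) k * (duhamel n0 n s k - duhamel n0 m s k)) (at s within {0..T})"
          by (rule derivative_eq_intros duhamel_derivative[OF trajectory_continuous[OF n] s]
              duhamel_derivative[OF trajectory_continuous[OF m] s] refl)+ (simp add: g_def algebra_simps)
        let ?e = "exp (\<kappa> * s)"
        have "\<bar>g s\<bar> \<le> (damping (n s) k + growth_const TYPE('a) * (M * ?e)) * ((a * ?e) * low_weight k)"
          unfolding g_def
        proof (rule influx_lipschitz[OF d trajectory_dominated(1)[OF n s] trajectory_dominated(1)[OF m s]])
          show "\<bar>duhamel n0 m s k\<bar> \<le> M * ?e * sup_weight k"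
            using dominatedD(2,3)[OF trajectory_dominated(1)[OF Dm s], of k] by simp
        qed (use a close s in \<open>auto simp: close_by_def\<close>)
        also have "\<dots> \<le> (damping (n s) k + (\<kappa> - 1)) * ((a * ?e) * low_weight k)"
          using growth_le[OF s] a by (intro mult_right_mono) auto
        also have "\<dots> \<le> ((\<kappa> + damping (n s) k) * \<theta>) * ((a * ?e) * low_weight k)"
        proof (rule mult_right_mono)
          have "(damping (n s) k + (\<kappa> - 1)) * (L + \<kappa>) = (\<kappa> + damping (n s) k) * (L + (\<kappa> - 1)) - (L - damping (n s) k)"
            by (simp add: algebra_simps)
          also have "\<dots> \<le> (\<kappa> + damping (n s) k) * (L + (\<kappa> - 1))" using lam[OF s] by simp
          finally show "damping (n s) k + (\<kappa> - 1) \<le> (\<kappa> + damping (n s) k) * \<theta>"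
            using L kappa_ge_1 by (simp add: \<theta>_def pos_le_divide_eq)
        qed (use a in auto)
        finally show "\<bar>g s\<bar> \<le> (\<kappa> + damping (n s) k) * (\<theta> * a * low_weight k * ?e)" by (simp add: mult_ac)
      qed (use th a in auto)
      also have "\<dots> = (\<theta> * a) * (exp (\<kappa> * t) * low_weight k)" by (simp add: mult_ac)
      also have "\<dots> \<le> max (\<theta> * a) \<epsilon> * (exp (\<kappa> * t) * low_weight k)" by (intro mult_right_mono) auto
      finally show ?thesis by (simp add: mult.assoc)
    next
      case False
      then have "M / \<epsilon> < norm k" by (simp add: R_def)
      then have "M \<le> \<epsilon> * norm k" using e by (simp add: pos_divide_less_eq mult.commute)
      also have "\<dots> \<le> \<epsilon> * jap k ^ 10"
      proof -
        have "jap k \<le> jap k ^ 10" using jap_ge(1)[of k] self_le_power[of "jap k" 10] by simp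
        then show ?thesis using jap_ge(2)[of k] e by (intro mult_left_mono) auto
      qed
      finally have "M * sup_weight k \<le> (\<epsilon> * jap k ^ 10) * (low_weight k * (1 / jap k ^ 10))"
        using M_nonneg e by (intro mult_mono sup_weight_le) auto
      then have Mw: "M * sup_weight k \<le> \<epsilon> * low_weight k" by simp
      have "\<bar>duhamel n0 n t k - duhamel n0 m t k\<bar> \<le> M * exp (\<kappa> * t) * sup_weight k"
        using dominatedD(2,3)[OF trajectory_dominated(1)[OF Dm t], of k] dominatedD(2,3)[OF trajectory_dominated(1)[OF Dn t], of k]
        by (auto simp: abs_le_iff)
      also have "\<dots> = exp (\<kappa> * t) * (M * sup_weight k)" by simp
      also have "\<dots> \<le> exp (\<kappa> * t) * (\<epsilon> * low_weight k)" using Mw by (intro mult_left_mono) auto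
      also have "\<dots> = \<epsilon> * (exp (\<kappa> * t) * low_weight k)" by simp
      also have "\<dots> \<le> max (\<theta> * a) \<epsilon> * (exp (\<kappa> * t) * low_weight k)" by (intro mult_right_mono) auto
      finally show ?thesis by (simp add: mult.assoc)
    qed
  qed
  then show ?thesis using th by blast
qed

primrec iterate :: "nat \<Rightarrow> real \<Rightarrow> 'a \<Rightarrow> real" where
  "iterate 0 = (\<lambda>t. n0)"
| "iterate (Suc j) = duhamel n0 (iterate j)"

lemma iterate_trajectory: "trajectory (iterate j)"
proof (induction j)
  case 0
  note [measurable] = dominatedD(1)[OF n0]
  have "dominated (M * exp (\<kappa> * t)) n0" if "t \<in> {0..T}" for t
    by (rule dominated_mono[OF n0]) (use mult_left_mono[OF exp_bounds(1)[OF that] M_nonneg] in simp)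
  then show ?case by (simp add: trajectory_def)
qed (simp add: duhamel_trajectory)

lemma close_by_mono:
  assumes "close_by a n m" "a \<le> b"
  shows "close_by b n m"
proof -
  have "a * exp (\<kappa> * t) * low_weight k \<le> b * exp (\<kappa> * t) * low_weight k" for t and k :: 'a
    using assms(2) by (intro mult_right_mono) auto
  then show ?thesis using assms(1) unfolding close_by_def by (meson order_trans)
qed

text \<open>For fixed \<epsilon> the distance shrinks by \<theta> per step until it reaches the
  floor \<epsilon>, and never exceeds it again. That \<theta> depends on \<epsilon> does no harm.
  The start is uniform in p, because all iterates share one bound.\<close>

lemma iterate_Cauchy:
  assumes e: "0 < \<epsilon>"
  obtains J where "\<And>j p. J \<le> j \<Longrightarrow> close_by \<epsilon> (iterate (j + p)) (iterate j)"
proof -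
  obtain \<theta> where th: "0 \<le> \<theta>" "\<theta> < 1"
    and c: "\<And>n m a. trajectory n \<Longrightarrow> trajectory m \<Longrightarrow> 0 \<le> a \<Longrightarrow> close_by a n m \<Longrightarrow> close_by (max (\<theta> * a) \<epsilon>) (duhamel n0 n) (duhamel n0 m)"
    using duhamel_contract[OF e] by blast
  have step: "close_by (max (\<theta> ^ j * M) \<epsilon>) (iterate (j + p)) (iterate j)" for j p
  proof (induction j)
    case 0
    have "close_by M (iterate p) n" if "n = iterate 0" for n
      unfolding close_by_def
    proof (intro ballI allI)
      fix t k assume t: "t \<in> {0..T}"
      note D = dominatedD[OF trajectory_dominated(1)[OF iterate_trajectory t]]
      show "\<bar>iterate p t k - n t k\<bar> \<le> M * exp (\<kappa> * t) * low_weight k"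
        using D(2,5)[of p k] D(2,5)[of 0 k] that by (auto simp: abs_le_iff)
    qed
    then show ?case using close_by_mono[of M _ _ "max M \<epsilon>"] by simp
  next
    case (Suc j)
    have "close_by (max (\<theta> * max (\<theta> ^ j * M) \<epsilon>) \<epsilon>) (iterate (Suc j + p)) (iterate (Suc j))"
      using c[OF iterate_trajectory iterate_trajectory _ Suc] e by simp
    moreover have "\<theta> * max (\<theta> ^ j * M) \<epsilon> \<le> max (\<theta> ^ Suc j * M) \<epsilon>"
    proof -
      have "\<theta> * \<epsilon> \<le> \<epsilon>" using th e by (simp add: mult_left_le_one_le)
      then show ?thesis by (auto simp: max_def)
    qed
    ultimately show ?case by (auto intro: close_by_mono)
  qed
  have "(\<lambda>j. \<theta> ^ j * M) \<longlonglongrightarrow> 0 * M" using th by (intro tendsto_mult LIMSEQ_power_zero tendsto_const) auto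
  then have "\<forall>\<^sub>F j in sequentially. \<theta> ^ j * M < \<epsilon>" using e by (simp add: order_tendstoD(2))
  then obtain J where J: "\<And>j. J \<le> j \<Longrightarrow> \<theta> ^ j * M < \<epsilon>" by (auto simp: eventually_sequentially)
  show thesis
  proof (rule that[of J])
    fix j p assume "J \<le> j"
    then show "close_by \<epsilon> (iterate (j + p)) (iterate j)" using step[of j p] J[of j] by (simp add: max_def split: if_splits)
  qed
qed

text \<open>Outside the time interval no convergence is asserted; \<open>lim\<close> still has a
  value there, and measurability in (t,k) is unaffected.\<close>

definition limit_flow :: "real \<Rightarrow> 'a \<Rightarrow> real" where
  "limit_flow t k = lim (\<lambda>j. iterate j t k)"

lemma iterate_tendsto:
  assumes t: "t \<in> {0..T}"
  shows "(\<lambda>j. iterate j t k) \<longlonglongrightarrow> limit_flow t k"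
proof -
  have "Cauchy (\<lambda>j. iterate j t k)"
  proof (rule CauchyI')
    fix e :: real assume e: "0 < e"
    obtain J where J: "\<And>j p. J \<le> j \<Longrightarrow> close_by (e / 4) (iterate (j + p)) (iterate j)"
      using iterate_Cauchy[of "e / 4"] e by auto
    have "dist (iterate j t k) (iterate i t k) < e" if "J \<le> j" "j < i" for i j
    proof -
      have "\<bar>iterate (j + (i - j)) t k - iterate j t k\<bar> \<le> (e / 4) * exp (\<kappa> * t) * low_weight k"
        using J[OF that(1)] t by (auto simp: close_by_def)
      also have "\<dots> \<le> (e / 4) * 2 * 1"
        using e exp_bounds[OF t] by (intro mult_mono low_weight_le_1) auto
      also have "\<dots> < e" using e by simp
      finally show ?thesis using that by (simp add: dist_real_def abs_minus_commute)
    qed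
    then show "\<exists>M. \<forall>m\<ge>M. \<forall>n>m. dist (iterate m t k) (iterate n t k) < e" by blast
  qed
  then show ?thesis unfolding limit_flow_def by (simp add: Cauchy_convergent convergent_LIMSEQ_iff[symmetric])
qed

lemma iterate_close_limit:
  assumes e: "0 < \<epsilon>"
  obtains J where "\<And>j. J \<le> j \<Longrightarrow> close_by \<epsilon> limit_flow (iterate j)"
proof -
  obtain J where J: "\<And>j p. J \<le> j \<Longrightarrow> close_by \<epsilon> (iterate (j + p)) (iterate j)" using iterate_Cauchy[OF e] by auto
  have "close_by \<epsilon> limit_flow (iterate j)" if "J \<le> j" for j
    unfolding close_by_def
  proof (intro ballI allI)
    fix t k assume t: "t \<in> {0..T}"
    have "(\<lambda>p. iterate (p + j) t k) \<longlonglongrightarrow> limit_flow t k" using iterate_tendsto[OF t] by (rule LIMSEQ_ignore_initial_segment)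
    then have "(\<lambda>p. \<bar>iterate (p + j) t k - iterate j t k\<bar>) \<longlonglongrightarrow> \<bar>limit_flow t k - iterate j t k\<bar>"
      by (intro tendsto_intros)
    then show "\<bar>limit_flow t k - iterate j t k\<bar> \<le> \<epsilon> * exp (\<kappa> * t) * low_weight k"
      by (rule Lim_bounded[where M = 0]) (use J[OF that] t in \<open>auto simp: close_by_def add.commute\<close>)
  qed
  then show thesis using that by blast
qed

lemma limit_flow_trajectory: "trajectory limit_flow"
  unfolding trajectory_def
proof (intro conjI ballI allI)
  have [measurable]: "(\<lambda>(s, k). iterate j s k) \<in> borel_measurable (borel \<Otimes>\<^sub>M borel)" for j
    using iterate_trajectory[of j] by (simp add: trajectory_def)
  have m: "(\<lambda>x. lim (\<lambda>j. (\<lambda>(s, k). iterate j s k) x)) \<in> borel_measurable (borel \<Otimes>\<^sub>M borel)"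
    by measurable
  then show m: "(\<lambda>(s, k). limit_flow s k) \<in> borel_measurable (borel \<Otimes>\<^sub>M borel)"
    by (simp add: limit_flow_def case_prod_beta')
  show "dominated (M * exp (\<kappa> * t)) (limit_flow t)" if t: "t \<in> {0..T}" for t
    unfolding dominated_def
  proof (intro conjI allI)
    show "limit_flow t \<in> borel_measurable borel"
      using measurable_compose[OF measurable_Pair1' m, of t] by simp
    fix k
    note D = dominatedD[OF trajectory_dominated(1)[OF iterate_trajectory t]]
    show "0 \<le> limit_flow t k" by (rule LIMSEQ_le_const[OF iterate_tendsto[OF t]]) (use D in auto)
    show "limit_flow t k \<le> M * exp (\<kappa> * t) * sup_weight k" by (rule LIMSEQ_le_const2[OF iterate_tendsto[OF t]]) (use D in auto)
  qed
  show "continuous_on {0..T} (\<lambda>t. limit_flow t k)" for k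
  proof (rule uniform_limit_theorem)
    show "\<forall>\<^sub>F j in sequentially. continuous_on {0..T} (\<lambda>t. iterate j t k)"
      using iterate_trajectory by (simp add: trajectory_def)
    show "uniform_limit {0..T} (\<lambda>j t. iterate j t k) (\<lambda>t. limit_flow t k) sequentially"
    proof (rule uniform_limitI)
      fix e :: real assume e: "0 < e"
      obtain J where J: "\<And>j. J \<le> j \<Longrightarrow> close_by (e / 4) limit_flow (iterate j)" using iterate_close_limit[of "e / 4"] e by auto
      have "dist (iterate j t k) (limit_flow t k) < e" if "J \<le> j" "t \<in> {0..T}" for j t
      proof -
        have "\<bar>limit_flow t k - iterate j t k\<bar> \<le> (e / 4) * exp (\<kappa> * t) * low_weight k"
          using J[OF that(1)] that(2) by (auto simp: close_by_def)
        also have "\<dots> \<le> (e / 4) * 2 * 1"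
          using e exp_bounds[OF that(2)] by (intro mult_mono low_weight_le_1) auto
        also have "\<dots> < e" using e by simp
        finally show ?thesis by (simp add: dist_real_def abs_minus_commute)
      qed
      then show "\<forall>\<^sub>F j in sequentially. \<forall>t\<in>{0..T}. dist (iterate j t k) (limit_flow t k) < e"
        unfolding eventually_sequentially by blast
    qed
  qed simp
qed

lemma limit_flow_fixed:
  assumes t: "t \<in> {0..T}"
  shows "duhamel n0 limit_flow t k = limit_flow t k"
proof -
  have "\<bar>duhamel n0 limit_flow t k - limit_flow t k\<bar> \<le> e" if e: "0 < e" for e
  proof -
    \<comment> \<open>The image of the limit and the limit itself are both compared with one
      iterate. Since exp(\<kappa>t) is at most 2, the tolerance e/4 gives an error of e/2 for
      each.\<close>
    obtain \<theta> where th: "0 \<le> \<theta>" "\<theta> < 1"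
      and c: "\<And>n m a. trajectory n \<Longrightarrow> trajectory m \<Longrightarrow> 0 \<le> a \<Longrightarrow> close_by a n m \<Longrightarrow> close_by (max (\<theta> * a) (e / 4)) (duhamel n0 n) (duhamel n0 m)"
      using duhamel_contract[of "e / 4"] e by auto
    obtain J where J: "\<And>j. J \<le> j \<Longrightarrow> close_by (e / 4) limit_flow (iterate j)" using iterate_close_limit[of "e / 4"] e by auto
    have "\<theta> * (e / 4) \<le> e / 4" using th e by (simp add: mult_left_le_one_le)
    then have "close_by (e / 4) (duhamel n0 limit_flow) (iterate (Suc J))"
      using c[OF limit_flow_trajectory iterate_trajectory _ J[of J]] e by (simp add: max_def split: if_splits)
    then have "\<bar>duhamel n0 limit_flow t k - iterate (Suc J) t k\<bar> \<le> (e / 4) * exp (\<kappa> * t) * low_weight k"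
      using t by (auto simp: close_by_def)
    moreover have "\<bar>limit_flow t k - iterate (Suc J) t k\<bar> \<le> (e / 4) * exp (\<kappa> * t) * low_weight k"
      using J[of "Suc J"] t by (auto simp: close_by_def)
    moreover have "(e / 4) * exp (\<kappa> * t) * low_weight k \<le> (e / 4) * 2 * 1"
      using e exp_bounds[OF t] by (intro mult_mono low_weight_le_1) auto
    ultimately show ?thesis by linarith
  qed
  then have "\<bar>duhamel n0 limit_flow t k - limit_flow t k\<bar> \<le> 0" by (rule field_le_epsilon) simp
  then show ?thesis by simp
qed

lemma kinetic_solution:
  obtains n where "\<And>t. t \<in> {0..T} \<Longrightarrow> dominated (2 * M) (n t)" "\<And>k. n 0 k = n0 k"
    "\<And>k. continuous_on {0..T} (\<lambda>t. S (n t) k)"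
    "\<And>t k. t \<in> {0..T} \<Longrightarrow> ((\<lambda>t. n t k) has_real_derivative S (n t) k) (at t within {0..T})"
proof (rule that[of limit_flow])
  note L = limit_flow_trajectory
  note c = trajectory_continuous[OF L]
  have S: "S (limit_flow t) k = influx (limit_flow t) k - damping (limit_flow t) k * limit_flow t k" if "t \<in> {0..T}" for t k
    by (rule S_eq_influx(1)[OF d trajectory_dominated(2)[OF L that]])
  show "dominated (2 * M) (limit_flow t)" if "t \<in> {0..T}" for t by (rule trajectory_dominated(2)[OF L that])
  show "limit_flow 0 k = n0 k" for k using limit_flow_fixed[of 0 k] T_pos by simp
  have "continuous_on {0..T} (\<lambda>t. influx (limit_flow t) k - damping (limit_flow t) k * limit_flow t k)" for k
    using L by (intro continuous_intros c) (auto simp: trajectory_def)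
  then show "continuous_on {0..T} (\<lambda>t. S (limit_flow t) k)" for k by (simp add: S cong: continuous_on_cong_simp)
  fix t k assume t: "t \<in> {0..T}"
  have "((\<lambda>t. duhamel n0 limit_flow t k) has_derivative (*) (S (limit_flow t) k)) (at t within {0..T})"
    using duhamel_derivative[OF c t, of n0] unfolding has_field_derivative_def S[OF t] limit_flow_fixed[OF t] .
  then have "((\<lambda>t. limit_flow t k) has_derivative (*) (S (limit_flow t) k)) (at t within {0..T})"
    by (rule has_derivative_transform[OF t, rotated]) (simp add: limit_flow_fixed)
  then show "((\<lambda>t. limit_flow t k) has_real_derivative S (limit_flow t) k) (at t within {0..T})"
    unfolding has_field_derivative_def .
qed

end

section \<open>Weighted Lebesgue spaces and the solution\<close>

lemma jap_powr_nat: "jap k powr real m = jap k ^ m"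
  by (rule powr_realpow) simp

lemma lebesgue_measurable_jap_mult:
  assumes "f \<in> borel_measurable lebesgue"
  shows "(\<lambda>k. ennreal \<bar>jap k powr s * f k\<bar>) \<in> borel_measurable lebesgue"
proof -
  have [measurable]: "jap \<in> borel_measurable lebesgue"
    by (rule measurable_completion) simp
  show ?thesis using assms by measurable
qed

lemma wnorm_infty_le:
  fixes f :: "'a::euclidean_space \<Rightarrow> real"
  assumes f: "f \<in> borel_measurable borel" and le: "\<And>k. \<bar>f k\<bar> \<le> c * (1 / jap k ^ m)"
  shows "wnorm \<infinity> (real m) f \<le> ennreal c"
  unfolding wnorm_def if_P[OF refl]
proof (rule esssup_I)
  have "f \<in> borel_measurable lebesgue" by (rule measurable_completion) (simp add: f)
  then show "(\<lambda>k. ennreal \<bar>jap k powr real m * f k\<bar>) \<in> borel_measurable lebesgue"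
    by (rule lebesgue_measurable_jap_mult)
  have "\<bar>jap k powr real m * f k\<bar> \<le> c" for k
    using le[of k] by (simp add: jap_powr_nat abs_mult field_simps)
  then show "AE k in lebesgue. ennreal \<bar>jap k powr real m * f k\<bar> \<le> ennreal c"
    by (intro AE_I2 ennreal_leI)
qed

lemma AE_wnorm_infty:
  assumes "wnorm \<infinity> (real m) f < \<infinity>"
  shows "AE k in lebesgue. \<bar>f k\<bar> \<le> enn2real (wnorm \<infinity> (real m) f) * (1 / jap k ^ m)"
proof -
  let ?N = "wnorm \<infinity> (real m) f"
  have N: "?N = ennreal (enn2real ?N)" using assms by simp
  have "AE k in lebesgue. ennreal \<bar>jap k powr real m * f k\<bar> \<le> ?N"
    unfolding wnorm_def if_P[OF refl] by (rule esssup_AE)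
  then show ?thesis
  proof eventually_elim
    case (elim k)
    then have "\<bar>jap k powr real m * f k\<bar> \<le> enn2real ?N"
      by (subst (asm) N) (simp add: ennreal_le_iff)
    then show ?case by (simp add: jap_powr_nat abs_mult field_simps)
  qed
qed

text \<open>The summand 1 keeps the constant positive, so that its product with an infinite norm is
  infinite.\<close>

definition low_weight_mass :: "'a::euclidean_space itself \<Rightarrow> real" where
  "low_weight_mass _ = 1 + unit_ball_vol (real DIM('a)) * shell_const DIM('a)"

lemma low_weight_mass_ge_1: "1 \<le> low_weight_mass TYPE('a::euclidean_space)"
  by (simp add: low_weight_mass_def shell_const_nonneg)

lemma nn_integral_low_weight:
  "(\<integral>\<^sup>+ k. ennreal (low_weight k) \<partial>(lebesgue :: 'a::euclidean_space measure)) \<le> ennreal (low_weight_mass TYPE('a))"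
proof -
  have "(\<integral>\<^sup>+ k. ennreal (low_weight k) \<partial>(lebesgue :: 'a measure)) = (\<integral>\<^sup>+ k. ennreal (low_weight (k::'a)) \<partial>lborel)"
    by (rule nn_integral_completion)
  also have "\<dots> \<le> (\<integral>\<^sup>+ k. ennreal (1 / jap (k - 0) ^ (DIM('a) + 2)) \<partial>(lborel :: 'a measure))"
  proof (intro nn_integral_mono ennreal_leI)
    fix k :: 'a
    have "jap k ^ (DIM('a) + 2) \<le> jap k ^ (2 * DIM('a) + 2)" using jap_ge(1)[of k] by (intro power_increasing) auto
    then show "low_weight k \<le> 1 / jap (k - 0) ^ (DIM('a) + 2)"
      unfolding low_weight_def diff_zero by (rule divide_left_mono) simp_all
  qed
  also have "\<dots> \<le> ennreal (unit_ball_vol (real DIM('a)) * shell_const DIM('a))"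
    by (rule nn_integral_jap_le) (auto simp: emeasure_cball)
  also have "\<dots> \<le> ennreal (low_weight_mass TYPE('a))"
    unfolding low_weight_mass_def by (intro ennreal_leI) simp
  finally show ?thesis .
qed

lemma wnorm_1_le:
  fixes f :: "'a::euclidean_space \<Rightarrow> real"
  shows "wnorm 1 0 f \<le> ennreal (low_weight_mass TYPE('a)) * wnorm \<infinity> (2 * (real DIM('a) + 1)) f"
proof (cases "wnorm \<infinity> (2 * (real DIM('a) + 1)) f < \<infinity>")
  case False
  then have "wnorm \<infinity> (2 * (real DIM('a) + 1)) f = \<infinity>" by (simp add: less_top[symmetric])
  then show ?thesis using low_weight_mass_ge_1[where 'a = 'a] by (simp add: ennreal_mult_top)
next
  case True
  let ?N = "wnorm \<infinity> (2 * (real DIM('a) + 1)) f"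
  have s: "2 * (real DIM('a) + 1) = real (2 * DIM('a) + 2)" by simp
  have AE: "AE k in lebesgue. \<bar>f k\<bar> \<le> enn2real ?N * (1 / jap k ^ (2 * DIM('a) + 2))"
    using AE_wnorm_infty[of "2 * DIM('a) + 2" f] True unfolding s by simp
  have "(\<integral>\<^sup>+ k. ennreal \<bar>f k\<bar> \<partial>lebesgue) \<le> (\<integral>\<^sup>+ k. ?N * ennreal (low_weight (k::'a)) \<partial>lebesgue)"
  proof (rule nn_integral_mono_AE)
    show "AE k in lebesgue. ennreal \<bar>f k\<bar> \<le> ?N * ennreal (low_weight k)"
      using AE
    proof eventually_elim
      case (elim k)
      have "ennreal \<bar>f k\<bar> \<le> ennreal (enn2real ?N * low_weight k)" using elim by (intro ennreal_leI) (simp add: low_weight_def)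
      also have "\<dots> = ?N * ennreal (low_weight k)" using True by (simp add: ennreal_mult)
      finally show ?case .
    qed
  qed
  also have "\<dots> = ?N * (\<integral>\<^sup>+ k. ennreal (low_weight (k::'a)) \<partial>lebesgue)"
    by (rule nn_integral_cmult) (rule measurable_completion, simp)
  also have "\<dots> \<le> ?N * ennreal (low_weight_mass TYPE('a))" by (intro mult_left_mono nn_integral_low_weight) auto
  finally have I: "(\<integral>\<^sup>+ k. ennreal \<bar>f k\<bar> \<partial>lebesgue) \<le> ennreal (low_weight_mass TYPE('a)) * ?N" by (simp add: mult.commute)
  also have "\<dots> < \<infinity>" using True by (simp add: ennreal_mult_less_top)
  finally have fin: "(\<integral>\<^sup>+ k. ennreal \<bar>f k\<bar> \<partial>lebesgue) < \<infinity>" .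
  define J where "J = (\<integral>\<^sup>+ k. ennreal \<bar>f k\<bar> \<partial>lebesgue)"
  have J: "(\<integral>\<^sup>+ k. ennreal (\<bar>jap k powr 0 * f k\<bar> powr enn2real 1) \<partial>lebesgue) = J"
    by (simp add: J_def)
  have "J < top" using fin by (simp add: J_def)
  then have "wnorm 1 0 f = J" unfolding wnorm_def J Let_def by auto
  then show ?thesis using I by (simp add: J_def)
qed

lemma C_wLp_subset_L1:
  "(C_wLp \<tau> \<infinity> (2 * (real DIM('a) + 1)) :: (real \<Rightarrow> 'a::euclidean_space \<Rightarrow> real) set) \<subseteq> C_wLp \<tau> 1 0"
proof
  fix n :: "real \<Rightarrow> 'a \<Rightarrow> real"
  let ?s = "2 * (real DIM('a) + 1)"
  let ?K = "ennreal (low_weight_mass TYPE('a))"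
  assume n: "n \<in> C_wLp \<tau> \<infinity> ?s"
  have "n t \<in> wLp 1 0" if "t \<in> {0..\<tau>}" for t
  proof -
    have "n t \<in> wLp \<infinity> ?s" using n that by (simp add: C_wLp_def)
    then have "n t \<in> borel_measurable lebesgue" "?K * wnorm \<infinity> ?s (n t) < \<infinity>"
      by (auto simp: wLp_def ennreal_mult_less_top)
    then show ?thesis using wnorm_1_le[of "n t"] by (auto simp: wLp_def intro: le_less_trans)
  qed
  moreover have "((\<lambda>r. wnorm 1 0 (\<lambda>k. n r k - n t k)) \<longlongrightarrow> 0) (at t within {0..\<tau>})" if "t \<in> {0..\<tau>}" for t
  proof (rule tendsto_sandwich[OF _ _ tendsto_const])
    have "((\<lambda>r. wnorm \<infinity> ?s (\<lambda>k. n r k - n t k)) \<longlongrightarrow> 0) (at t within {0..\<tau>})"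
      using n that by (simp add: C_wLp_def)
    then show "((\<lambda>r. ?K * wnorm \<infinity> ?s (\<lambda>k. n r k - n t k)) \<longlongrightarrow> 0) (at t within {0..\<tau>})"
      using ennreal_tendsto_cmult[of ?K _ 0] by fastforce
    show "\<forall>\<^sub>F r in at t within {0..\<tau>}. wnorm 1 0 (\<lambda>k. n r k - n t k) \<le> ?K * wnorm \<infinity> ?s (\<lambda>k. n r k - n t k)"
      by (intro always_eventually allI wnorm_1_le)
  qed simp
  ultimately show "n \<in> C_wLp \<tau> 1 0" by (simp add: C_wLp_def)
qed

text \<open>The factor \<open>omega k\<close> is absorbed by the gap between the weights. Hence
  solutions are Lipschitz in time for the norm with exponent 2(d+1), which yields the required
  continuity.\<close>

lemma S_bound:
  fixes n :: "'a::euclidean_space \<Rightarrow> real"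
  assumes d: "2 \<le> DIM('a)" and n: "dominated \<beta> n"
  shows "\<bar>S n k\<bar> \<le> \<beta> * \<beta> * (6 * transition_const TYPE('a) + growth_const TYPE('a)) * low_weight k"
proof -
  define C G where "C = transition_const TYPE('a)" and "G = growth_const TYPE('a)"
  have CG: "0 \<le> C" "0 \<le> G" by (simp_all add: C_def G_def transition_const_nonneg growth_const_nonneg)
  note N = dominatedD[OF n] and D = damping_bounds[OF d n, of k, folded C_def]
  have "damping n k * n k \<le> (3 * \<beta> * C * omega k) * (\<beta> * sup_weight k)"
    using D N CG by (intro mult_mono) auto
  moreover have "influx n k \<le> (3 * \<beta> * C * omega k + G * \<beta>) * (\<beta> * sup_weight k)"
    using influx_le[OF d n, of k, folded G_def] mult_right_mono[OF D(2), of "\<beta> * sup_weight k"] N(4)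
    by (simp add: distrib_right)
  moreover have "0 \<le> damping n k * n k" using D N by simp
  ultimately have "\<bar>S n k\<bar> \<le> (6 * \<beta> * C * omega k + G * \<beta>) * (\<beta> * sup_weight k)"
    unfolding S_eq_influx(1)[OF d n] using D(3) by (simp add: algebra_simps abs_le_iff)
  also have "\<dots> = \<beta> * \<beta> * (6 * C * (sup_weight k * omega k) + G * sup_weight k)" by (simp add: algebra_simps)
  also have "\<dots> \<le> \<beta> * \<beta> * (6 * C * low_weight k + G * low_weight k)"
    using CG N(4) by (intro mult_left_mono add_mono sup_weight_omega_le sup_weight_le_low) auto
  also have "\<dots> = \<beta> * \<beta> * (6 * C + G) * low_weight k" by (simp add: algebra_simps)
  finally show ?thesis by (simp add: C_def G_def)
qed

text \<open>The datum is known only up to null sets, whereas the iteration needs a Borel function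
  bounded at every point. A Borel version is cut off between 0 and its almost-everywhere
  bound.\<close>

lemma dominated_representative:
  fixes n0 :: "'a::euclidean_space \<Rightarrow> real"
  assumes n0: "n0 \<in> wLp \<infinity> (4 * real DIM('a) + 12)" and pos: "AE k in lebesgue. 0 \<le> n0 k"
  obtains m0 where "dominated (enn2real (wnorm \<infinity> (4 * real DIM('a) + 12) n0)) m0" "AE k in lebesgue. m0 k = n0 k"
proof -
  define M where "M = enn2real (wnorm \<infinity> (4 * real DIM('a) + 12) n0)"
  have s: "4 * real DIM('a) + 12 = real (4 * DIM('a) + 12)" by simp
  have le: "AE k in lebesgue. \<bar>n0 k\<bar> \<le> M * sup_weight k"
    using AE_wnorm_infty[of "4 * DIM('a) + 12" n0] n0 unfolding s M_def sup_weight_def wLp_def by simp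
  obtain g where g [measurable]: "g \<in> borel_measurable lborel" and eq: "AE k in lborel. n0 k = g k"
    using completion_ex_borel_measurable_real[of n0 lborel] n0 by (auto simp: wLp_def)
  define m0 where "m0 k = max 0 (min (g k) (M * sup_weight k))" for k
  have M: "0 \<le> M" by (simp add: M_def)
  have "dominated M m0" unfolding dominated_def m0_def[abs_def] using M by auto
  moreover have "AE k in lebesgue. m0 k = n0 k"
    using le pos AE_completion[OF eq] by eventually_elim (simp add: m0_def)
  ultimately show thesis using that unfolding M_def by blast
qed

theorem theorem1p1:
  assumes "DIM('a::euclidean_space) \<ge> 2"
  shows "\<exists>T :: ennreal \<Rightarrow> real. \<forall>n0 :: 'a \<Rightarrow> real.
    n0 \<in> wLp \<infinity> (4 * real DIM('a) + 12) \<and> (AE k in lebesgue. 0 \<le> n0 k) \<longrightarrow>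
    (let M = wnorm \<infinity> (4 * real DIM('a) + 12) n0; \<tau> = T M in
      0 < \<tau> \<and>
      (C_wLp \<tau> \<infinity> (2 * (real DIM('a) + 1)) :: (real \<Rightarrow> 'a \<Rightarrow> real) set) \<subseteq> C_wLp \<tau> 1 0 \<and>
      (\<exists>n \<in> C_wLp \<tau> \<infinity> (2 * (real DIM('a) + 1)).
         strong_solution \<tau> n0 n \<and>
         (SUP t\<in>{0..\<tau>}. wnorm \<infinity> (4 * real DIM('a) + 12) (n t)) \<le> 2 * M))"
proof (intro exI allI impI, elim conjE)
  \<comment> \<open>The norm of admissible data is finite, so \<open>enn2real\<close> loses
    nothing.\<close>
  define T where "T N = ln 2 / (2 * growth_const TYPE('a) * enn2real N + 1)" for N
  fix n0 :: "'a \<Rightarrow> real"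
  assume n0: "n0 \<in> wLp \<infinity> (4 * real DIM('a) + 12)" and pos: "AE k in lebesgue. 0 \<le> n0 k"
  define N where "N = wnorm \<infinity> (4 * real DIM('a) + 12) n0"
  define M where "M = enn2real N"
  define \<tau> where "\<tau> = T N"
  have N: "N = ennreal M" using n0 by (simp add: M_def N_def wLp_def)
  obtain m0 where m0: "dominated M m0" and m0_eq: "AE k in lebesgue. m0 k = n0 k"
    using dominated_representative[OF n0 pos] unfolding M_def N_def by blast
  have M: "0 \<le> M" by (simp add: M_def)
  have tau: "0 < \<tau>"
    using growth_const_nonneg[where 'a = 'a] M by (simp add: \<tau>_def T_def M_def[symmetric] add_nonneg_pos)
  obtain n where dom: "\<And>t. t \<in> {0..\<tau>} \<Longrightarrow> dominated (2 * M) (n t)" and init: "\<And>k. n 0 k = m0 k"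
    and cont: "\<And>k. continuous_on {0..\<tau>} (\<lambda>t. S (n t) k)"
    and der: "\<And>t k. t \<in> {0..\<tau>} \<Longrightarrow> ((\<lambda>t. n t k) has_real_derivative S (n t) k) (at t within {0..\<tau>})"
    using kinetic_solution[OF assms m0 refl refl] unfolding \<tau>_def T_def M_def by blast
  define B where "B = (2 * M) * (2 * M) * (6 * transition_const TYPE('a) + growth_const TYPE('a))"
  have lip: "\<bar>n r k - n t k\<bar> \<le> (B * \<bar>r - t\<bar>) * low_weight k" if "r \<in> {0..\<tau>}" "t \<in> {0..\<tau>}" for r t k
  proof -
    have "norm (n r k - n t k) \<le> (B * low_weight k) * norm (r - t)"
      by (rule field_differentiable_bound[where S = "{0..\<tau>}" and f' = "\<lambda>t. S (n t) k"])
         (use der S_bound[OF assms dom] that in \<open>auto simp: B_def\<close>)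
    then show ?thesis by (simp add: mult_ac)
  qed
  have s: "2 * (real DIM('a) + 1) = real (2 * DIM('a) + 2)" "4 * real DIM('a) + 12 = real (4 * DIM('a) + 12)" by simp_all
  have meas: "n t \<in> borel_measurable lebesgue" if "t \<in> {0..\<tau>}" for t
    by (rule measurable_completion) (use dominatedD(1)[OF dom[OF that]] in simp)
  have nC: "n \<in> C_wLp \<tau> \<infinity> (2 * (real DIM('a) + 1))"
    unfolding C_wLp_def
  proof (intro CollectI conjI ballI)
    fix t assume t: "t \<in> {0..\<tau>}"
    have "wnorm \<infinity> (real (2 * DIM('a) + 2)) (n t) \<le> ennreal (2 * M)"
      by (rule wnorm_infty_le) (use dominatedD(1,2,5)[OF dom[OF t]] in \<open>auto simp: low_weight_def\<close>)
    then show "n t \<in> wLp \<infinity> (2 * (real DIM('a) + 1))"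
      unfolding s wLp_def using meas[OF t] by (auto intro: le_less_trans)
    show "((\<lambda>r. wnorm \<infinity> (2 * (real DIM('a) + 1)) (\<lambda>k. n r k - n t k)) \<longlongrightarrow> 0) (at t within {0..\<tau>})"
    proof (rule tendsto_sandwich[OF _ _ tendsto_const])
      have "((\<lambda>r. B * \<bar>r - t\<bar>) \<longlongrightarrow> B * \<bar>t - t\<bar>) (at t within {0..\<tau>})" by (intro tendsto_intros)
      then show "((\<lambda>r. ennreal (B * \<bar>r - t\<bar>)) \<longlongrightarrow> 0) (at t within {0..\<tau>})"
        using tendsto_ennrealI[of _ 0] by fastforce
      have "wnorm \<infinity> (2 * (real DIM('a) + 1)) (\<lambda>k. n r k - n t k) \<le> ennreal (B * \<bar>r - t\<bar>)" if r: "r \<in> {0..\<tau>}" for r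
        unfolding s
      proof (rule wnorm_infty_le)
        show "(\<lambda>k. n r k - n t k) \<in> borel_measurable borel"
          using dominatedD(1)[OF dom[OF r]] dominatedD(1)[OF dom[OF t]] by measurable
        show "\<bar>n r k - n t k\<bar> \<le> B * \<bar>r - t\<bar> * (1 / jap k ^ (2 * DIM('a) + 2))" for k
          using lip[OF r t, of k] by (simp add: low_weight_def)
      qed
      then show "\<forall>\<^sub>F r in at t within {0..\<tau>}. wnorm \<infinity> (2 * (real DIM('a) + 1)) (\<lambda>k. n r k - n t k) \<le> ennreal (B * \<bar>r - t\<bar>)"
        by (auto simp: eventually_at_filter intro: always_eventually)
    qed auto
  qed
  have sol: "strong_solution \<tau> n0 n"
    unfolding strong_solution_def
  proof (intro conjI ballI)
    show "AE k in lebesgue. 0 \<le> n t k" if "t \<in> {0..\<tau>}" for t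
      using dominatedD(2)[OF dom[OF that]] by simp
    show "AE k in lebesgue. n 0 k = n0 k" using m0_eq by (simp add: init)
    show "AE k in lebesgue. S_converges (n t) k" if "t \<in> {0..\<tau>}" for t
      using S_eq_influx(2)[OF assms dom[OF that]] by simp
    fix t assume t: "t \<in> {0..\<tau>}"
    \<comment> \<open>This holds at every k for the representative m0. The only exceptional null set
      is where m0 and n0 differ, and it is the same for all t.\<close>
    have "set_integrable lebesgue {0..t} (\<lambda>s. S (n s) k) \<and> n t k = m0 k + (LINT s:{0..t}|lebesgue. S (n s) k)" for k
    proof -
      have "continuous_on {0..t} (\<lambda>s. S (n s) k)" by (rule continuous_on_subset[OF cont]) (use t in auto)
      then have i: "set_integrable lebesgue {0..t} (\<lambda>s. S (n s) k)" by (rule absolutely_integrable_continuous_real)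
      have "((\<lambda>s. S (n s) k) has_integral n t k - n 0 k) {0..t}"
      proof (rule fundamental_theorem_of_calculus)
        fix x assume x: "x \<in> {0..t}"
        have "((\<lambda>t. n t k) has_real_derivative S (n x) k) (at x within {0..t})"
          by (rule DERIV_subset[OF der]) (use x t in auto)
        then show "((\<lambda>t. n t k) has_vector_derivative S (n x) k) (at x within {0..t})"
          by (simp add: has_real_derivative_iff_has_vector_derivative)
      qed (use t in simp)
      then have "(LINT s:{0..t}|lebesgue. S (n s) k) = n t k - m0 k"
        unfolding set_lebesgue_integral_eq_integral(2)[OF i] init by (rule integral_unique)
      then show ?thesis using i by simp
    qed
    then show "AE k in lebesgue. set_integrable lebesgue {0..t} (\<lambda>s. S (n s) k) \<and> n t k = n0 k + (LINT s:{0..t}|lebesgue. S (n s) k)"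
      using m0_eq by (auto elim: eventually_mono)
  qed
  have "(SUP t\<in>{0..\<tau>}. wnorm \<infinity> (4 * real DIM('a) + 12) (n t)) \<le> 2 * N"
  proof (rule SUP_least)
    fix t assume t: "t \<in> {0..\<tau>}"
    have "wnorm \<infinity> (real (4 * DIM('a) + 12)) (n t) \<le> ennreal (2 * M)"
      by (rule wnorm_infty_le) (use dominatedD(1,2,3)[OF dom[OF t]] in \<open>auto simp: sup_weight_def\<close>)
    then show "wnorm \<infinity> (4 * real DIM('a) + 12) (n t) \<le> 2 * N"
      unfolding s N using M by (simp add: ennreal_mult)
  qed
  then show "let M = wnorm \<infinity> (4 * real DIM('a) + 12) n0; \<tau> = T M in
      0 < \<tau> \<and>
      (C_wLp \<tau> \<infinity> (2 * (real DIM('a) + 1)) :: (real \<Rightarrow> 'a \<Rightarrow> real) set) \<subseteq> C_wLp \<tau> 1 0 \<and>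
      (\<exists>n \<in> C_wLp \<tau> \<infinity> (2 * (real DIM('a) + 1)).
         strong_solution \<tau> n0 n \<and>
         (SUP t\<in>{0..\<tau>}. wnorm \<infinity> (4 * real DIM('a) + 12) (n t)) \<le> 2 * M)"
    unfolding Let_def N_def[symmetric] \<tau>_def[symmetric]
    using tau C_wLp_subset_L1 nC sol by blast
qed

end
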